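(* Let $1<p<\infty$ and let $\Phi:\mathbb{N}\to\mathbb{R}$. Suppose that for some $n_0\in\mathbb{N}$ and some $0<\gamma<1$, $$\Phi(k)=h\left(\frac{1}{r_k^{\gamma}}\right),\qquad k\ge n_0,$$ where $h$ is an analytic function in a neighborhood of zero (in particular the right-hand side is defined for all $k\ge n_0$). Then the multiplier operator $T_\Phi$ associated to $\Phi$, defined on polynomials $f\in\mathcal{P}$ by $T_\Phi f=\sum_{n=0}^\infty\Phi(n)J_n^{\alpha,\beta}f$, admits a continuous extension to $L^p([-1,1]^d,\mu^d_{\alpha,\beta})$.
   Context: $\mathbb{N}=\{0,1,2,\dots\}$. Fix $d\ge 1$ and $\alpha=(\alpha_1,\dots,\alpha_d),\ \beta=(\beta_1,\dots,\beta_d)\in\mathbb{R}^d$ with $\alpha_i,\beta_i>-\frac12$ for all $i$. The normalized Jacobi measure on $[-1,1]^d$ is the probability measure $\mu^d_{\alpha,\beta}(dx)=\prod_{i=1}^d \frac{1}{2^{\alpha_i+\beta_i+1}B(\alpha_i+1,\beta_i+1)}(1-x_i)^{\alpha_i}(1+x_i)^{\beta_i}dx_i$, where $B$ is the Beta function. $\mathcal{P}$ is the set of polynomials in $d$ variables. For $n\in\mathbb{N}$ and real $a,b>-1$, $p_n^{a,b}$ is the one-dimensional Jacobi polynomial of degree $n$, given by Rodrigues' formula $(1-x)^a(1+x)^b c_n p_n^{a,b}(x)=\frac{(-1)^n}{2^n n!}\frac{d^n}{dx^n}\{(1-x)^{a+n}(1+x)^{b+n}\}$, with constant $c_n>0$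 chosen so that $p_n^{a,b}$ has $L^2$ norm $1$ with respect to the one-dimensional normalized Jacobi measure. For $\kappa=(\kappa_1,\dots,\kappa_d)\in\mathbb{N}^d$ put $\vec p_\kappa^{\,\alpha,\beta}(x)=\prod_{i=1}^d p_{\kappa_i}^{\alpha_i,\beta_i}(x_i)$; these form an orthonormal basis of $L^2([-1,1]^d,\mu^d_{\alpha,\beta})$. Put $\lambda_\kappa=\sum_{i=1}^d\kappa_i(\kappa_i+\alpha_i+\beta_i+1)$. The set $\{\lambda_\kappa:\kappa\in\mathbb{N}^d\}$ is written in increasing order as $\{r_n\}_{n=0}^\infty$, $0=r_0<r_1<r_2<\cdots$, and $A_n^{\alpha,\beta}=\{\kappa\in\mathbb{N}^d:\lambda_\kappa=r_n\}$. $J_n^{\alpha,\beta}$ is the orthogonal projection of $L^2([-1,1]^d,\mu^d_{\alpha,\beta})$ onto the span of $\{\vec p_\kappa^{\,\alpha,\beta}:\kappa\in A_n^{\alpha,\beta}\}$, i.e. $J_n^{\alpha,\beta}f=\sum_{\kappa\in A_n^{\alpha,\beta}}\hat f(\kappa)\,\vec p_\kappa^{\,\alpha,\beta}$ with $\hat f(\kappa)=\int_{[-1,1]^d} f\,\vec p_\kappa^{\,\alpha,\beta}\,d\mu^d_{\alpha,\beta}$. For a polynomial $f$ only finitely many $J_n^{\alpha,\beta}f$ are nonzero. *)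

theory Defs
  imports "HOL-Analysis.Analysis"
begin

definition Lp_space :: "real \<Rightarrow> 'a measure \<Rightarrow> ('a \<Rightarrow> real) set" where
  "Lp_space p M = {f \<in> borel_measurable M. integrable M (\<lambda>x. \<bar>f x\<bar> powr p)}"

definition Lp_norm :: "real \<Rightarrow> 'a measure \<Rightarrow> ('a \<Rightarrow> real) \<Rightarrow> real" where
  "Lp_norm p M f = (LINT x|M. \<bar>f x\<bar> powr p) powr (1 / p)"

(* Elements of L^p(M) are represented by functions, so that equality in L^p(M) is equality
   almost everywhere; the second conjunct says that T descends to the quotient. *)
definition Lp_bounded_linear ::
    "real \<Rightarrow> 'a measure \<Rightarrow> (('a \<Rightarrow> real) \<Rightarrow> ('a \<Rightarrow> real)) \<Rightarrow> bool" where
  "Lp_bounded_linear p M T \<longleftrightarrow>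
     (\<forall>f\<in>Lp_space p M. T f \<in> Lp_space p M) \<and>
     (\<forall>f\<in>Lp_space p M. \<forall>g\<in>Lp_space p M.
        (AE x in M. f x = g x) \<longrightarrow> (AE x in M. T f x = T g x)) \<and>
     (\<forall>f\<in>Lp_space p M. \<forall>g\<in>Lp_space p M. \<forall>a b.
        AE x in M. T (\<lambda>y. a * f y + b * g y) x = a * T f x + b * T g x) \<and>
     (\<exists>C. \<forall>f\<in>Lp_space p M. Lp_norm p M (T f) \<le> C * Lp_norm p M f)"

definition jacobi_weight :: "real \<Rightarrow> real \<Rightarrow> real \<Rightarrow> real" where
  "jacobi_weight a b x =
     (1 - x) powr a * (1 + x) powr b / (2 powr (a + b + 1) * Beta (a + 1) (b + 1))"

(* Both Jacobi measures are regarded as measures on the whole space, carried by the cube. *)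
definition jacobi_measure1 :: "real \<Rightarrow> real \<Rightarrow> real measure" where
  "jacobi_measure1 a b =
     density lborel (\<lambda>x. ennreal (indicator {-1..1} x * jacobi_weight a b x))"

definition jacobi_measure :: "real ^ 'd \<Rightarrow> real ^ 'd \<Rightarrow> (real ^ 'd) measure" where
  "jacobi_measure \<alpha> \<beta> =
     density lborel
       (\<lambda>x. ennreal (indicator (cbox (-1) 1) x * (\<Prod>i\<in>UNIV. jacobi_weight (\<alpha> $ i) (\<beta> $ i) (x $ i))))"

(* Rodrigues' formula is imposed on the open interval only, where all the powers involved are
   smooth; this determines the polynomial up to the normalization. *)
definition jacobi_poly :: "real \<Rightarrow> real \<Rightarrow> nat \<Rightarrow> real poly" where
  "jacobi_poly a b n = (THE q.
     (\<exists>c>0. \<forall>x\<in>{-1<..<1}.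
        (1 - x) powr a * (1 + x) powr b * c * poly q x =
          (-1) ^ n / (2 ^ n * fact n) *
            (deriv ^^ n) (\<lambda>t. (1 - t) powr (a + real n) * (1 + t) powr (b + real n)) x) \<and>
     Lp_norm 2 (jacobi_measure1 a b) (poly q) = 1)"

definition jacobi_basis :: "real ^ 'd \<Rightarrow> real ^ 'd \<Rightarrow> nat ^ 'd \<Rightarrow> real ^ 'd \<Rightarrow> real" where
  "jacobi_basis \<alpha> \<beta> \<kappa> x = (\<Prod>i\<in>UNIV. poly (jacobi_poly (\<alpha> $ i) (\<beta> $ i) (\<kappa> $ i)) (x $ i))"

definition jacobi_lambda :: "real ^ 'd \<Rightarrow> real ^ 'd \<Rightarrow> nat ^ 'd \<Rightarrow> real" where
  "jacobi_lambda \<alpha> \<beta> \<kappa> =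
     (\<Sum>i\<in>UNIV. real (\<kappa> $ i) * (real (\<kappa> $ i) + \<alpha> $ i + \<beta> $ i + 1))"

definition jacobi_r :: "real ^ 'd \<Rightarrow> real ^ 'd \<Rightarrow> nat \<Rightarrow> real" where
  "jacobi_r \<alpha> \<beta> = (THE r. strict_mono r \<and> range r = range (jacobi_lambda \<alpha> \<beta>))"

definition jacobi_index :: "real ^ 'd \<Rightarrow> real ^ 'd \<Rightarrow> nat \<Rightarrow> (nat ^ 'd) set" where
  "jacobi_index \<alpha> \<beta> n = {\<kappa>. jacobi_lambda \<alpha> \<beta> \<kappa> = jacobi_r \<alpha> \<beta> n}"

definition jacobi_coeff ::
    "real ^ 'd \<Rightarrow> real ^ 'd \<Rightarrow> (real ^ 'd \<Rightarrow> real) \<Rightarrow> nat ^ 'd \<Rightarrow> real" where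
  "jacobi_coeff \<alpha> \<beta> f \<kappa> = (LINT x|jacobi_measure \<alpha> \<beta>. f x * jacobi_basis \<alpha> \<beta> \<kappa> x)"

definition jacobi_proj ::
    "real ^ 'd \<Rightarrow> real ^ 'd \<Rightarrow> nat \<Rightarrow> (real ^ 'd \<Rightarrow> real) \<Rightarrow> real ^ 'd \<Rightarrow> real" where
  "jacobi_proj \<alpha> \<beta> n f x =
     (\<Sum>\<kappa>\<in>jacobi_index \<alpha> \<beta> n. jacobi_coeff \<alpha> \<beta> f \<kappa> * jacobi_basis \<alpha> \<beta> \<kappa> x)"

(* Meant for polynomials f, for which the series has only finitely many nonzero terms. *)
definition jacobi_multiplier ::
    "real ^ 'd \<Rightarrow> real ^ 'd \<Rightarrow> (nat \<Rightarrow> real) \<Rightarrow> (real ^ 'd \<Rightarrow> real) \<Rightarrow> real ^ 'd \<Rightarrow> real" where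
  "jacobi_multiplier \<alpha> \<beta> \<Phi> f x = (\<Sum>n. \<Phi> n * jacobi_proj \<alpha> \<beta> n f x)"

(* analytic_on is restricted to complex functions; this is its real counterpart. *)
definition real_analytic_on :: "(real \<Rightarrow> real) \<Rightarrow> real set \<Rightarrow> bool" where
  "real_analytic_on h U \<longleftrightarrow> (\<forall>x\<in>U. \<exists>F. (\<lambda>t. h (x + t)) has_fps_expansion F)"

end

theory Submission
  imports Defs
begin

text \<open>
  Let \<open>L\<close> be the Jacobi operator, which multiplies the basis polynomial with index \<open>\<kappa>\<close> by the eigenvalue \<open>\<lambda>(\<kappa>)\<close>. The
  multiplier in question is \<open>h(L^(-\<gamma>))\<close> up to finitely many eigenvalues. The proof separates two sources of
  boundedness on \<open>L^p\<close>.

  First, multipliers that preserve positivity and fix constants are contractions on every \<open>L^p\<close>, by Jensen's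
  inequality (\<open>positive_symbol_contraction\<close>). The resolvents \<open>(1 + s L)^(-1)\<close> have this property by the minimum principle:
  at a minimum of a polynomial \<open>u\<close> over the cube, \<open>L u\<close> is not positive, also when the minimum lies on the boundary
  (\<open>jacobi_op_nonpos_at_min\<close>, \<open>positive_symbol_resolvent\<close>). Limits of powers of resolvents give the semigroup \<open>exp(-t L)\<close>,
  and integrating \<open>t^(a-1) exp(-t L)\<close> over the unit interval gives \<open>\<Gamma>(a) L^(-a)\<close> up to an error whose symbol decays
  exponentially.

  Second, a multiplier whose symbol decays like a sufficiently high negative power of \<open>\<lambda>\<close> has a bounded integral
  kernel, hence is bounded on \<open>L^p\<close> (\<open>Lp_multiplier_decay\<close>). This requires that the sup norms of the normalized Jacobi
  polynomials grow at most polynomially (\<open>jacobi_poly_sup_bound\<close>), which follows from Sonin's monotonicity argument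
  applied to their derivatives.

  Together these show that every \<open>L^(-a)\<close> is bounded, up to finitely many eigenvalues (\<open>Lp_multiplier_power\<close>).
  Taylor's formula for \<open>h\<close> at \<open>0\<close> writes \<open>h(\<lambda>^(-\<gamma>))\<close> as a finite combination of the powers \<open>\<lambda>^(-\<gamma> j)\<close> and a remainder of
  order \<open>\<lambda>^(-\<gamma> J)\<close>, which for large \<open>J\<close> is covered by the kernel estimate (\<open>Lp_multiplier_analytic\<close>). Since
  polynomials are dense in \<open>L^p\<close> (\<open>polynomials_dense\<close>), the multiplier extends continuously from them to the whole
  space (\<open>bounded_extension\<close>).
\<close>

section \<open>Jacobi polynomials from Rodrigues' formula\<close>

text \<open>
  The sign is chosen so that the eigenvalues are nonnegative: this is minus the classical Jacobi differential operator.
\<close>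
definition jacobi_op :: "real \<Rightarrow> real \<Rightarrow> real poly \<Rightarrow> real poly" where
  "jacobi_op a b v = [:-1, 0, 1:] * pderiv (pderiv v) + [:a - b, a + b + 2:] * pderiv v"

text \<open>
  The weighted derivative in Rodrigues' formula is again the weight times a polynomial. Peeling off the last
  derivative instead of the first one raises both parameters by one, which gives a recursion without any
  auxiliary index.
\<close>
fun rodrigues_poly :: "nat \<Rightarrow> real \<Rightarrow> real \<Rightarrow> real poly" where
  "rodrigues_poly 0 a b = 1"
| "rodrigues_poly (Suc n) a b =
     [:b - a, - (a + b + 2):] * rodrigues_poly n (a + 1) (b + 1)
       + [:1, 0, -1:] * pderiv (rodrigues_poly n (a + 1) (b + 1))"

lemma deriv_weighted_poly:
  fixes a b x :: real and q :: "real poly"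
  assumes x: "x \<in> {-1<..<1}"
  shows "((\<lambda>t. (1 - t) powr (a + 1) * (1 + t) powr (b + 1) * poly q t) has_real_derivative
     (1 - x) powr a * (1 + x) powr b * poly ([:b - a, - (a + b + 2):] * q + [:1, 0, -1:] * pderiv q) x) (at x)"
proof -
  have *: "(1 - x) powr (a + 1) = (1 - x) powr a * (1 - x)" "(1 + x) powr (b + 1) = (1 + x) powr b * (1 + x)"
    using x by (simp_all add: powr_add)
  have "((\<lambda>t. (1 - t) powr (a + 1)) has_real_derivative - ((a + 1) * (1 - x) powr a)) (at x)"
    using x by (auto intro!: derivative_eq_intros)
  moreover have "((\<lambda>t. (1 + t) powr (b + 1)) has_real_derivative (b + 1) * (1 + x) powr b) (at x)"
    using x by (auto intro!: derivative_eq_intros)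
  moreover have "(poly q has_real_derivative poly (pderiv q) x) (at x)" by (rule poly_DERIV)
  ultimately have "((\<lambda>t. (1 - t) powr (a + 1) * (1 + t) powr (b + 1) * poly q t) has_real_derivative
     ((- ((a + 1) * (1 - x) powr a)) * (1 + x) powr (b + 1) + ((b + 1) * (1 + x) powr b) * (1 - x) powr (a + 1)) * poly q x
       + poly (pderiv q) x * ((1 - x) powr (a + 1) * (1 + x) powr (b + 1))) (at x)"
    by (intro DERIV_mult)
  then show ?thesis
    unfolding * by (rule back_subst[of "\<lambda>d. (_ has_real_derivative d) _"]) (simp add: algebra_simps)
qed

lemma rodrigues_poly_higher_deriv:
  assumes "x \<in> {-1<..<1}"
  shows "(deriv ^^ n) (\<lambda>t. (1 - t) powr (a + real n) * (1 + t) powr (b + real n)) x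
           = (1 - x) powr a * (1 + x) powr b * poly (rodrigues_poly n a b) x"
  using assms
proof (induction n arbitrary: a b x)
  case 0
  then show ?case by simp
next
  case (Suc n)
  let ?f = "\<lambda>t. (1 - t) powr (a + real (Suc n)) * (1 + t) powr (b + real (Suc n))"
  have f: "?f = (\<lambda>t. (1 - t) powr ((a + 1) + real n) * (1 + t) powr ((b + 1) + real n))"
    by (simp add: algebra_simps)
  have "eventually (\<lambda>t. t \<in> {-1<..<1::real}) (nhds x)"
    using Suc.prems by (intro eventually_nhds_in_open) auto
  then have ev: "eventually (\<lambda>t. (deriv ^^ n) ?f t =
      (1 - t) powr (a + 1) * (1 + t) powr (b + 1) * poly (rodrigues_poly n (a + 1) (b + 1)) t) (nhds x)"
    unfolding f by (rule eventually_mono) (rule Suc.IH)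
  have "(deriv ^^ Suc n) ?f x = deriv ((deriv ^^ n) ?f) x" by simp
  also have "\<dots> = deriv (\<lambda>t. (1 - t) powr (a + 1) * (1 + t) powr (b + 1) * poly (rodrigues_poly n (a + 1) (b + 1)) t) x"
    by (rule deriv_cong_ev[OF ev refl])
  also have "\<dots> = (1 - x) powr a * (1 + x) powr b * poly (rodrigues_poly (Suc n) a b) x"
    unfolding rodrigues_poly.simps by (rule DERIV_imp_deriv[OF deriv_weighted_poly[OF Suc.prems]])
  finally show ?case .
qed

text \<open>
  The eigenvalue equation and the lowering rule support each other: differentiating the recursion and inserting
  the equation at the parameters \<^term>\<open>(a + 1, b + 1)\<close> gives the lowering rule, and the recursion itself then reads
  as the equation at \<^term>\<open>(a, b)\<close>.
\<close>
lemma jacobi_op_rodrigues_poly: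
  "jacobi_op a b (rodrigues_poly n a b) = smult (real n * (real n + a + b + 1)) (rodrigues_poly n a b)"
  and pderiv_rodrigues_poly:
  "pderiv (rodrigues_poly (Suc n) a b)
     = smult (- (real (Suc n) * (real n + a + b + 2))) (rodrigues_poly n (a + 1) (b + 1))"
proof (induction n arbitrary: a b)
  case 0
  { case 1
    show ?case by (simp add: jacobi_op_def) }
  { case 2
    show ?case by (simp add: pderiv_pCons pderiv_mult pderiv_add pderiv_1) }
next
  case (Suc n)
  have op: "jacobi_op a b (rodrigues_poly (Suc n) a b)
      = smult (real (Suc n) * (real (Suc n) + a + b + 1)) (rodrigues_poly (Suc n) a b)" for a b
  proof -
    let ?q = "rodrigues_poly n (a + 1) (b + 1)"
    have "poly (jacobi_op a b (rodrigues_poly (Suc n) a b)) x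
      = poly (smult (real (Suc n) * (real (Suc n) + a + b + 1)) (rodrigues_poly (Suc n) a b)) x" for x
      unfolding jacobi_op_def Suc.IH(2)
      by (simp add: pderiv_smult algebra_simps power2_eq_square)
    then show ?thesis using poly_eq_poly_eq_iff by blast
  qed
  { case 1
    show ?case by (rule op) }
  { case 2
    let ?q = "rodrigues_poly (Suc n) (a + 1) (b + 1)"
    have q: "rodrigues_poly (Suc (Suc n)) a b = [:b - a, - (a + b + 2):] * ?q + [:1, 0, -1:] * pderiv ?q" by simp
    have o: "poly (jacobi_op (a + 1) (b + 1) ?q) x = (real (Suc n) * (real (Suc n) + a + b + 3)) * poly ?q x" for x
      unfolding op by simp
    have "poly (pderiv (rodrigues_poly (Suc (Suc n)) a b)) x = poly (smult (- (real (Suc (Suc n)) * (real (Suc n) + a + b + 2))) ?q) x" for x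
      using o[of x] unfolding q jacobi_op_def
      by (simp add: pderiv_add pderiv_mult pderiv_pCons pderiv_smult pderiv_minus algebra_simps
            del: rodrigues_poly.simps)
    then show ?case using poly_eq_poly_eq_iff by blast }
qed

text \<open>
  By the lowering rule no leading coefficient can vanish, since \<^term>\<open>n + a + b + 2 > 0\<close>.
\<close>
lemma degree_rodrigues_poly:
  assumes "a + b > -2"
  shows "degree (rodrigues_poly n a b) = n"
  using assms
proof (induction n arbitrary: a b)
  case (Suc n)
  let ?q = "rodrigues_poly n (a + 1) (b + 1)"
  have c: "- (real (Suc n) * (real n + a + b + 2)) \<noteq> 0" 
  proof -
    have "real (Suc n) > 0" "real n + a + b + 2 > 0" using Suc.prems by (auto intro: add_nonneg_pos)
    then show ?thesis by (metis mult_pos_pos neg_equal_0_iff_equal less_irrefl)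
  qed
  have "degree (pderiv (rodrigues_poly (Suc n) a b)) = n"
    unfolding pderiv_rodrigues_poly using c Suc by (simp add: Suc.IH)
  moreover have "pderiv (rodrigues_poly (Suc n) a b) \<noteq> 0"
  proof -
    have "degree ?q = n" using Suc.prems by (intro Suc.IH) auto
    then have "?q \<noteq> 0" by (cases n) auto
    then show ?thesis unfolding pderiv_rodrigues_poly using c by (simp del: rodrigues_poly.simps)
  qed
  ultimately show ?case by (metis degree_pderiv pderiv_eq_0_iff Suc_pred' neq0_conv)
qed simp

section \<open>The one-dimensional Jacobi measure and orthonormality\<close>

lemma jacobi_weight_nonneg: "a > -1 \<Longrightarrow> b > -1 \<Longrightarrow> jacobi_weight a b x \<ge> 0"
  unfolding jacobi_weight_def Beta_def by (intro divide_nonneg_nonneg mult_nonneg_nonneg) (auto intro!: Gamma_real_nonneg)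

lemma Beta_real_pos: "a > 0 \<Longrightarrow> b > 0 \<Longrightarrow> Beta a b > (0::real)"
  unfolding Beta_def by simp

lemma jacobi_weight_measurable [measurable]: "jacobi_weight a b \<in> borel_measurable borel"
  unfolding jacobi_weight_def[abs_def] by measurable

text \<open>
  The substitution \<open>x = 2 s - 1\<close> turns the weight into the integrand of the Beta function.
\<close>
lemma set_integrable_jacobi_weight:
  assumes "a > -1" "b > -1"
  shows "set_integrable lborel {-1..1} (jacobi_weight a b)"
proof -
  let ?f = "\<lambda>s. indicator {0..1} s *\<^sub>R (s powr ((b + 1) - 1) * (1 - s) powr ((a + 1) - 1))"
  have "integrable lborel ?f"
    using integrable_Beta[of "b + 1" "a + 1"] assms unfolding set_integrable_def by simp
  then have "integrable lborel (\<lambda>x. ?f (1 / 2 + (1 / 2) * x))"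
    by (rule lborel_integrable_real_affine) simp
  then have "integrable lborel (\<lambda>x. 2 powr (a + b) / (2 powr (a + b + 1) * Beta (a + 1) (b + 1)) * ?f (1 / 2 + (1 / 2) * x))"
    by (rule integrable_mult_right)
  moreover have "2 powr (a + b) / (2 powr (a + b + 1) * Beta (a + 1) (b + 1)) * ?f (1 / 2 + (1 / 2) * x)
      = indicator {-1..1} x *\<^sub>R jacobi_weight a b x" for x :: real
  proof (cases "x \<in> {-1..1}")
    case True
    define s where "s = 1 / 2 + (1 / 2) * x"
    have s: "0 \<le> s" "s \<le> 1" "1 + x = 2 * s" "1 - x = 2 * (1 - s)" using True by (auto simp: s_def field_simps)
    have "(1 + x) powr b = 2 powr b * s powr b" "(1 - x) powr a = 2 powr a * (1 - s) powr a"
      unfolding s(3,4) using s(1,2) by (simp_all only: powr_mult)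
    then show ?thesis using True s(1,2) unfolding s_def[symmetric]
      by (simp add: jacobi_weight_def powr_add)
  next
    case False
    then have "1 / 2 + (1 / 2) * x \<notin> {0..1}" by (auto simp: field_simps)
    then show ?thesis using False by simp
  qed
  ultimately show ?thesis unfolding set_integrable_def by simp
qed

lemma integrable_jacobi_measure1:
  assumes "a > -1" "b > -1" and f: "continuous_on {-1..1} f" and m [measurable]: "f \<in> borel_measurable borel"
  shows "integrable lborel (\<lambda>x. indicator {-1..1} x * jacobi_weight a b x * f x)"
    and "integrable (jacobi_measure1 a b) f"
    and "(LINT x|jacobi_measure1 a b. f x) = (LINT x|lborel. indicator {-1..1} x * jacobi_weight a b x * f x)"
proof -
  obtain B where B: "\<And>x. x \<in> {-1..1} \<Longrightarrow> \<bar>f x\<bar> \<le> B"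
    using compact_imp_bounded[OF compact_continuous_image[OF f compact_Icc]] unfolding bounded_iff
    by (metis imageI real_norm_def)
  have "integrable lborel (\<lambda>x. B * (indicator {-1..1} x *\<^sub>R jacobi_weight a b x))"
    using set_integrable_jacobi_weight[OF assms(1,2)] unfolding set_integrable_def by (rule integrable_mult_right)
  then show 1: "integrable lborel (\<lambda>x. indicator {-1..1} x * jacobi_weight a b x * f x)"
  proof (rule Bochner_Integration.integrable_bound)
    show "AE x in lborel. norm (indicator {-1..1} x * jacobi_weight a b x * f x) \<le> norm (B * (indicator {-1..1} x *\<^sub>R jacobi_weight a b x))"
    proof (rule AE_I2)
      fix x :: real
      show "norm (indicator {-1..1} x * jacobi_weight a b x * f x) \<le> norm (B * (indicator {-1..1} x *\<^sub>R jacobi_weight a b x))"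
        using B[of x] jacobi_weight_nonneg[OF assms(1,2), of x]
        by (auto simp: indicator_def abs_mult mult.commute[of B] intro!: mult_left_mono order_trans[OF _ abs_ge_self])
    qed
  qed simp
  have nn: "AE x in lborel. 0 \<le> indicator {-1..1} x * jacobi_weight a b x"
    using jacobi_weight_nonneg[OF assms(1,2)] by (auto simp: indicator_def)
  show "integrable (jacobi_measure1 a b) f"
    unfolding jacobi_measure1_def using 1 nn by (subst integrable_density) auto
  show "(LINT x|jacobi_measure1 a b. f x) = (LINT x|lborel. indicator {-1..1} x * jacobi_weight a b x * f x)"
    unfolding jacobi_measure1_def using nn by (subst integral_density) auto
qed

lemma poly_borel_measurable [measurable]: "poly (q :: real poly) \<in> borel_measurable borel"
  by (intro borel_measurable_continuous_onI continuous_intros)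

lemma integrable_jacobi_measure1_poly [simp]:
  "a > -1 \<Longrightarrow> b > -1 \<Longrightarrow> integrable (jacobi_measure1 a b) (poly q)"
  by (rule integrable_jacobi_measure1(2)) (auto intro!: continuous_intros)

text \<open>
  The difference of the two integrands is the derivative of \<open>(1 - x)^(a+1) (1 + x)^(b+1) (u' v - u v')\<close>, which vanishes at
  both endpoints because \<^term>\<open>a + 1\<close> and \<^term>\<open>b + 1\<close> are positive.
\<close>
lemma jacobi_op_self_adjoint:
  assumes ab: "a > -1" "b > -1"
  shows "(LINT x|jacobi_measure1 a b. poly (jacobi_op a b u * v) x) = (LINT x|jacobi_measure1 a b. poly (u * jacobi_op a b v) x)"
proof -
  define q where "q = pderiv u * v - u * pderiv v"
  define r where "r = [:b - a, - (a + b + 2):] * q + [:1, 0, -1:] * pderiv q"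
  have r: "r = u * jacobi_op a b v - jacobi_op a b u * v"
  proof -
    have "poly r x = poly (u * jacobi_op a b v - jacobi_op a b u * v) x" for x
      unfolding r_def q_def jacobi_op_def
      by (simp add: pderiv_diff pderiv_mult algebra_simps)
    then show ?thesis using poly_eq_poly_eq_iff by blast
  qed
  let ?w = "\<lambda>x. (1 - x) powr a * (1 + x) powr b"
  let ?H = "\<lambda>x. (1 - x) powr (a + 1) * (1 + x) powr (b + 1) * poly q x"
  let ?c = "2 powr (a + b + 1) * Beta (a + 1) (b + 1)"
  have "((\<lambda>x. ?w x * poly r x) has_integral (?H 1 - ?H (-1))) {-1..1}"
  proof (rule fundamental_theorem_of_calculus_interior)
    show "continuous_on {-1..1} ?H"
      using ab by (intro continuous_intros continuous_on_powr') auto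
    show "(?H has_vector_derivative ?w x * poly r x) (at x)" if "x \<in> {-1<..<1}" for x
      using deriv_weighted_poly[OF that, of a b q] unfolding r_def has_real_derivative_iff_has_vector_derivative .
  qed simp
  then have "((\<lambda>x. ?w x * poly r x) has_integral 0) {-1..1}" using ab by simp
  then have "((\<lambda>x. (1 / ?c) * (?w x * poly r x)) has_integral (1 / ?c) * 0) {-1..1}" by (rule has_integral_mult_right)
  then have 0: "((\<lambda>x. jacobi_weight a b x * poly r x) has_integral 0) {-1..1}" by (simp add: jacobi_weight_def)
  have int: "integrable lborel (\<lambda>x. indicator {-1..1} x * jacobi_weight a b x * poly r x)"
    by (rule integrable_jacobi_measure1(1)[OF ab]) (auto intro!: continuous_intros)
  then have "set_integrable lborel {-1..1} (\<lambda>x. jacobi_weight a b x * poly r x)"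
    unfolding set_integrable_def by (simp add: mult.assoc)
  then have "(LINT x:{-1..1}|lborel. jacobi_weight a b x * poly r x) = 0"
    using set_borel_integral_eq_integral(2) integral_unique[OF 0] by metis
  then have "(LINT x|lborel. indicator {-1..1} x * jacobi_weight a b x * poly r x) = 0"
    unfolding set_lebesgue_integral_def by (simp add: mult.assoc)
  then have "(LINT x|jacobi_measure1 a b. poly r x) = 0"
    by (subst integrable_jacobi_measure1(3)[OF ab]) (auto intro!: continuous_intros)
  moreover have "(LINT x|jacobi_measure1 a b. poly r x) =
      (LINT x|jacobi_measure1 a b. poly (u * jacobi_op a b v) x) - (LINT x|jacobi_measure1 a b. poly (jacobi_op a b u * v) x)"
    unfolding r poly_diff by (rule Bochner_Integration.integral_diff)
      (use ab in \<open>simp_all del: poly_mult\<close>)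
  ultimately show ?thesis by simp
qed

lemma jacobi_measure1_square_pos:
  assumes ab: "a > -1" "b > -1" and q: "q \<noteq> 0"
  shows "(LINT x|jacobi_measure1 a b. (poly q x)\<^sup>2) > 0"
proof -
  have sq: "(\<lambda>x. (poly q x)\<^sup>2) = poly (q * q)" by (auto simp: power2_eq_square)
  have "(LINT x|jacobi_measure1 a b. (poly q x)\<^sup>2) \<noteq> 0"
  proof
    assume "(LINT x|jacobi_measure1 a b. (poly q x)\<^sup>2) = 0"
    moreover have "integrable (jacobi_measure1 a b) (\<lambda>x. (poly q x)\<^sup>2)" unfolding sq using ab by simp
    ultimately have "AE x in jacobi_measure1 a b. (poly q x)\<^sup>2 = 0"
      by (subst (asm) integral_nonneg_eq_0_iff_AE) auto
    then have "AE x in lborel. 0 < ennreal (indicator {-1..1} x * jacobi_weight a b x) \<longrightarrow> poly q x = 0"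
      unfolding jacobi_measure1_def by (subst (asm) AE_density) auto
    moreover have "AE x in lborel. x \<notin> {x. poly q x = 0}"
      by (intro AE_not_in finite_imp_null_set_lborel poly_roots_finite q)
    ultimately have "AE x in lborel. x \<notin> {-1<..<1::real}"
    proof eventually_elim
      case (elim x)
      show ?case
      proof
        assume x: "x \<in> {-1<..<1}"
        have "jacobi_weight a b x > 0" unfolding jacobi_weight_def
          using x ab Beta_real_pos[of "a + 1" "b + 1"] by (intro divide_pos_pos mult_pos_pos) auto
        then show False using elim x by auto
      qed
    qed
    then have "emeasure lborel {-1<..<1::real} = 0"
      by (subst (asm) AE_iff_measurable[of "{-1<..<1::real}"]) auto
    then show False using emeasure_lborel_Ioo[of "-1" 1] by (simp del: greaterThanLessThan_iff)
  qed
  moreover have "(LINT x|jacobi_measure1 a b. (poly q x)\<^sup>2) \<ge> 0" by simp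
  ultimately show ?thesis by linarith
qed

lemma Lp_norm_2_poly:
  "Lp_norm 2 (jacobi_measure1 a b) (poly q) = sqrt (LINT x|jacobi_measure1 a b. (poly q x)\<^sup>2)"
  unfolding Lp_norm_def by (simp add: powr_half_sqrt)

text \<open>
  Rodrigues' formula fixes the polynomial up to a positive factor, and the normalization fixes the factor;
  so the definite description in the definition denotes a multiple of the polynomial of the recursion.
\<close>
lemma jacobi_poly_rodrigues:
  assumes ab: "a > -1" "b > -1"
  obtains k where "k \<noteq> 0" "jacobi_poly a b n = smult k (rodrigues_poly n a b)"
    "(LINT x|jacobi_measure1 a b. (poly (jacobi_poly a b n) x)\<^sup>2) = 1"
proof -
  define k0 :: real where "k0 = (-1) ^ n / (2 ^ n * fact n)"
  define R where "R = smult k0 (rodrigues_poly n a b)"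
  define N where "N = Lp_norm 2 (jacobi_measure1 a b)"
  have k0: "k0 \<noteq> 0" by (simp add: k0_def)
  have "rodrigues_poly n a b \<noteq> 0" using degree_rodrigues_poly[of a b n] ab by (cases n) auto
  then have "R \<noteq> 0" using k0 by (simp add: R_def)
  then have NR: "N (poly R) > 0" unfolding N_def Lp_norm_2_poly using jacobi_measure1_square_pos[OF ab] by simp
  have Ns: "N (poly (smult c q)) = \<bar>c\<bar> * N (poly q)" for c q
    unfolding N_def Lp_norm_2_poly by (simp add: power_mult_distrib real_sqrt_mult)
  have rod: "(\<forall>x\<in>{-1<..<1}. (1 - x) powr a * (1 + x) powr b * c * poly q x =
          (-1) ^ n / (2 ^ n * fact n) *
            (deriv ^^ n) (\<lambda>t. (1 - t) powr (a + real n) * (1 + t) powr (b + real n)) x) \<longleftrightarrow> smult c q = R" for c q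
  proof
    assume *: "\<forall>x\<in>{-1<..<1}. (1 - x) powr a * (1 + x) powr b * c * poly q x =
          (-1) ^ n / (2 ^ n * fact n) *
            (deriv ^^ n) (\<lambda>t. (1 - t) powr (a + real n) * (1 + t) powr (b + real n)) x"
    have "poly (smult c q - R) x = 0" if x: "x \<in> {-1<..<1}" for x
    proof -
      have "(1 - x) powr a * (1 + x) powr b * (c * poly q x) = (1 - x) powr a * (1 + x) powr b * poly R x"
        using *[rule_format, OF x] unfolding rodrigues_poly_higher_deriv[OF x]
        by (simp add: R_def k0_def mult_ac)
      then show ?thesis using x by simp
    qed
    then have "{-1<..<1} \<subseteq> {x. poly (smult c q - R) x = 0}" by auto
    moreover have "infinite {-1<..<1::real}" by (simp add: infinite_Ioo)
    ultimately have "smult c q - R = 0" using poly_roots_finite finite_subset by metis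
    then show "smult c q = R" by simp
  next
    assume "smult c q = R"
    then have *: "c * poly q x = poly R x" for x by (metis poly_smult)
    show "\<forall>x\<in>{-1<..<1}. (1 - x) powr a * (1 + x) powr b * c * poly q x =
          (-1) ^ n / (2 ^ n * fact n) *
            (deriv ^^ n) (\<lambda>t. (1 - t) powr (a + real n) * (1 + t) powr (b + real n)) x"
    proof
      fix x :: real assume x: "x \<in> {-1<..<1}"
      show "(1 - x) powr a * (1 + x) powr b * c * poly q x =
          (-1) ^ n / (2 ^ n * fact n) *
            (deriv ^^ n) (\<lambda>t. (1 - t) powr (a + real n) * (1 + t) powr (b + real n)) x"
        unfolding rodrigues_poly_higher_deriv[OF x] mult.assoc *
        by (simp add: R_def k0_def mult_ac)
    qed
  qed
  define q where "q = smult (1 / N (poly R)) R"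
  have Nq: "N (poly q) = 1" unfolding q_def Ns using NR by simp
  have "jacobi_poly a b n = q"
    unfolding jacobi_poly_def rod N_def[symmetric]
  proof (rule the_equality)
    show "(\<exists>c>0. smult c q = R) \<and> N (poly q) = 1"
      using Nq NR by (auto intro!: exI[of _ "N (poly R)"] simp: q_def)
  next
    fix q' assume q': "(\<exists>c>0. smult c q' = R) \<and> N (poly q') = 1"
    then obtain c where c: "c > 0" "smult c q' = R" by blast
    then have "N (poly R) = c" using q' Ns[of c q'] by simp
    then show "q' = q" unfolding q_def c(2)[symmetric] using c(1) by simp
  qed
  moreover have "(LINT x|jacobi_measure1 a b. (poly q x)\<^sup>2) = 1"
    using Nq unfolding N_def Lp_norm_2_poly by simp
  ultimately show ?thesis
    using that[of "k0 / N (poly R)"] k0 NR by (simp add: q_def R_def)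
qed

lemma degree_jacobi_poly:
  assumes "a > -1" "b > -1"
  shows "degree (jacobi_poly a b n) = n"
proof -
  obtain k where "k \<noteq> 0" "jacobi_poly a b n = smult k (rodrigues_poly n a b)"
    using jacobi_poly_rodrigues[OF assms] by blast
  then show ?thesis using degree_rodrigues_poly[of a b n] assms by simp
qed

lemma jacobi_poly_nonzero: "a > -1 \<Longrightarrow> b > -1 \<Longrightarrow> jacobi_poly a b n \<noteq> 0"
proof
  assume "a > -1" "b > -1" and 0: "jacobi_poly a b n = 0"
  then have "(LINT x|jacobi_measure1 a b. (poly (jacobi_poly a b n) x)\<^sup>2) = 1"
    using jacobi_poly_rodrigues by blast
  then show False unfolding 0 by simp
qed

lemma jacobi_op_smult: "jacobi_op a b (smult c u) = smult c (jacobi_op a b u)"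
  by (simp add: jacobi_op_def pderiv_smult smult_add_right)

lemma jacobi_op_jacobi_poly:
  assumes "a > -1" "b > -1"
  shows "jacobi_op a b (jacobi_poly a b n) = smult (real n * (real n + a + b + 1)) (jacobi_poly a b n)"
proof -
  obtain k where "jacobi_poly a b n = smult k (rodrigues_poly n a b)"
    using jacobi_poly_rodrigues[OF assms] by blast
  then show ?thesis by (simp add: jacobi_op_smult jacobi_op_rodrigues_poly mult.commute)
qed

text \<open>
  Eigenpolynomials of a symmetric operator for different eigenvalues are orthogonal; the eigenvalues are different
  because \<^term>\<open>n + m + a + b + 1 > 0\<close> as soon as \<^term>\<open>n \<noteq> m\<close>.
\<close>
lemma jacobi_poly_orthonormal:
  assumes ab: "a > -1" "b > -1"
  shows "(LINT x|jacobi_measure1 a b. poly (jacobi_poly a b n) x * poly (jacobi_poly a b m) x) = (if n = m then 1 else 0)"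
proof (cases "n = m")
  case True
  have "(LINT x|jacobi_measure1 a b. (poly (jacobi_poly a b n) x)\<^sup>2) = 1"
    using jacobi_poly_rodrigues[OF ab] by blast
  then show ?thesis using True by (simp add: power2_eq_square)
next
  case False
  let ?I = "LINT x|jacobi_measure1 a b. poly (jacobi_poly a b n * jacobi_poly a b m) x"
  have "(real n * (real n + a + b + 1)) * ?I = (real m * (real m + a + b + 1)) * ?I"
    using jacobi_op_self_adjoint[OF ab, of "jacobi_poly a b n" "jacobi_poly a b m"]
    unfolding jacobi_op_jacobi_poly[OF ab] by (simp add: mult.assoc)
  then have "(real n - real m) * (real n + real m + (a + b + 1)) * ?I = 0" by (simp add: algebra_simps)
  moreover have "real n - real m \<noteq> 0" using False by simp
  moreover have "real n + real m \<ge> 1" using False by (cases n; cases m) auto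
  then have "real n + real m + (a + b + 1) \<noteq> 0" using ab by linarith
  ultimately have "?I = 0" by simp
  then show ?thesis using False by simp
qed

lemma jacobi_poly_spanning:
  assumes ab: "a > -1" "b > -1" and "degree q \<le> N"
  obtains c where "q = (\<Sum>k\<le>N. smult (c k) (jacobi_poly a b k))"
proof -
  have "\<exists>c. q = (\<Sum>k\<le>N. smult (c k) (jacobi_poly a b k))" using \<open>degree q \<le> N\<close>
  proof (induction N arbitrary: q)
    case 0
    then obtain x where x: "q = [:x:]" by (metis degree_0_id le_zero_eq)
    have "degree (jacobi_poly a b 0) = 0" "jacobi_poly a b 0 \<noteq> 0" using degree_jacobi_poly jacobi_poly_nonzero ab by auto
    then obtain y where y: "jacobi_poly a b 0 = [:y:]" "y \<noteq> 0" by (metis degree_0_id pCons_0_0)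
    show ?case by (rule exI[of _ "\<lambda>_. x / y"]) (simp add: x y)
  next
    case (Suc N)
    let ?p = "jacobi_poly a b (Suc N)"
    define t where "t = coeff q (Suc N) / lead_coeff ?p"
    have p: "degree ?p = Suc N" using degree_jacobi_poly ab by blast
    have p': "coeff ?p (Suc N) \<noteq> 0" using jacobi_poly_nonzero[OF ab, of "Suc N"] p by (metis leading_coeff_0_iff)
    have "degree (q - smult t ?p) \<le> N"
    proof (rule degree_le, intro allI impI)
      fix i assume "N < i"
      show "coeff (q - smult t ?p) i = 0"
      proof (cases "i = Suc N")
        case True
        then show ?thesis using p p' by (simp add: t_def)
      next
        case False
        then have "i > Suc N" using \<open>N < i\<close> by simp
        then show ?thesis using p Suc.prems by (simp add: coeff_eq_0)
      qed
    qed
    then obtain c where c: "q - smult t ?p = (\<Sum>k\<le>N. smult (c k) (jacobi_poly a b k))" using Suc.IH by blast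
    show ?case
    proof (rule exI[of _ "c(Suc N := t)"])
      have "(\<Sum>k\<le>N. smult ((c(Suc N := t)) k) (jacobi_poly a b k)) = q - smult t ?p"
        unfolding c by (rule sum.cong) auto
      then show "q = (\<Sum>k\<le>Suc N. smult ((c(Suc N := t)) k) (jacobi_poly a b k))" by simp
    qed
  qed
  then show ?thesis using that by blast
qed

section \<open>Minimum principle and growth of Jacobi polynomials\<close>

text \<open>
  In the interior the first derivative vanishes and the second one is nonnegative. At an endpoint the second order
  term drops out, and the drift points into the interval.
\<close>
lemma jacobi_op_nonpos_at_min:
  assumes ab: "a > -1" "b > -1" and t: "t \<in> {-1..1}"
    and min: "\<And>s. s \<in> {-1..1} \<Longrightarrow> poly v t \<le> poly v s"
  shows "poly (jacobi_op a b v) t \<le> 0"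
proof -
  let ?d = "poly (pderiv v) t"
  consider "t = 1" | "t = -1" | "-1 < t" "t < 1" using t by fastforce
  then show ?thesis
  proof cases
    case 1
    have "?d \<le> 0"
    proof (rule ccontr)
      assume "\<not> ?d \<le> 0"
      then obtain d where d: "d > 0" "\<And>h. 0 < h \<Longrightarrow> h < d \<Longrightarrow> poly v (t - h) < poly v t"
        using DERIV_pos_inc_left[OF poly_DERIV[of v t]] by auto
      have "poly v (t - min (d / 2) 1) < poly v t" using d(1) by (intro d(2)) auto
      moreover have "t - min (d / 2) 1 \<in> {-1..1}" using 1 d(1) by auto
      ultimately show False using min by force
    qed
    then have "(2 * a + 2) * ?d \<le> 0" using ab by (intro mult_nonneg_nonpos) auto
    moreover have "poly (jacobi_op a b v) t = (2 * a + 2) * ?d"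
      unfolding 1 by (simp add: jacobi_op_def algebra_simps)
    ultimately show ?thesis by linarith
  next
    case 2
    have "?d \<ge> 0"
    proof (rule ccontr)
      assume "\<not> ?d \<ge> 0"
      then obtain d where d: "d > 0" "\<And>h. 0 < h \<Longrightarrow> h < d \<Longrightarrow> poly v (t + h) < poly v t"
        using DERIV_neg_dec_right[OF poly_DERIV[of v t]] by auto
      have "poly v (t + min (d / 2) 1) < poly v t" using d(1) by (intro d(2)) auto
      moreover have "t + min (d / 2) 1 \<in> {-1..1}" using 2 d(1) by auto
      ultimately show False using min by force
    qed
    then have "(2 * b + 2) * ?d \<ge> 0" using ab by (intro mult_nonneg_nonneg) auto
    moreover have "poly (jacobi_op a b v) t = - ((2 * b + 2) * ?d)"
      unfolding 2 by (simp add: jacobi_op_def) (simp add: algebra_simps)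
    ultimately show ?thesis by linarith
  next
    case 3
    define e where "e = min (1 - t) (1 + t)"
    have e: "e > 0" using 3 by (simp add: e_def)
    have d0: "?d = 0"
    proof (rule DERIV_local_min[OF poly_DERIV e], intro allI impI)
      fix y assume "\<bar>t - y\<bar> < e"
      then have "y \<in> {-1..1}" by (simp add: e_def abs_less_iff)
      then show "poly v t \<le> poly v y" by (rule min)
    qed
    have "poly (pderiv (pderiv v)) t \<ge> 0"
    proof (rule ccontr)
      assume "\<not> poly (pderiv (pderiv v)) t \<ge> 0"
      then obtain d where d: "d > 0" "\<And>h. 0 < h \<Longrightarrow> h < d \<Longrightarrow> poly (pderiv v) (t + h) < 0"
        using DERIV_neg_dec_right[OF poly_DERIV[of "pderiv v" t]] d0 by auto
      define h where "h = min (d / 2) (e / 2)"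
      have h: "h > 0" "h < d" "h < e" using d(1) e by (auto simp: h_def)
      obtain z where z: "t < z" "z < t + h" "poly v (t + h) - poly v t = (t + h - t) * poly (pderiv v) z"
        using MVT2[of t "t + h" "poly v" "poly (pderiv v)"] poly_DERIV h(1) by auto
      have "poly (pderiv v) z < 0" using d(2)[of "z - t"] z h by simp
      then have "poly v (t + h) < poly v t" using z(3) mult_pos_neg[OF h(1), of "poly (pderiv v) z"] by simp
      moreover have "t + h \<in> {-1..1}" using h 3 by (auto simp: e_def)
      ultimately show False using min by force
    qed
    moreover have "t * t - 1 \<le> 0" using 3 by (simp add: square_le_1 flip: power2_eq_square)
    ultimately have "(t * t - 1) * poly (pderiv (pderiv v)) t \<le> 0" by (intro mult_nonpos_nonneg)
    then show ?thesis using d0 by (simp add: jacobi_op_def algebra_simps)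
  qed
qed

text \<open>
  Sonin's argument: \<open>l v\<^sup>2 + (1 - x\<^sup>2) v'\<^sup>2\<close> dominates \<open>l v\<^sup>2\<close>, agrees with it at the endpoints, and its derivative
  has the sign of a linear function with positive slope, so that it first decreases and then increases.
\<close>
lemma jacobi_eigenpoly_le_endpoints:
  assumes s: "a + b + 1 > 0" and l: "l > 0" and op: "jacobi_op a b v = smult l v" and x: "x \<in> {-1..1}"
  shows "(poly v x)\<^sup>2 \<le> max ((poly v 1)\<^sup>2) ((poly v (-1))\<^sup>2)"
proof -
  define F where "F = smult l (v * v) + [:1, 0, -1:] * (pderiv v * pderiv v)"
  have F': "poly (pderiv F) y = 2 * (poly (pderiv v) y)\<^sup>2 * ((a - b) + (a + b + 1) * y)" for y
  proof -
    have o: "(y * y - 1) * poly (pderiv (pderiv v)) y + ((a - b) + (a + b + 2) * y) * poly (pderiv v) y = l * poly v y"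
      using arg_cong[OF op, of "\<lambda>q. poly q y"] by (simp add: jacobi_op_def algebra_simps)
    have "poly (pderiv F) y = 2 * poly (pderiv v) y * (l * poly v y + (1 - y * y) * poly (pderiv (pderiv v)) y - y * poly (pderiv v) y)"
      by (simp add: F_def pderiv_add pderiv_mult pderiv_smult pderiv_pCons pderiv_minus algebra_simps)
    also have "\<dots> = 2 * (poly (pderiv v) y)\<^sup>2 * ((a - b) + (a + b + 1) * y)"
      unfolding o[symmetric] by (simp add: algebra_simps power2_eq_square)
    finally show ?thesis .
  qed
  have 1: "l * (poly v x)\<^sup>2 \<le> poly F x"
  proof -
    have "(1 - x\<^sup>2) * (poly (pderiv v) x)\<^sup>2 \<ge> 0"
      using x by (intro mult_nonneg_nonneg) (auto simp: abs_square_le_1)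
    then show ?thesis by (simp add: F_def power2_eq_square algebra_simps)
  qed
  have 2: "poly F 1 = l * (poly v 1)\<^sup>2" "poly F (-1) = l * (poly v (-1))\<^sup>2" by (simp_all add: F_def power2_eq_square)
  have "poly F x \<le> max (poly F 1) (poly F (-1))"
  proof (cases "(a - b) + (a + b + 1) * x \<ge> 0")
    case True
    have "poly F x \<le> poly F 1"
    proof (rule DERIV_nonneg_imp_nondecreasing[of x 1 "poly F"])
      fix y assume y: "x \<le> y" "y \<le> 1"
      have "(a + b + 1) * x \<le> (a + b + 1) * y" using s y by simp
      then have "poly (pderiv F) y \<ge> 0" unfolding F' using True by (intro mult_nonneg_nonneg) auto
      then show "\<exists>z. DERIV (poly F) y :> z \<and> 0 \<le> z" using poly_DERIV by blast
    qed (use x in auto)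
    then show ?thesis by simp
  next
    case False
    have "poly F x \<le> poly F (-1)"
    proof (rule DERIV_nonpos_imp_nonincreasing[of "-1" x "poly F"])
      fix y assume y: "-1 \<le> y" "y \<le> x"
      have "(a + b + 1) * y \<le> (a + b + 1) * x" using s y by simp
      then have "poly (pderiv F) y \<le> 0" unfolding F' using False by (intro mult_nonneg_nonpos) auto
      then show "\<exists>z. DERIV (poly F) y :> z \<and> z \<le> 0" using poly_DERIV by blast
    qed (use x in auto)
    then show ?thesis by simp
  qed
  then have "l * (poly v x)\<^sup>2 \<le> max (l * (poly v 1)\<^sup>2) (l * (poly v (-1))\<^sup>2)" using 1 unfolding 2 by simp
  also have "\<dots> = l * max ((poly v 1)\<^sup>2) ((poly v (-1))\<^sup>2)" using l by (simp add: max_mult_distrib_left)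
  finally show ?thesis using l by simp
qed

text \<open>
  The derivative of a Jacobi polynomial solves the Jacobi equation with both parameters raised by one, so it is
  largest at an endpoint. There the equation itself expresses the derivative by the value of the polynomial.
\<close>
lemma jacobi_poly_deriv_bound:
  assumes ab: "a > -1/2" "b > -1/2" and M: "\<And>x. x \<in> {-1..1} \<Longrightarrow> \<bar>poly (jacobi_poly a b n) x\<bar> \<le> M"
    and x: "x \<in> {-1..1}"
  shows "\<bar>poly (pderiv (jacobi_poly a b n)) x\<bar> \<le> real n * (real n + a + b + 1) * M"
proof -
  define v where "v = jacobi_poly a b n"
  define l where "l = real n * (real n + a + b + 1)"
  have op: "jacobi_op a b v = smult l v" unfolding v_def l_def using ab by (intro jacobi_op_jacobi_poly) auto
  have l0: "l \<ge> 0" unfolding l_def using ab by (cases n) auto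
  have M0: "M \<ge> 0" using M[OF x] by linarith
  have *: "poly (jacobi_op a b v) y = l * poly v y" for y using op by simp
  have 1: "\<bar>poly (pderiv v) 1\<bar> \<le> l * M"
  proof -
    have e1: "(2 * a + 2) * poly (pderiv v) 1 = l * poly v 1"
      using *[of 1] by (simp add: jacobi_op_def algebra_simps)
    then have "(2 * a + 2) * \<bar>poly (pderiv v) 1\<bar> = l * \<bar>poly v 1\<bar>"
    proof -
      have "(2 * a + 2) * \<bar>poly (pderiv v) 1\<bar> = \<bar>(2 * a + 2) * poly (pderiv v) 1\<bar>"
        using ab by (subst abs_mult) simp
      also have "\<dots> = \<bar>l * poly v 1\<bar>" using e1 by simp
      finally show ?thesis using l0 by (simp add: abs_mult)
    qed
    moreover have "1 * \<bar>poly (pderiv v) 1\<bar> \<le> (2 * a + 2) * \<bar>poly (pderiv v) 1\<bar>"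
      using ab by (intro mult_right_mono) auto
    moreover have "l * \<bar>poly v 1\<bar> \<le> l * M" using M[of 1] l0 unfolding v_def by (intro mult_left_mono) auto
    ultimately show ?thesis by linarith
  qed
  have 2: "\<bar>poly (pderiv v) (-1)\<bar> \<le> l * M"
  proof -
    have e2: "- ((2 * b + 2) * poly (pderiv v) (-1)) = l * poly v (-1)"
      using *[of "-1"] by (simp add: jacobi_op_def algebra_simps)
    then have "(2 * b + 2) * \<bar>poly (pderiv v) (-1)\<bar> = l * \<bar>poly v (-1)\<bar>"
    proof -
      have "(2 * b + 2) * \<bar>poly (pderiv v) (-1)\<bar> = \<bar>- ((2 * b + 2) * poly (pderiv v) (-1))\<bar>"
        using ab by (subst abs_minus_cancel, subst abs_mult) simp
      also have "\<dots> = \<bar>l * poly v (-1)\<bar>" using e2 by simp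
      finally show ?thesis using l0 by (simp add: abs_mult)
    qed
    moreover have "1 * \<bar>poly (pderiv v) (-1)\<bar> \<le> (2 * b + 2) * \<bar>poly (pderiv v) (-1)\<bar>"
      using ab by (intro mult_right_mono) auto
    moreover have "l * \<bar>poly v (-1)\<bar> \<le> l * M" using M[of "-1"] l0 unfolding v_def by (intro mult_left_mono) auto
    ultimately show ?thesis by linarith
  qed
  have "(poly (pderiv v) x)\<^sup>2 \<le> max ((poly (pderiv v) 1)\<^sup>2) ((poly (pderiv v) (-1))\<^sup>2)"
  \<comment> \<open>For \<open>n \<le> 1\<close> the derivative is constant, and its eigenvalue \<open>(n - 1) (n + a + b + 2)\<close> is not positive.\<close>
  proof (cases "n \<le> 1")
    case True
    have "degree (pderiv v) = 0" using True degree_jacobi_poly[of a b n] ab by (simp add: degree_pderiv v_def)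
    then obtain c where "pderiv v = [:c:]" by (metis degree_0_id)
    then show ?thesis by simp
  next
    case False
    have "pderiv (jacobi_op a b v) = jacobi_op (a + 1) (b + 1) (pderiv v) + smult (a + b + 2) (pderiv v)"
    proof -
      have "poly (pderiv (jacobi_op a b v)) y = poly (jacobi_op (a + 1) (b + 1) (pderiv v) + smult (a + b + 2) (pderiv v)) y" for y
        by (simp add: jacobi_op_def pderiv_add pderiv_diff pderiv_minus pderiv_mult pderiv_smult pderiv_pCons algebra_simps)
      then show ?thesis using poly_eq_poly_eq_iff by blast
    qed
    then have "jacobi_op (a + 1) (b + 1) (pderiv v) = smult l (pderiv v) - smult (a + b + 2) (pderiv v)"
      unfolding op by (simp add: pderiv_smult algebra_simps)
    then have o: "jacobi_op (a + 1) (b + 1) (pderiv v) = smult (l - (a + b + 2)) (pderiv v)"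
      by (simp add: smult_diff_left)
    have "l - (a + b + 2) = (real n - 1) * (real n + a + b + 2)" by (simp add: l_def algebra_simps)
    also have "\<dots> > 0" using False ab by (intro mult_pos_pos) auto
    finally show ?thesis using ab by (intro jacobi_eigenpoly_le_endpoints[OF _ _ o x]) auto
  qed
  also have "\<dots> \<le> (l * M)\<^sup>2"
    using 1 2 l0 M0 by (auto intro!: power2_le_iff_abs_le[THEN iffD2] mult_nonneg_nonneg)
  finally have "\<bar>poly (pderiv v) x\<bar> \<le> l * M"
    using l0 M0 by (subst (asm) power2_le_iff_abs_le) auto
  then show ?thesis by (simp add: v_def l_def)
qed

lemma powr_ge_powr_abs:
  fixes y e c :: real
  assumes "0 < e" "e \<le> y" "y \<le> 1 / e" "e \<le> 1"
  shows "e powr \<bar>c\<bar> \<le> y powr c"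
proof (cases "c \<ge> 0")
  case True
  then show ?thesis using assms by (auto intro!: powr_mono2)
next
  case False
  have "e powr \<bar>c\<bar> = (1 / e) powr c" using False assms by (simp add: powr_minus_divide powr_divide)
  also have "\<dots> \<le> y powr c" using assms False by (intro powr_mono2') auto
  finally show ?thesis .
qed

text \<open>
  Near a point where the maximum is attained the polynomial stays above half its maximum on an interval whose length
  is inversely proportional to one plus the eigenvalue, by the bound on the derivative. As the polynomial has norm one,
  its maximum is at most a constant times a power of that quantity.
\<close>
lemma jacobi_poly_sup_bound:
  assumes ab: "a > -1/2" "b > -1/2"
  obtains C where "C > 0" "\<And>n x. x \<in> {-1..1} \<Longrightarrow>
      (poly (jacobi_poly a b n) x)\<^sup>2 \<le> C * (1 + real n * (real n + a + b + 1)) powr (\<bar>a\<bar> + \<bar>b\<bar> + 1)"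
proof -
  define A where "A = \<bar>a\<bar> + \<bar>b\<bar> + 1"
  define K where "K = 2 powr (a + b + 1) * Beta (a + 1) (b + 1)"
  have K: "K > 0" using Beta_real_pos[of "a + 1" "b + 1"] ab by (simp add: K_def)
  have ab': "a > -1" "b > -1" using ab by auto
  have "(poly (jacobi_poly a b n) x)\<^sup>2 \<le> (4 * K / 3 * 8 powr A) * (1 + real n * (real n + a + b + 1)) powr A"
    if x: "x \<in> {-1..1}" for n x
  proof -
    define L where "L = 1 + real n * (real n + a + b + 1)"
    have L: "L \<ge> 1" unfolding L_def using ab by (cases n) auto
    define u where "u = jacobi_poly a b n"
    have "\<exists>z\<in>{-1..1}. \<forall>y\<in>{-1..1}. \<bar>poly u y\<bar> \<le> \<bar>poly u z\<bar>"
      by (rule continuous_attains_sup) (auto intro!: continuous_intros)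
    then obtain z where z: "z \<in> {-1..1}" "\<And>y. y \<in> {-1..1} \<Longrightarrow> \<bar>poly u y\<bar> \<le> \<bar>poly u z\<bar>" by blast
    define M where "M = \<bar>poly u z\<bar>"
    have M0: "M \<ge> 0" by (simp add: M_def)
    have du: "\<bar>poly (pderiv u) y\<bar> \<le> L * M" if "y \<in> {-1..1}" for y
    proof -
      have "\<bar>poly (pderiv u) y\<bar> \<le> (L - 1) * M" unfolding L_def u_def
        using jacobi_poly_deriv_bound[OF ab _ that, of n M] z(2) by (simp add: u_def M_def)
      also have "\<dots> \<le> L * M" using M0 by (intro mult_right_mono) auto
      finally show ?thesis .
    qed
    define e where "e = 1 / (8 * L)"
    have e: "e > 0" "e \<le> 1 / 8" using L by (auto simp: e_def field_simps)
    \<comment> \<open>\<open>J\<close> lies on the side of \<open>z\<close> towards the centre and keeps the distance \<open>e\<close> from both endpoints,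
      so that the weight is bounded below on it whatever the signs of \<open>a\<close> and \<open>b\<close>.\<close>
    define J where "J = (if z \<le> 0 then {z + e..z + 4 * e} else {z - 4 * e..z - e})"
    have J: "y \<in> {-1..1}" "\<bar>y - z\<bar> \<le> 4 * e" "1 - y \<ge> e" "1 + y \<ge> e" if "y \<in> J" for y
      using that z(1) e unfolding J_def by (auto split: if_splits)
    have u: "\<bar>poly u y\<bar> \<ge> M / 2" if y: "y \<in> J" for y
    proof -
      have "norm (poly u y - poly u z) \<le> L * M * norm (y - z)"
      proof (rule field_differentiable_bound[of "{-1..1}"])
        show "(poly u has_field_derivative poly (pderiv u) t) (at t within {-1..1})" for t
          by (rule has_field_derivative_at_within[OF poly_DERIV])
      qed (use du z J[OF y] in auto)
      also have "\<dots> \<le> L * M * (4 * e)" using J(2)[OF y] L M0 by (intro mult_left_mono) auto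
      also have "\<dots> = M / 2" using L by (simp add: e_def)
      finally have "\<bar>poly u y - poly u z\<bar> \<le> M / 2" by simp
      then show ?thesis unfolding M_def by linarith
    qed
    define c where "c = e powr (\<bar>a\<bar> + \<bar>b\<bar>) / K * (M\<^sup>2 / 4)"
    have c: "c \<le> jacobi_weight a b y * (poly u y)\<^sup>2" if y: "y \<in> J" for y
      unfolding c_def
    proof (rule mult_mono)
      have 1: "1 / e \<ge> 2" using e by (simp add: field_simps)
      have "e powr \<bar>a\<bar> * e powr \<bar>b\<bar> \<le> (1 - y) powr a * (1 + y) powr b"
        using J[OF y] e 1 by (intro mult_mono powr_ge_powr_abs) auto
      then show "e powr (\<bar>a\<bar> + \<bar>b\<bar>) / K \<le> jacobi_weight a b y"
        unfolding jacobi_weight_def K_def[symmetric] using K by (subst powr_add, intro divide_right_mono) auto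
      have "(M / 2)\<^sup>2 \<le> (\<bar>poly u y\<bar>)\<^sup>2" using u[OF y] M0 by (intro power_mono) auto
      then show "M\<^sup>2 / 4 \<le> (poly u y)\<^sup>2" by (simp add: power_divide)
    qed (use jacobi_weight_nonneg[OF ab'] in auto)
    have Jm [measurable]: "J \<in> sets borel" by (auto simp: J_def)
    have mJ: "measure lborel J = 3 * e" "emeasure lborel J < \<infinity>" using e by (auto simp: J_def)
    have "3 * e * c = (LINT y|lborel. indicator J y * c)" using mJ by simp
    also have "\<dots> \<le> (LINT y|lborel. indicator {-1..1} y * jacobi_weight a b y * (poly u y)\<^sup>2)"
    proof (rule integral_mono)
      show "integrable lborel (\<lambda>y. indicator J y * c)" using mJ by (intro integrable_mult_left integrable_real_indicator) auto
      show "integrable lborel (\<lambda>y. indicator {-1..1} y * jacobi_weight a b y * (poly u y)\<^sup>2)"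
        by (rule integrable_jacobi_measure1[OF ab']) (auto intro!: continuous_intros)
      show "indicator J y * c \<le> indicator {-1..1} y * jacobi_weight a b y * (poly u y)\<^sup>2" for y
        using c[of y] J(1)[of y] jacobi_weight_nonneg[OF ab', of y] by (auto simp: indicator_def)
    qed
    also have "\<dots> = (LINT y|jacobi_measure1 a b. (poly u y)\<^sup>2)"
      by (rule integrable_jacobi_measure1(3)[OF ab', symmetric]) (auto intro!: continuous_intros)
    also have "\<dots> = 1"
      using jacobi_poly_orthonormal[OF ab', of n n] by (simp add: u_def power2_eq_square)
    finally have "3 * e * c \<le> 1" .
    moreover have "3 * e * c = (3 / (4 * K)) * (e powr A) * M\<^sup>2"
    proof -
      have "e powr A = e powr (\<bar>a\<bar> + \<bar>b\<bar>) * e" using e by (simp only: A_def powr_add) simp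
      then show ?thesis unfolding c_def by (simp add: mult.commute mult.left_commute)
    qed
    ultimately have "(3 / (4 * K)) * (e powr A) * M\<^sup>2 \<le> 1" by simp
    moreover have "e powr A = 1 / (8 * L) powr A" using L unfolding e_def by (subst powr_divide) simp_all
    ultimately have "M\<^sup>2 \<le> (4 * K / 3) * (8 * L) powr A"
      using K L by (simp add: field_simps)
    also have "\<dots> = (4 * K / 3 * 8 powr A) * L powr A" using L by (simp add: powr_mult)
    finally have "M\<^sup>2 \<le> (4 * K / 3 * 8 powr A) * L powr A" .
    moreover have "(poly u x)\<^sup>2 \<le> M\<^sup>2" using z(2)[OF x] by (simp add: M_def abs_le_square_iff)
    ultimately show ?thesis by (simp add: u_def L_def)
  qed
  then show ?thesis using K that[of "4 * K / 3 * 8 powr A"] by (simp add: A_def)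
qed

section \<open>Polynomials on the cube as finite Jacobi sums\<close>

text \<open>
  Lebesgue measure on \<^typ>\<open>real^'d\<close> is by definition an image of a product measure over the standard basis; the basis is
  reindexed by the coordinates.
\<close>
lemma lborel_vec_product:
  fixes g :: "'d::finite \<Rightarrow> real \<Rightarrow> real"
  assumes int: "\<And>i. integrable lborel (g i)"
  shows "integrable lborel (\<lambda>x::real^'d. \<Prod>i\<in>UNIV. g i (x $ i))"
    and "(LINT x|(lborel :: (real^'d) measure). (\<Prod>i\<in>UNIV. g i (x $ i))) = (\<Prod>i\<in>UNIV. (LINT t|lborel. g i t))"
proof -
  interpret product_sigma_finite "\<lambda>_ :: real^'d. lborel :: real measure" by standard
  have [measurable]: "g i \<in> borel_measurable borel" for i
    using borel_measurable_integrable[OF int[of i]] by simp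
  let ?ax = "\<lambda>i::'d. axis i (1::real)"
  have bij: "bij_betw ?ax UNIV Basis"
    unfolding bij_betw_def inj_on_def Basis_vec_def by (auto simp: axis_eq_axis)
  define h where "h b = g (inv ?ax b)" for b
  have inv: "inv ?ax (?ax i) = i" for i
    by (rule inv_f_f) (auto simp: inj_on_def axis_eq_axis)
  let ?s = "\<lambda>f. \<Sum>b\<in>Basis. f b *\<^sub>R (b :: real^'d)"
  let ?P = "Pi\<^sub>M (Basis :: (real^'d) set) (\<lambda>_. lborel :: real measure)"
  have s: "?s f $ i = f (?ax i)" for f i
  proof -
    have "?s f $ i = ?s f \<bullet> ?ax i" by (simp add: cart_eq_inner_axis)
    also have "\<dots> = f (?ax i)" using bij by (subst inner_sum_left_Basis) (auto simp: bij_betw_def)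
    finally show ?thesis .
  qed
  have pr: "(\<Prod>i\<in>UNIV. g i (?s f $ i)) = (\<Prod>b\<in>Basis. h b (f b))" for f
    unfolding s by (subst prod.reindex_bij_betw[OF bij, symmetric]) (simp add: h_def inv)
  have pi: "(\<Prod>i\<in>UNIV. (LINT t|lborel. g i t)) = (\<Prod>b\<in>Basis. (LINT t|lborel. h b t))"
    by (subst prod.reindex_bij_betw[OF bij, symmetric]) (simp add: h_def inv)
  have ms: "?s \<in> measurable ?P borel" by measurable
  have lb: "(lborel :: (real^'d) measure) = distr ?P borel ?s" by (rule lborel_eq)
  have hi: "integrable lborel (h b)" for b unfolding h_def by (rule int)
  show "integrable lborel (\<lambda>x::real^'d. \<Prod>i\<in>UNIV. g i (x $ i))"
    unfolding lb by (subst integrable_distr_eq[OF ms]) (simp_all add: pr product_integrable_prod hi del: sum_component)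
  show "(LINT x|(lborel :: (real^'d) measure). (\<Prod>i\<in>UNIV. g i (x $ i))) = (\<Prod>i\<in>UNIV. (LINT t|lborel. g i t))"
    unfolding lb by (subst integral_distr[OF ms]) (simp_all add: pr pi product_integral_prod hi del: sum_component)
qed

lemma sum_box_prod:
  fixes f :: "'d::finite \<Rightarrow> nat \<Rightarrow> real" and N :: nat
  defines "F \<equiv> {\<kappa> :: nat^'d. \<forall>i. \<kappa> $ i \<le> N}"
  shows "finite F" and "(\<Sum>\<kappa>\<in>F. \<Prod>i\<in>UNIV. f i (\<kappa> $ i)) = (\<Prod>i\<in>UNIV. \<Sum>k\<le>N. f i k)"
proof -
  have bij: "bij_betw vec_lambda (PiE UNIV (\<lambda>_::'d. {..N})) F"
    by (rule bij_betw_byWitness[where f' = vec_nth]) (auto simp: F_def PiE_def Pi_def)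
  then show "finite F" by (rule bij_betw_finite[THEN iffD1]) (auto intro: finite_PiE)
  have "(\<Prod>i\<in>UNIV. \<Sum>k\<le>N. f i k) = (\<Sum>g\<in>PiE UNIV (\<lambda>_. {..N}). \<Prod>i\<in>UNIV. f i (g i))"
    by (rule prod_sum_PiE) auto
  also have "\<dots> = (\<Sum>\<kappa>\<in>F. \<Prod>i\<in>UNIV. f i (\<kappa> $ i))"
    by (subst sum.reindex_bij_betw[OF bij, symmetric]) simp
  finally show "(\<Sum>\<kappa>\<in>F. \<Prod>i\<in>UNIV. f i (\<kappa> $ i)) = (\<Prod>i\<in>UNIV. \<Sum>k\<le>N. f i k)" ..
qed

locale jacobi_parameters =
  fixes \<alpha> \<beta> :: "real ^ 'd"
  assumes \<alpha>_gt: "\<And>i. \<alpha> $ i > -1/2" and \<beta>_gt: "\<And>i. \<beta> $ i > -1/2"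
begin

abbreviation "cube \<equiv> cbox (-1) (1 :: real^'d)"
abbreviation "M \<equiv> jacobi_measure \<alpha> \<beta>"
abbreviation "P \<equiv> jacobi_basis \<alpha> \<beta>"
abbreviation "eig \<equiv> jacobi_lambda \<alpha> \<beta>"
abbreviation "fin_supp c \<equiv> finite {\<kappa>. c \<kappa> \<noteq> (0::real)}"

lemma gt_minus_one: "\<alpha> $ i > -1" "\<beta> $ i > -1"
  using \<alpha>_gt[of i] \<beta>_gt[of i] by auto

lemma mem_cube: "x \<in> cube \<longleftrightarrow> (\<forall>i. x $ i \<in> {-1..1})"
  by (simp add: mem_box_cart)

lemma sets_M [simp, measurable_cong]: "sets M = sets borel" and space_M [simp]: "space M = UNIV"
  by (simp_all add: jacobi_measure_def)

lemma jacobi_density: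
  "indicator cube x * (\<Prod>i\<in>UNIV. jacobi_weight (\<alpha> $ i) (\<beta> $ i) (x $ i))
    = (\<Prod>i\<in>UNIV. indicator {-1..1} (x $ i) * jacobi_weight (\<alpha> $ i) (\<beta> $ i) (x $ i))"
proof (cases "x \<in> cube")
  case True
  then have "indicator {-1..1} (x $ i) = (1::real)" for i by (simp add: mem_cube)
  then show ?thesis using True by simp
next
  case False
  then obtain i where "x $ i \<notin> {-1..1}" by (auto simp: mem_cube)
  then have "(\<Prod>i\<in>UNIV. indicator {-1..1} (x $ i) * jacobi_weight (\<alpha> $ i) (\<beta> $ i) (x $ i)) = 0"
    by (intro prod_zero) (auto intro!: exI[of _ i])
  then show ?thesis using False by simp
qed

lemma jacobi_density_nonneg: "0 \<le> indicator cube x * (\<Prod>i\<in>UNIV. jacobi_weight (\<alpha> $ i) (\<beta> $ i) (x $ i))"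
  by (intro mult_nonneg_nonneg prod_nonneg) (auto intro: jacobi_weight_nonneg gt_minus_one)

lemma jacobi_density_measurable [measurable]:
  "(\<lambda>x. indicator cube x * (\<Prod>i\<in>UNIV. jacobi_weight (\<alpha> $ i) (\<beta> $ i) (x $ i))) \<in> borel_measurable borel"
  by measurable

lemma AE_M: "(AE x in lborel. Q x) \<Longrightarrow> AE x in M. Q x"
  unfolding jacobi_measure_def by (subst AE_density) auto

lemma AE_M_cube: "AE x in M. x \<in> cube"
  unfolding jacobi_measure_def by (subst AE_density) (auto intro!: AE_I2 simp: indicator_def)

lemma integral_M_product:
  fixes q :: "'d \<Rightarrow> real poly"
  shows "integrable M (\<lambda>x. \<Prod>i\<in>UNIV. poly (q i) (x $ i))"
    and "(LINT x|M. (\<Prod>i\<in>UNIV. poly (q i) (x $ i))) = (\<Prod>i\<in>UNIV. (LINT t|jacobi_measure1 (\<alpha> $ i) (\<beta> $ i). poly (q i) t))"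
proof -
  define g where "g i t = indicator {-1..1} t * jacobi_weight (\<alpha> $ i) (\<beta> $ i) t * poly (q i) t" for i t
  have gi: "integrable lborel (g i)" for i
    unfolding g_def by (rule integrable_jacobi_measure1(1)[OF gt_minus_one]) (auto intro!: continuous_intros)
  have gv: "(LINT t|lborel. g i t) = (LINT t|jacobi_measure1 (\<alpha> $ i) (\<beta> $ i). poly (q i) t)" for i
    unfolding g_def by (rule integrable_jacobi_measure1(3)[OF gt_minus_one, symmetric]) (auto intro!: continuous_intros)
  have e: "(indicator cube x * (\<Prod>i\<in>UNIV. jacobi_weight (\<alpha> $ i) (\<beta> $ i) (x $ i))) *\<^sub>R (\<Prod>i\<in>UNIV. poly (q i) (x $ i))
     = (\<Prod>i\<in>UNIV. g i (x $ i))" for x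
    unfolding jacobi_density g_def by (simp add: prod.distrib)
  let ?w = "\<lambda>x. indicator cube x * (\<Prod>i\<in>UNIV. jacobi_weight (\<alpha> $ i) (\<beta> $ i) (x $ i))"
  have nn: "AE x in lborel. 0 \<le> ?w x" by (intro AE_I2 jacobi_density_nonneg)
  have m: "(\<lambda>x::real^'d. \<Prod>i\<in>UNIV. poly (q i) (x $ i)) \<in> borel_measurable lborel" "?w \<in> borel_measurable lborel"
    using jacobi_density_measurable by simp_all
  show "integrable M (\<lambda>x. \<Prod>i\<in>UNIV. poly (q i) (x $ i))"
    unfolding jacobi_measure_def integrable_density[OF m nn] e by (rule lborel_vec_product(1)[OF gi])
  show "(LINT x|M. (\<Prod>i\<in>UNIV. poly (q i) (x $ i))) = (\<Prod>i\<in>UNIV. (LINT t|jacobi_measure1 (\<alpha> $ i) (\<beta> $ i). poly (q i) t))"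
    unfolding jacobi_measure_def integral_density[OF m nn] e lborel_vec_product(2)[OF gi] gv ..
qed

sublocale M: finite_measure M
proof
  have "integrable M (\<lambda>x. 1::real)" using integral_M_product(1)[of "\<lambda>_. 1"] by simp
  then show "emeasure M (space M) \<noteq> \<infinity>" by (simp add: integrable_iff_bounded less_top)
qed

lemma integrable_M_continuous:
  assumes "f \<in> borel_measurable borel" "continuous_on cube f"
  shows "integrable M (f :: real^'d \<Rightarrow> real)"
proof -
  obtain B where "\<And>x. x \<in> cube \<Longrightarrow> \<bar>f x\<bar> \<le> B"
    using compact_imp_bounded[OF compact_continuous_image[OF assms(2) compact_cbox]] unfolding bounded_iff
    by (metis imageI real_norm_def)
  then show ?thesis using AE_M_cube assms(1) by (intro M.integrable_const_bound[of _ B]) auto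
qed

lemma P_product: "P \<kappa> x = (\<Prod>i\<in>UNIV. poly (jacobi_poly (\<alpha> $ i) (\<beta> $ i) (\<kappa> $ i)) (x $ i))"
  by (simp add: jacobi_basis_def)

lemma P_continuous [continuous_intros]: "continuous_on S (P \<kappa>)"
  unfolding jacobi_basis_def[abs_def] by (intro continuous_intros)

lemma P_measurable [measurable]: "P \<kappa> \<in> borel_measurable borel"
  by (intro borel_measurable_continuous_onI continuous_intros)

lemma P_orthonormal:
  "integrable M (\<lambda>x. P \<kappa> x * P \<nu> x)" "(LINT x|M. P \<kappa> x * P \<nu> x) = (if \<kappa> = \<nu> then 1 else 0)"
proof -
  let ?q = "\<lambda>i. jacobi_poly (\<alpha> $ i) (\<beta> $ i) (\<kappa> $ i) * jacobi_poly (\<alpha> $ i) (\<beta> $ i) (\<nu> $ i)"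
  have e: "P \<kappa> x * P \<nu> x = (\<Prod>i\<in>UNIV. poly (?q i) (x $ i))" for x
    by (simp add: P_product prod.distrib)
  show "integrable M (\<lambda>x. P \<kappa> x * P \<nu> x)" unfolding e by (rule integral_M_product)
  have "(LINT x|M. P \<kappa> x * P \<nu> x) = (\<Prod>i\<in>UNIV. if \<kappa> $ i = \<nu> $ i then 1 else 0)"
  proof -
    have "poly (?q i) = (\<lambda>t. poly (jacobi_poly (\<alpha> $ i) (\<beta> $ i) (\<kappa> $ i)) t * poly (jacobi_poly (\<alpha> $ i) (\<beta> $ i) (\<nu> $ i)) t)" for i
      by (simp add: fun_eq_iff)
    then show ?thesis
      unfolding e integral_M_product(2) by (simp only: jacobi_poly_orthonormal[OF gt_minus_one])
  qed
  also have "\<dots> = (if \<kappa> = \<nu> then 1 else 0)"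
    by (auto simp: vec_eq_iff intro!: prod_zero)
  finally show "(LINT x|M. P \<kappa> x * P \<nu> x) = (if \<kappa> = \<nu> then 1 else 0)" .
qed

text \<open>
  Polynomials are handled through their finitely supported families of coefficients, so that a multiplier simply acts by
  pointwise multiplication of coefficients.
\<close>
definition jacobi_sum :: "(nat^'d \<Rightarrow> real) \<Rightarrow> real^'d \<Rightarrow> real" where
  "jacobi_sum c x = (\<Sum>\<kappa> | c \<kappa> \<noteq> 0. c \<kappa> * P \<kappa> x)"

lemma jacobi_sum_eq: "finite F \<Longrightarrow> {\<kappa>. c \<kappa> \<noteq> 0} \<subseteq> F \<Longrightarrow> jacobi_sum c x = (\<Sum>\<kappa>\<in>F. c \<kappa> * P \<kappa> x)"
  unfolding jacobi_sum_def by (rule sum.mono_neutral_left) auto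

lemma jacobi_sum_continuous [continuous_intros]: "continuous_on S (jacobi_sum c)"
  unfolding jacobi_sum_def[abs_def] by (intro continuous_intros)

lemma jacobi_sum_measurable [measurable]: "jacobi_sum c \<in> borel_measurable borel"
  by (intro borel_measurable_continuous_onI continuous_intros)

lemma jacobi_sum_integrable: "integrable M (jacobi_sum c)"
  by (rule integrable_M_continuous) (auto intro: continuous_intros)

lemma fin_supp_linear: "fin_supp c \<Longrightarrow> fin_supp d \<Longrightarrow> fin_supp (\<lambda>\<kappa>. a * c \<kappa> + b * d \<kappa>)"
  by (rule finite_subset[of _ "{\<kappa>. c \<kappa> \<noteq> 0} \<union> {\<kappa>. d \<kappa> \<noteq> 0}"]) auto

lemma fin_supp_mult: "fin_supp c \<Longrightarrow> fin_supp (\<lambda>\<kappa>. m \<kappa> * c \<kappa>)"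
  by (rule finite_subset[of _ "{\<kappa>. c \<kappa> \<noteq> 0}"]) auto

lemma jacobi_sum_linear:
  assumes "fin_supp c" "fin_supp d"
  shows "jacobi_sum (\<lambda>\<kappa>. a * c \<kappa> + b * d \<kappa>) x = a * jacobi_sum c x + b * jacobi_sum d x"
proof -
  let ?F = "{\<kappa>. c \<kappa> \<noteq> 0} \<union> {\<kappa>. d \<kappa> \<noteq> 0}"
  have F: "finite ?F" using assms by simp
  have "jacobi_sum c x = (\<Sum>\<kappa>\<in>?F. c \<kappa> * P \<kappa> x)" "jacobi_sum d x = (\<Sum>\<kappa>\<in>?F. d \<kappa> * P \<kappa> x)"
    "jacobi_sum (\<lambda>\<kappa>. a * c \<kappa> + b * d \<kappa>) x = (\<Sum>\<kappa>\<in>?F. (a * c \<kappa> + b * d \<kappa>) * P \<kappa> x)"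
    by (rule jacobi_sum_eq[OF F]; auto)+
  then show ?thesis by (simp add: sum.distrib sum_distrib_left algebra_simps)
qed

lemma jacobi_sum_mult:
  assumes "fin_supp c"
  shows "jacobi_sum (\<lambda>\<kappa>. m \<kappa> * c \<kappa>) x = (\<Sum>\<kappa> | c \<kappa> \<noteq> 0. m \<kappa> * c \<kappa> * P \<kappa> x)"
  by (rule jacobi_sum_eq[OF assms]) auto

lemma jacobi_coeff_jacobi_sum:
  assumes "fin_supp c"
  shows "jacobi_coeff \<alpha> \<beta> (jacobi_sum c) \<kappa> = c \<kappa>"
proof -
  have "jacobi_coeff \<alpha> \<beta> (jacobi_sum c) \<kappa> = (LINT x|M. (\<Sum>\<nu> | c \<nu> \<noteq> 0. c \<nu> * (P \<nu> x * P \<kappa> x)))"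
    unfolding jacobi_coeff_def jacobi_sum_def sum_distrib_right mult.assoc ..
  also have "\<dots> = (\<Sum>\<nu> | c \<nu> \<noteq> 0. c \<nu> * (if \<nu> = \<kappa> then 1 else 0))"
    by (subst Bochner_Integration.integral_sum) (auto simp: P_orthonormal)
  also have "\<dots> = (\<Sum>\<nu> | c \<nu> \<noteq> 0. if \<nu> = \<kappa> then c \<nu> else 0)" by (rule sum.cong) auto
  also have "\<dots> = c \<kappa>" using assms by (subst sum.delta) auto
  finally show ?thesis .
qed

text \<open>
  Each factor is expanded in one-dimensional Jacobi polynomials, and the product of the expansions is multiplied out.
\<close>
lemma poly_product_eq_jacobi_sum:
  fixes q :: "'d \<Rightarrow> real poly"
  shows "\<exists>c. fin_supp c \<and> (\<lambda>x. \<Prod>i\<in>UNIV. poly (q i) (x $ i)) = jacobi_sum c"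
proof -
  define N where "N = Max (range (\<lambda>i. degree (q i)))"
  have "degree (q i) \<le> N" for i unfolding N_def by (intro Max_ge) auto
  then have "\<exists>c. q i = (\<Sum>k\<le>N. smult (c k) (jacobi_poly (\<alpha> $ i) (\<beta> $ i) k))" for i
    using jacobi_poly_spanning[OF gt_minus_one] by metis
  then obtain c where c: "\<And>i. q i = (\<Sum>k\<le>N. smult (c i k) (jacobi_poly (\<alpha> $ i) (\<beta> $ i) k))" by metis
  define F where "F = {\<kappa> :: nat^'d. \<forall>i. \<kappa> $ i \<le> N}"
  have F: "finite F" unfolding F_def by (rule sum_box_prod)
  define d where "d \<kappa> = (if \<kappa> \<in> F then \<Prod>i\<in>UNIV. c i (\<kappa> $ i) else 0)" for \<kappa>
  have "(\<Prod>i\<in>UNIV. poly (q i) (x $ i)) = jacobi_sum d x" for x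
  proof -
    have "(\<Prod>i\<in>UNIV. poly (q i) (x $ i)) = (\<Prod>i\<in>UNIV. \<Sum>k\<le>N. c i k * poly (jacobi_poly (\<alpha> $ i) (\<beta> $ i) k) (x $ i))"
      by (subst c) (simp add: poly_sum)
    also have "\<dots> = (\<Sum>\<kappa>\<in>F. \<Prod>i\<in>UNIV. c i (\<kappa> $ i) * poly (jacobi_poly (\<alpha> $ i) (\<beta> $ i) (\<kappa> $ i)) (x $ i))"
      unfolding F_def by (rule sum_box_prod(2)[symmetric])
    also have "\<dots> = (\<Sum>\<kappa>\<in>F. d \<kappa> * P \<kappa> x)"
      by (rule sum.cong) (auto simp: d_def P_product prod.distrib)
    also have "\<dots> = jacobi_sum d x" by (rule jacobi_sum_eq[symmetric, OF F]) (auto simp: d_def)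
    finally show ?thesis .
  qed
  moreover have "fin_supp d" by (rule finite_subset[OF _ F]) (auto simp: d_def)
  ultimately show ?thesis by blast
qed

lemma jacobi_sum_sum_exists:
  assumes "finite F" "\<And>k. k \<in> F \<Longrightarrow> \<exists>c. fin_supp c \<and> g k = jacobi_sum c"
  shows "\<exists>c. fin_supp c \<and> (\<lambda>x. \<Sum>k\<in>F. a k * g k x) = jacobi_sum c"
  using assms
proof (induction F rule: finite_induct)
  case empty
  show ?case by (rule exI[of _ "\<lambda>_. 0"]) (auto simp: jacobi_sum_def)
next
  case (insert k F)
  then obtain c where c: "fin_supp c" "(\<lambda>x. \<Sum>k\<in>F. a k * g k x) = jacobi_sum c" by blast
  obtain d where d: "fin_supp d" "g k = jacobi_sum d" using insert.prems[of k] by blast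
  have "(\<lambda>x. \<Sum>k\<in>insert k F. a k * g k x) = jacobi_sum (\<lambda>\<kappa>. 1 * c \<kappa> + a k * d \<kappa>)"
    using insert.hyps fun_cong[OF c(2)] unfolding jacobi_sum_linear[OF c(1) d(1), abs_def] d(2)
    by (simp add: fun_eq_iff d(2))
  then show ?case
    by - (rule exI, rule conjI, rule fin_supp_linear[OF c(1) d(1)], assumption)
qed

lemma real_polynomial_function_jacobi_sum:
  assumes "real_polynomial_function f"
  shows "\<exists>c. fin_supp c \<and> f = jacobi_sum c"
  using assms
proof (induction rule: real_polynomial_function.induct)
  case (linear f)
  have "f x = (\<Sum>i\<in>UNIV. f (axis i 1) * x $ i)" for x
  proof -
    interpret bounded_linear f by fact
    have "f x = f (\<Sum>i\<in>UNIV. x $ i *\<^sub>R axis i 1)" by (metis basis_expansion scalar_mult_eq_scaleR)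
    then show ?thesis by (simp add: sum scaleR mult.commute)
  qed
  then have f: "f = (\<lambda>x. \<Sum>i\<in>UNIV. f (axis i 1) * x $ i)" by blast
  have "\<exists>c. fin_supp c \<and> (\<lambda>x::real^'d. x $ i) = jacobi_sum c" for i
  proof -
    have "(\<lambda>x::real^'d. x $ i) = (\<lambda>x. \<Prod>j\<in>UNIV. poly (if j = i then [:0, 1:] else 1) (x $ j))"
    proof
      fix x :: "real^'d"
      have "(\<Prod>j\<in>UNIV. poly (if j = i then [:0, 1:] else 1) (x $ j)) = (\<Prod>j\<in>UNIV. if j = i then x $ j else 1)"
        by (rule prod.cong) auto
      then show "x $ i = (\<Prod>j\<in>UNIV. poly (if j = i then [:0, 1:] else 1) (x $ j))" by (simp add: prod.delta)
    qed
    then show ?thesis using poly_product_eq_jacobi_sum by metis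
  qed
  then show ?case by (subst f) (rule jacobi_sum_sum_exists; simp)
next
  case (const a)
  obtain c where c: "fin_supp c" "(\<lambda>x::real^'d. 1) = jacobi_sum c" using poly_product_eq_jacobi_sum[of "\<lambda>_. 1"] by auto
  have "(\<lambda>x. a) = jacobi_sum (\<lambda>\<kappa>. a * c \<kappa> + 0 * c \<kappa>)"
    unfolding jacobi_sum_linear[OF c(1) c(1), abs_def] using fun_cong[OF c(2)] by (simp add: fun_eq_iff)
  then show ?case
    by - (rule exI, rule conjI, rule fin_supp_linear[OF c(1) c(1)], assumption)
next
  case (add f g)
  then obtain c d where c: "fin_supp c" "f = jacobi_sum c" and d: "fin_supp d" "g = jacobi_sum d" by blast
  then have "(\<lambda>x. f x + g x) = jacobi_sum (\<lambda>\<kappa>. 1 * c \<kappa> + 1 * d \<kappa>)" unfolding jacobi_sum_linear[OF c(1) d(1), abs_def] by simp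
  then show ?case
    by - (rule exI, rule conjI, rule fin_supp_linear[OF c(1) d(1)], assumption)
next
  case (mult f g)
  then obtain c d where c: "fin_supp c" "f = jacobi_sum c" and d: "fin_supp d" "g = jacobi_sum d" by blast
  let ?F = "{\<kappa>. c \<kappa> \<noteq> 0} \<times> {\<kappa>. d \<kappa> \<noteq> 0}"
  have "(\<lambda>x. f x * g x) = (\<lambda>x. \<Sum>z\<in>?F. (c (fst z) * d (snd z)) * (P (fst z) x * P (snd z) x))"
    unfolding c(2) d(2) jacobi_sum_def by (simp add: sum_product sum.cartesian_product case_prod_beta mult_ac)
  moreover have "\<exists>e. fin_supp e \<and> (\<lambda>x. P \<kappa> x * P \<nu> x) = jacobi_sum e" for \<kappa> \<nu>
    using poly_product_eq_jacobi_sum[of "\<lambda>i. jacobi_poly (\<alpha> $ i) (\<beta> $ i) (\<kappa> $ i) * jacobi_poly (\<alpha> $ i) (\<beta> $ i) (\<nu> $ i)"]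
    by (simp add: P_product prod.distrib)
  ultimately show ?case
    using jacobi_sum_sum_exists[of ?F "\<lambda>z x. P (fst z) x * P (snd z) x" "\<lambda>z. c (fst z) * d (snd z)"] c(1) d(1) by simp
qed

end

section \<open>Positivity preserving multipliers\<close>

lemma jacobi_op_add: "jacobi_op a b (u + v) = jacobi_op a b u + jacobi_op a b v"
  by (simp add: jacobi_op_def pderiv_add distrib_left)

lemma jacobi_op_sum: "jacobi_op a b (\<Sum>k\<in>F. smult (d k) (v k)) = (\<Sum>k\<in>F. smult (d k) (jacobi_op a b (v k)))"
proof (induction F rule: infinite_finite_induct)
  case (insert k F)
  then show ?case by (simp add: jacobi_op_add jacobi_op_smult)
qed (simp_all add: jacobi_op_def)

lemma powr_abs_add_le:
  fixes a b p :: real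
  assumes "p > 0"
  shows "\<bar>a + b\<bar> powr p \<le> 2 powr p * (\<bar>a\<bar> powr p + \<bar>b\<bar> powr p)"
proof -
  let ?m = "max \<bar>a\<bar> \<bar>b\<bar>"
  have "\<bar>a + b\<bar> powr p \<le> (2 * ?m) powr p" using assms by (intro powr_mono2) auto
  also have "\<dots> = 2 powr p * ?m powr p" by (rule powr_mult)
  also have "?m powr p \<le> \<bar>a\<bar> powr p + \<bar>b\<bar> powr p" by (auto simp: max_def)
  finally show ?thesis by simp
qed

text \<open>
  Every point of the graph of \<open>|t|^p\<close> has a supporting line. This is the only form of convexity that the contraction
  property and Jensen's inequality below rely on.
\<close>
lemma powr_abs_tangent:
  fixes p c :: real
  assumes p: "p > 1"
  obtains s where "\<And>t. \<bar>t\<bar> powr p \<ge> \<bar>c\<bar> powr p + s * (t - c)"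
proof -
  have pos: "\<bar>t\<bar> powr p \<ge> c powr p + (p * c powr (p - 1)) * (t - c)" if c: "c > 0" for c t :: real
  proof (cases "t > 0")
    case True
    have "((\<lambda>x. x powr p) has_field_derivative p * c powr (p - 1)) (at c within {0<..})"
      by (rule has_field_derivative_at_within[OF has_real_derivative_powr[OF c]])
    then have "t powr p - c powr p \<ge> (p * c powr (p - 1)) * (t - c)"
      using p c True by (intro convex_on_imp_above_tangent[OF powr_convex]) (auto simp: interior_open)
    then show ?thesis using True by simp
  next
    case False
    have "c powr p = c powr (p - 1) * c" using c by (simp add: powr_diff)
    have "(p * c powr (p - 1)) * (t - c) \<le> (p * c powr (p - 1)) * (- c)"
      using False p by (intro mult_left_mono) auto
    also have "\<dots> = - (p * c powr p)" using \<open>c powr p = _\<close> by simp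
    also have "\<dots> \<le> - (1 * c powr p)" using p by (intro le_imp_neg_le mult_right_mono) auto
    finally show ?thesis using powr_ge_zero[of "\<bar>t\<bar>" p] by linarith
  qed
  consider "c = 0" | "c > 0" | "- c > 0" by linarith
  then show ?thesis
  proof cases
    case 1
    then show ?thesis using that[of 0] by simp
  next
    case 2
    then show ?thesis using that[of "p * c powr (p - 1)"] pos[OF 2] by simp
  next
    case 3
    have "\<bar>t\<bar> powr p \<ge> \<bar>c\<bar> powr p + (- (p * (- c) powr (p - 1))) * (t - c)" for t
      using pos[OF 3, of "- t"] 3 by (simp add: algebra_simps)
    then show ?thesis using that by blast
  qed
qed

context jacobi_parameters
begin

lemma eig_term_ge: "real k * (real k + \<alpha> $ i + \<beta> $ i + 1) \<ge> (real k)\<^sup>2"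
proof -
  have "real k * (\<alpha> $ i + \<beta> $ i + 1) \<ge> 0" using \<alpha>_gt[of i] \<beta>_gt[of i] by (intro mult_nonneg_nonneg) auto
  then show ?thesis by (simp add: power2_eq_square algebra_simps)
qed

lemma eig_ge: "eig \<kappa> \<ge> (\<Sum>i\<in>UNIV. (real (\<kappa> $ i))\<^sup>2)"
  unfolding jacobi_lambda_def by (intro sum_mono eig_term_ge)

lemma eig_nonneg: "eig \<kappa> \<ge> 0"
  by (rule order_trans[OF sum_nonneg eig_ge]) auto

lemma eig_0: "eig 0 = 0"
  by (simp add: jacobi_lambda_def)

text \<open>
  The operator with symbol \<^const>\<open>jacobi_lambda\<close> is the sum of the one-dimensional Jacobi operators in the coordinates, and the
  restriction of the polynomial to each coordinate line through the minimum has its minimum there.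
\<close>
lemma jacobi_sum_eig_nonpos_at_min:
  assumes c: "fin_supp c" and x: "x \<in> cube" and min: "\<And>y. y \<in> cube \<Longrightarrow> jacobi_sum c x \<le> jacobi_sum c y"
  shows "jacobi_sum (\<lambda>\<kappa>. eig \<kappa> * c \<kappa>) x \<le> 0"
proof -
  let ?F = "{\<kappa>. c \<kappa> \<noteq> 0}"
  let ?p = "\<lambda>\<kappa> i. jacobi_poly (\<alpha> $ i) (\<beta> $ i) (\<kappa> $ i)"
  define d where "d i \<kappa> = c \<kappa> * (\<Prod>j\<in>UNIV - {i}. poly (?p \<kappa> j) (x $ j))" for i \<kappa>
  define v where "v i = (\<Sum>\<kappa>\<in>?F. smult (d i \<kappa>) (?p \<kappa> i))" for i
  have dP: "d i \<kappa> * poly (?p \<kappa> i) (x $ i) = c \<kappa> * P \<kappa> x" for i \<kappa>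
    unfolding d_def P_product by (subst (2) prod.remove[of _ i]) auto
  have v: "poly (v i) t = jacobi_sum c (\<chi> j. if j = i then t else x $ j)" for i t
  proof -
    have "d i \<kappa> * poly (?p \<kappa> i) t = c \<kappa> * P \<kappa> (\<chi> j. if j = i then t else x $ j)" for \<kappa>
      unfolding d_def P_product by (subst (2) prod.remove[of _ i]) (auto intro!: prod.cong)
    then show ?thesis by (simp add: v_def jacobi_sum_def poly_sum)
  qed
  have op: "poly (jacobi_op (\<alpha> $ i) (\<beta> $ i) (v i)) (x $ i)
      = (\<Sum>\<kappa>\<in>?F. real (\<kappa> $ i) * (real (\<kappa> $ i) + \<alpha> $ i + \<beta> $ i + 1) * (c \<kappa> * P \<kappa> x))" for i
    unfolding v_def jacobi_op_sum jacobi_op_jacobi_poly[OF gt_minus_one] dP[of i, symmetric]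
    by (simp add: poly_sum mult_ac)
  have xx: "(\<chi> j. if j = i then x $ i else x $ j) = x" for i by (simp add: vec_eq_iff)
  have "poly (jacobi_op (\<alpha> $ i) (\<beta> $ i) (v i)) (x $ i) \<le> 0" for i
  proof (rule jacobi_op_nonpos_at_min[OF gt_minus_one])
    show "x $ i \<in> {-1..1}" using x by (simp add: mem_cube)
    show "poly (v i) (x $ i) \<le> poly (v i) t" if "t \<in> {-1..1}" for t
      unfolding v xx using x that by (intro min) (auto simp: mem_cube)
  qed
  then have "(\<Sum>i\<in>UNIV. poly (jacobi_op (\<alpha> $ i) (\<beta> $ i) (v i)) (x $ i)) \<le> 0" by (intro sum_nonpos)
  also have "(\<Sum>i\<in>UNIV. poly (jacobi_op (\<alpha> $ i) (\<beta> $ i) (v i)) (x $ i)) = (\<Sum>\<kappa>\<in>?F. eig \<kappa> * (c \<kappa> * P \<kappa> x))"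
    unfolding op by (subst sum.swap) (simp add: jacobi_lambda_def sum_distrib_right)
  also have "\<dots> = jacobi_sum (\<lambda>\<kappa>. eig \<kappa> * c \<kappa>) x" unfolding jacobi_sum_mult[OF c] by (simp add: mult.assoc)
  finally show ?thesis .
qed

text \<open>
  Positivity is tested on the cube, which carries the measure; outside of it the polynomials may take either sign.
\<close>
definition positive_symbol :: "(nat^'d \<Rightarrow> real) \<Rightarrow> bool" where
  "positive_symbol m \<longleftrightarrow> (\<forall>c. fin_supp c \<longrightarrow> (\<forall>x\<in>cube. 0 \<le> jacobi_sum c x) \<longrightarrow> (\<forall>x\<in>cube. 0 \<le> jacobi_sum (\<lambda>\<kappa>. m \<kappa> * c \<kappa>) x))"

lemma positive_symbolD:
  "positive_symbol m \<Longrightarrow> fin_supp c \<Longrightarrow> (\<And>x. x \<in> cube \<Longrightarrow> 0 \<le> jacobi_sum c x) \<Longrightarrow> x \<in> cube \<Longrightarrow> 0 \<le> jacobi_sum (\<lambda>\<kappa>. m \<kappa> * c \<kappa>) x"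
  unfolding positive_symbol_def by blast

lemma cube_nonempty: "cube \<noteq> {}"
proof -
  have "0 \<in> cube" by (simp add: mem_cube)
  then show ?thesis by blast
qed

text \<open>
  If \<open>u\<close> is the image of \<open>f\<close> then \<open>f = u + s L u\<close>. At a minimum of \<open>u\<close> on the cube \<open>L u\<close> is not positive, hence the minimum of \<open>u\<close> is
  at least the value of \<open>f\<close> there.
\<close>
lemma positive_symbol_resolvent:
  assumes s: "s \<ge> 0"
  shows "positive_symbol (\<lambda>\<kappa>. 1 / (1 + s * eig \<kappa>))"
  unfolding positive_symbol_def
proof (intro allI impI ballI)
  fix c x assume c: "fin_supp c" and nn: "\<forall>x\<in>cube. 0 \<le> jacobi_sum c x" and x: "x \<in> cube"
  define e where "e = (\<lambda>\<kappa>. 1 / (1 + s * eig \<kappa>) * c \<kappa>)"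
  have e: "fin_supp e" unfolding e_def by (rule fin_supp_mult[OF c])
  have ne: "1 + s * eig \<kappa> \<noteq> 0" for \<kappa> using mult_nonneg_nonneg[OF s eig_nonneg[of \<kappa>]] by linarith
  obtain z where z: "z \<in> cube" "\<And>y. y \<in> cube \<Longrightarrow> jacobi_sum e z \<le> jacobi_sum e y"
    using continuous_attains_inf[OF compact_cbox cube_nonempty jacobi_sum_continuous] by blast
  have "c = (\<lambda>\<kappa>. 1 * e \<kappa> + s * (eig \<kappa> * e \<kappa>))"
  proof
    fix \<kappa>
    have "1 * e \<kappa> + s * (eig \<kappa> * e \<kappa>) = (1 + s * eig \<kappa>) * e \<kappa>" by (simp add: algebra_simps)
    then show "c \<kappa> = 1 * e \<kappa> + s * (eig \<kappa> * e \<kappa>)" using ne[of \<kappa>] by (simp add: e_def)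
  qed
  then have "jacobi_sum c z = 1 * jacobi_sum e z + s * jacobi_sum (\<lambda>\<kappa>. eig \<kappa> * e \<kappa>) z"
    using jacobi_sum_linear[OF e fin_supp_mult[OF e, of eig], of 1 s z] by simp
  moreover have "s * jacobi_sum (\<lambda>\<kappa>. eig \<kappa> * e \<kappa>) z \<le> 0"
    using s jacobi_sum_eig_nonpos_at_min[OF e z] by (intro mult_nonneg_nonpos)
  ultimately have "0 \<le> jacobi_sum e z" using nn z(1) by fastforce
  also have "\<dots> \<le> jacobi_sum e x" by (rule z(2)[OF x])
  finally show "0 \<le> jacobi_sum (\<lambda>\<kappa>. 1 / (1 + s * eig \<kappa>) * c \<kappa>) x" by (simp add: e_def)
qed

lemma positive_symbol_power:
  assumes "positive_symbol m"
  shows "positive_symbol (\<lambda>\<kappa>. m \<kappa> ^ n)"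
proof (induction n)
  case 0
  show ?case by (simp add: positive_symbol_def)
next
  case (Suc n)
  show ?case unfolding positive_symbol_def
  proof (intro allI impI ballI)
    fix c x assume c: "fin_supp c" and nn: "\<forall>x\<in>cube. 0 \<le> jacobi_sum c x" and x: "x \<in> cube"
    have "0 \<le> jacobi_sum (\<lambda>\<kappa>. m \<kappa> * (m \<kappa> ^ n * c \<kappa>)) x"
      by (rule positive_symbolD[OF assms fin_supp_mult[OF c] positive_symbolD[OF Suc.IH c]]) (use nn x in auto)
    then show "0 \<le> jacobi_sum (\<lambda>\<kappa>. m \<kappa> ^ Suc n * c \<kappa>) x" by (simp add: mult.assoc)
  qed
qed

lemma positive_symbol_limit:
  assumes "\<And>n. positive_symbol (m n)" and lim: "\<And>\<kappa>. (\<lambda>n. m n \<kappa>) \<longlonglongrightarrow> l \<kappa>"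
  shows "positive_symbol l"
  unfolding positive_symbol_def
proof (intro allI impI ballI)
  fix c x assume c: "fin_supp c" and nn: "\<forall>x\<in>cube. 0 \<le> jacobi_sum c x" and x: "x \<in> cube"
  have "(\<lambda>n. jacobi_sum (\<lambda>\<kappa>. m n \<kappa> * c \<kappa>) x) \<longlonglongrightarrow> jacobi_sum (\<lambda>\<kappa>. l \<kappa> * c \<kappa>) x"
    unfolding jacobi_sum_mult[OF c] by (intro tendsto_intros lim)
  then show "0 \<le> jacobi_sum (\<lambda>\<kappa>. l \<kappa> * c \<kappa>) x"
    by (rule LIMSEQ_le_const) (use positive_symbolD[OF assms(1) c] nn x in blast)
qed

text \<open>
  The Jacobi heat semigroup is the limit of powers of resolvents.
\<close>
lemma positive_symbol_exp:
  assumes t: "t \<ge> 0"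
  shows "positive_symbol (\<lambda>\<kappa>. exp (- (t * eig \<kappa>)))"
proof (rule positive_symbol_limit)
  show "positive_symbol (\<lambda>\<kappa>. (1 / (1 + (t / real n) * eig \<kappa>)) ^ n)" for n
    using t by (intro positive_symbol_power positive_symbol_resolvent) auto
  show "(\<lambda>n. (1 / (1 + (t / real n) * eig \<kappa>)) ^ n) \<longlonglongrightarrow> exp (- (t * eig \<kappa>))" for \<kappa>
  proof -
    have "(\<lambda>n. inverse ((1 + (t * eig \<kappa>) / real n) ^ n)) \<longlonglongrightarrow> inverse (exp (t * eig \<kappa>))"
      by (intro tendsto_inverse tendsto_exp_limit_sequentially) auto
    then show ?thesis by (simp add: exp_minus power_one_over inverse_eq_divide)
  qed
qed

lemma positive_symbol_integral:
  assumes "\<And>t. t \<in> S \<Longrightarrow> positive_symbol (m t)" "\<And>t. t \<in> S \<Longrightarrow> w t \<ge> 0"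
    and int: "\<And>\<kappa>. ((\<lambda>t. w t * m t \<kappa>) has_integral l \<kappa>) S"
  shows "positive_symbol l"
  unfolding positive_symbol_def
proof (intro allI impI ballI)
  fix c x assume c: "fin_supp c" and nn: "\<forall>x\<in>cube. 0 \<le> jacobi_sum c x" and x: "x \<in> cube"
  have "((\<lambda>t. \<Sum>\<kappa> | c \<kappa> \<noteq> 0. w t * m t \<kappa> * (c \<kappa> * P \<kappa> x)) has_integral (\<Sum>\<kappa> | c \<kappa> \<noteq> 0. l \<kappa> * (c \<kappa> * P \<kappa> x))) S"
    by (intro has_integral_sum c has_integral_mult_left int)
  moreover have "(\<Sum>\<kappa> | c \<kappa> \<noteq> 0. w t * m t \<kappa> * (c \<kappa> * P \<kappa> x)) = w t * jacobi_sum (\<lambda>\<kappa>. m t \<kappa> * c \<kappa>) x" for t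
    unfolding jacobi_sum_mult[OF c] by (simp add: sum_distrib_left mult_ac)
  ultimately have "((\<lambda>t. w t * jacobi_sum (\<lambda>\<kappa>. m t \<kappa> * c \<kappa>) x) has_integral jacobi_sum (\<lambda>\<kappa>. l \<kappa> * c \<kappa>) x) S"
    unfolding jacobi_sum_mult[OF c] by (simp add: mult.assoc)
  then show "0 \<le> jacobi_sum (\<lambda>\<kappa>. l \<kappa> * c \<kappa>) x"
    by (rule has_integral_nonneg) (use positive_symbolD[OF assms(1) c] assms(2) nn x in auto)
qed

lemma P_0_constant: obtains k where "k \<noteq> 0" "\<And>x. P 0 x = k"
proof -
  have "\<exists>k. k \<noteq> 0 \<and> jacobi_poly (\<alpha> $ i) (\<beta> $ i) 0 = [:k:]" for i
  proof -
    obtain k where k: "jacobi_poly (\<alpha> $ i) (\<beta> $ i) 0 = [:k:]"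
      using degree_0_id[OF degree_jacobi_poly[OF gt_minus_one, of i i 0]] by metis
    then have "k \<noteq> 0" using jacobi_poly_nonzero[OF gt_minus_one, of i i 0] by auto
    with k show ?thesis by blast
  qed
  then obtain k where "\<And>i. k i \<noteq> 0 \<and> jacobi_poly (\<alpha> $ i) (\<beta> $ i) 0 = [:k i:]" by metis
  then show ?thesis using that[of "\<Prod>i\<in>UNIV. k i"] by (simp add: P_product)
qed

text \<open>
  The constant polynomial with value \<open>a\<close>; the basis function with index \<open>0\<close> is itself constant.
\<close>
definition const_coeff :: "real \<Rightarrow> nat^'d \<Rightarrow> real" where
  "const_coeff a \<kappa> = (if \<kappa> = 0 then a / P 0 0 else 0)"

lemma fin_supp_const: "fin_supp (const_coeff a)"
  by (rule finite_subset[of _ "{0}"]) (auto simp: const_coeff_def)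

lemma jacobi_sum_const: "jacobi_sum (const_coeff a) x = a"
proof -
  obtain k where "k \<noteq> 0" "\<And>x. P 0 x = k" using P_0_constant by blast
  then show ?thesis by (subst jacobi_sum_eq[of "{0}"]) (auto simp: const_coeff_def)
qed

lemma integral_jacobi_sum:
  assumes "fin_supp c"
  shows "(LINT x|M. jacobi_sum c x) = c 0 / P 0 0"
proof -
  obtain k where k: "k \<noteq> 0" "\<And>x. P 0 x = k" using P_0_constant by blast
  have "(LINT x|M. jacobi_sum c x * P 0 x) = c 0" using jacobi_coeff_jacobi_sum[OF assms] unfolding jacobi_coeff_def .
  then show ?thesis using k by (simp add: field_simps)
qed

lemma integrable_powr_jacobi_sum: "p > 0 \<Longrightarrow> integrable M (\<lambda>x. \<bar>jacobi_sum c x\<bar> powr p)"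
  by (rule integrable_M_continuous) (auto intro!: continuous_intros continuous_on_powr')

text \<open>
  A positive multiplier \<open>S\<close> that fixes constants satisfies Jensen's inequality \<open>|S f|^p \<le> S g\<close> for every polynomial \<open>g \<ge> |f|^p\<close>,
  as one sees by applying \<open>S\<close> to the difference of \<open>g\<close> and a supporting line of \<open>|t|^p\<close> composed with \<open>f\<close>. Moreover \<open>S\<close> preserves
  integrals, and by Weierstrass \<open>g\<close> can be chosen uniformly close to \<open>|f|^p\<close>.
\<close>
lemma positive_symbol_contraction:
  assumes p: "p > 1" and m: "positive_symbol m" "m 0 = 1" and c: "fin_supp c"
  shows "(LINT x|M. \<bar>jacobi_sum (\<lambda>\<kappa>. m \<kappa> * c \<kappa>) x\<bar> powr p) \<le> (LINT x|M. \<bar>jacobi_sum c x\<bar> powr p)"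
proof (rule field_le_epsilon)
  fix e :: real assume e: "e > 0"
  define \<eta> where "\<eta> = e / (measure M UNIV + 1)"
  define \<delta> where "\<delta> = \<eta> / 2"
  have \<delta>: "\<delta> > 0" using e by (simp add: \<delta>_def \<eta>_def add_nonneg_pos)
  have "continuous_on cube (\<lambda>x. \<bar>jacobi_sum c x\<bar> powr p + \<delta>)"
    using p by (auto intro!: continuous_intros continuous_on_powr')
  then obtain g where g: "real_polynomial_function g" "\<And>x. x \<in> cube \<Longrightarrow> \<bar>(\<bar>jacobi_sum c x\<bar> powr p + \<delta>) - g x\<bar> < \<delta>"
    by (rule Stone_Weierstrass_real_polynomial_function[OF compact_cbox _ \<delta>]) blast
  obtain d where d: "fin_supp d" "g = jacobi_sum d" using real_polynomial_function_jacobi_sum[OF g(1)] by blast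
  have dom: "\<bar>jacobi_sum (\<lambda>\<kappa>. m \<kappa> * c \<kappa>) x\<bar> powr p \<le> jacobi_sum (\<lambda>\<kappa>. m \<kappa> * d \<kappa>) x" if x: "x \<in> cube" for x
  proof -
    define y where "y = jacobi_sum (\<lambda>\<kappa>. m \<kappa> * c \<kappa>) x"
    obtain s where s: "\<And>t. \<bar>t\<bar> powr p \<ge> \<bar>y\<bar> powr p + s * (t - y)" using powr_abs_tangent[OF p] by blast
    \<comment> \<open>The coefficients of \<open>g - |y|^p - s (f - y)\<close>, a polynomial that is nonnegative on the cube.\<close>
    let ?k = "const_coeff (s * y - \<bar>y\<bar> powr p)"
    let ?u = "\<lambda>\<kappa>. 1 * (1 * d \<kappa> + (-s) * c \<kappa>) + 1 * ?k \<kappa>"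
    have u: "fin_supp ?u" by (intro fin_supp_linear d c fin_supp_const)
    have "0 \<le> jacobi_sum (\<lambda>\<kappa>. m \<kappa> * ?u \<kappa>) x"
    proof (rule positive_symbolD[OF m(1) u _ x])
      fix z assume z: "z \<in> cube"
      have "jacobi_sum ?u z = g z - s * jacobi_sum c z + (s * y - \<bar>y\<bar> powr p)"
        by (subst jacobi_sum_linear[OF fin_supp_linear[OF d(1) c] fin_supp_const], subst jacobi_sum_linear[OF d(1) c])
          (simp add: jacobi_sum_const d(2))
      moreover have "g z \<ge> \<bar>jacobi_sum c z\<bar> powr p" using g(2)[OF z] by linarith
      ultimately show "0 \<le> jacobi_sum ?u z" using s[of "jacobi_sum c z"] by (simp add: algebra_simps)
    qed
    also have "(\<lambda>\<kappa>. m \<kappa> * ?u \<kappa>) = (\<lambda>\<kappa>. 1 * (1 * (m \<kappa> * d \<kappa>) + (-s) * (m \<kappa> * c \<kappa>)) + 1 * ?k \<kappa>)"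
      using m(2) by (auto simp: fun_eq_iff const_coeff_def algebra_simps)
    also have "jacobi_sum \<dots> x = jacobi_sum (\<lambda>\<kappa>. m \<kappa> * d \<kappa>) x - s * y + (s * y - \<bar>y\<bar> powr p)"
      by (subst jacobi_sum_linear[OF fin_supp_linear[OF fin_supp_mult[OF d(1)] fin_supp_mult[OF c]] fin_supp_const],
          subst jacobi_sum_linear[OF fin_supp_mult[OF d(1)] fin_supp_mult[OF c]])
        (simp add: jacobi_sum_const y_def)
    finally show ?thesis by (simp add: y_def)
  qed
  have "(LINT x|M. \<bar>jacobi_sum (\<lambda>\<kappa>. m \<kappa> * c \<kappa>) x\<bar> powr p) \<le> (LINT x|M. jacobi_sum (\<lambda>\<kappa>. m \<kappa> * d \<kappa>) x)"
    using p AE_M_cube dom by (intro integral_mono_AE integrable_powr_jacobi_sum jacobi_sum_integrable) auto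
  also have "\<dots> = (LINT x|M. jacobi_sum d x)"
    unfolding integral_jacobi_sum[OF fin_supp_mult[OF d(1)]] integral_jacobi_sum[OF d(1)] m(2) by simp
  also have "\<dots> \<le> (LINT x|M. \<bar>jacobi_sum c x\<bar> powr p + 2 * \<delta>)"
  proof (intro integral_mono_AE jacobi_sum_integrable Bochner_Integration.integrable_add integrable_powr_jacobi_sum)
    show "AE x in M. jacobi_sum d x \<le> \<bar>jacobi_sum c x\<bar> powr p + 2 * \<delta>"
      using AE_M_cube by eventually_elim (use g(2) in \<open>fastforce simp: d(2)\<close>)
  qed (use p in auto)
  also have "\<dots> = (LINT x|M. \<bar>jacobi_sum c x\<bar> powr p) + 2 * \<delta> * measure M UNIV"
    using p by (subst Bochner_Integration.integral_add) (auto intro: integrable_powr_jacobi_sum)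
  also have "2 * \<delta> * measure M UNIV \<le> e"
  proof -
    have "measure M UNIV / (measure M UNIV + 1) \<le> 1" by (simp add: divide_le_eq add_nonneg_pos)
    then have "e * (measure M UNIV / (measure M UNIV + 1)) \<le> e * 1" using e by (intro mult_left_mono) auto
    then have "\<eta> * measure M UNIV \<le> e" by (simp add: \<eta>_def)
    then show ?thesis by (simp add: \<delta>_def)
  qed
  finally show "(LINT x|M. \<bar>jacobi_sum (\<lambda>\<kappa>. m \<kappa> * c \<kappa>) x\<bar> powr p) \<le> (LINT x|M. \<bar>jacobi_sum c x\<bar> powr p) + e" by simp
qed

text \<open>
  Boundedness is stated for the integral of the \<open>p\<close>-th power instead of the norm: constants do not matter, and
  the elementary inequality \<open>|a + b|^p \<le> 2^p (|a|^p + |b|^p)\<close> then replaces Minkowski's inequality.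
\<close>
definition Lp_multiplier :: "real \<Rightarrow> (nat^'d \<Rightarrow> real) \<Rightarrow> bool" where
  "Lp_multiplier p m \<longleftrightarrow> (\<exists>C\<ge>0. \<forall>c. fin_supp c \<longrightarrow>
     (LINT x|M. \<bar>jacobi_sum (\<lambda>\<kappa>. m \<kappa> * c \<kappa>) x\<bar> powr p) \<le> C * (LINT x|M. \<bar>jacobi_sum c x\<bar> powr p))"

lemma Lp_multiplier_scale:
  assumes "p > 0" "Lp_multiplier p m"
  shows "Lp_multiplier p (\<lambda>\<kappa>. a * m \<kappa>)"
proof -
  obtain C where C: "C \<ge> 0" "\<And>c. fin_supp c \<Longrightarrow> (LINT x|M. \<bar>jacobi_sum (\<lambda>\<kappa>. m \<kappa> * c \<kappa>) x\<bar> powr p) \<le> C * (LINT x|M. \<bar>jacobi_sum c x\<bar> powr p)"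
    using assms(2) unfolding Lp_multiplier_def by blast
  have "(LINT x|M. \<bar>jacobi_sum (\<lambda>\<kappa>. a * m \<kappa> * c \<kappa>) x\<bar> powr p) \<le> (\<bar>a\<bar> powr p * C) * (LINT x|M. \<bar>jacobi_sum c x\<bar> powr p)" if c: "fin_supp c" for c
  proof -
    have "jacobi_sum (\<lambda>\<kappa>. a * m \<kappa> * c \<kappa>) x = a * jacobi_sum (\<lambda>\<kappa>. m \<kappa> * c \<kappa>) x" for x
      unfolding jacobi_sum_mult[OF c] by (simp add: sum_distrib_left mult_ac)
    then have "(LINT x|M. \<bar>jacobi_sum (\<lambda>\<kappa>. a * m \<kappa> * c \<kappa>) x\<bar> powr p) = \<bar>a\<bar> powr p * (LINT x|M. \<bar>jacobi_sum (\<lambda>\<kappa>. m \<kappa> * c \<kappa>) x\<bar> powr p)"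
      by (simp add: abs_mult powr_mult)
    also have "\<dots> \<le> \<bar>a\<bar> powr p * (C * (LINT x|M. \<bar>jacobi_sum c x\<bar> powr p))" by (intro mult_left_mono C(2) c) auto
    finally show ?thesis by (simp add: mult.assoc)
  qed
  then show ?thesis unfolding Lp_multiplier_def using C(1) by (intro exI[of _ "\<bar>a\<bar> powr p * C"]) auto
qed

lemma Lp_multiplier_add:
  assumes p: "p > 0" and "Lp_multiplier p m" "Lp_multiplier p n"
  shows "Lp_multiplier p (\<lambda>\<kappa>. m \<kappa> + n \<kappa>)"
proof -
  obtain C where C: "C \<ge> 0" "\<And>c. fin_supp c \<Longrightarrow> (LINT x|M. \<bar>jacobi_sum (\<lambda>\<kappa>. m \<kappa> * c \<kappa>) x\<bar> powr p) \<le> C * (LINT x|M. \<bar>jacobi_sum c x\<bar> powr p)"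
    using assms(2) unfolding Lp_multiplier_def by blast
  obtain D where D: "D \<ge> 0" "\<And>c. fin_supp c \<Longrightarrow> (LINT x|M. \<bar>jacobi_sum (\<lambda>\<kappa>. n \<kappa> * c \<kappa>) x\<bar> powr p) \<le> D * (LINT x|M. \<bar>jacobi_sum c x\<bar> powr p)"
    using assms(3) unfolding Lp_multiplier_def by blast
  have "(LINT x|M. \<bar>jacobi_sum (\<lambda>\<kappa>. (m \<kappa> + n \<kappa>) * c \<kappa>) x\<bar> powr p) \<le> (2 powr p * (C + D)) * (LINT x|M. \<bar>jacobi_sum c x\<bar> powr p)" if c: "fin_supp c" for c
  proof -
    let ?f = "jacobi_sum (\<lambda>\<kappa>. m \<kappa> * c \<kappa>)" and ?g = "jacobi_sum (\<lambda>\<kappa>. n \<kappa> * c \<kappa>)"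
    have "jacobi_sum (\<lambda>\<kappa>. (m \<kappa> + n \<kappa>) * c \<kappa>) x = ?f x + ?g x" for x
      unfolding jacobi_sum_mult[OF c] by (simp add: sum.distrib algebra_simps)
    then have "(LINT x|M. \<bar>jacobi_sum (\<lambda>\<kappa>. (m \<kappa> + n \<kappa>) * c \<kappa>) x\<bar> powr p) \<le> (LINT x|M. 2 powr p * (\<bar>?f x\<bar> powr p + \<bar>?g x\<bar> powr p))"
      using p by (intro integral_mono integrable_powr_jacobi_sum integrable_mult_right Bochner_Integration.integrable_add) (auto intro: powr_abs_add_le)
    also have "\<dots> = 2 powr p * ((LINT x|M. \<bar>?f x\<bar> powr p) + (LINT x|M. \<bar>?g x\<bar> powr p))"
      using p by (simp add: integrable_powr_jacobi_sum)
    also have "\<dots> \<le> 2 powr p * (C * (LINT x|M. \<bar>jacobi_sum c x\<bar> powr p) + D * (LINT x|M. \<bar>jacobi_sum c x\<bar> powr p))"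
      by (intro mult_left_mono add_mono C(2) D(2) c) auto
    finally show ?thesis by (simp add: algebra_simps)
  qed
  then show ?thesis unfolding Lp_multiplier_def using C(1) D(1) by (intro exI[of _ "2 powr p * (C + D)"]) auto
qed

lemma Lp_multiplier_positive:
  assumes p: "p > 1" and m: "positive_symbol m" "m 0 > 0"
  shows "Lp_multiplier p m"
proof -
  let ?n = "\<lambda>\<kappa>. 1 / m 0 * m \<kappa>"
  have "positive_symbol ?n" unfolding positive_symbol_def
  proof (intro allI impI ballI)
    fix c x assume c: "fin_supp c" and nn: "\<forall>x\<in>cube. 0 \<le> jacobi_sum c x" and x: "x \<in> cube"
    have "jacobi_sum (\<lambda>\<kappa>. ?n \<kappa> * c \<kappa>) x = 1 / m 0 * jacobi_sum (\<lambda>\<kappa>. m \<kappa> * c \<kappa>) x"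
      unfolding jacobi_sum_mult[OF c] by (simp add: sum_distrib_left mult_ac)
    then show "0 \<le> jacobi_sum (\<lambda>\<kappa>. ?n \<kappa> * c \<kappa>) x" using positive_symbolD[OF m(1) c] nn x m(2) by simp
  qed
  moreover have "?n 0 = 1" using m(2) by simp
  ultimately have "Lp_multiplier p ?n" unfolding Lp_multiplier_def
    using positive_symbol_contraction[OF p, of ?n] by (intro exI[of _ 1]) simp
  then have "Lp_multiplier p (\<lambda>\<kappa>. m 0 * ?n \<kappa>)" using p Lp_multiplier_scale[of p ?n "m 0"] by simp
  then show ?thesis using m(2) by simp
qed

lemma Lp_multiplier_sum:
  assumes p: "p > 0" and "finite I" "\<And>i. i \<in> I \<Longrightarrow> Lp_multiplier p (m i)"
  shows "Lp_multiplier p (\<lambda>\<kappa>. \<Sum>i\<in>I. m i \<kappa>)"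
  using assms(2,3)
proof (induction I rule: finite_induct)
  case empty
  show ?case unfolding Lp_multiplier_def by (rule exI[of _ 1]) (use p in \<open>simp add: jacobi_sum_def\<close>)
next
  case (insert i I)
  then show ?case by (simp add: Lp_multiplier_add[OF p])
qed

end

section \<open>Multipliers with rapidly decaying symbol\<close>

lemma summable_inverse_one_plus_square: "summable (\<lambda>k. 1 / (1 + (real k)\<^sup>2))"
proof (rule summable_comparison_test')
  show "summable (\<lambda>k. inverse ((real k)\<^sup>2))" by (rule inverse_power_summable) simp
  show "norm (1 / (1 + (real k)\<^sup>2)) \<le> inverse ((real k)\<^sup>2)" if "k \<ge> 1" for k
    using that by (simp add: inverse_eq_divide frac_le add_pos_nonneg)
qed

context jacobi_parameters
begin

text \<open>
  The sup norms grow at most polynomially in the one-dimensional eigenvalues, each of which is at most the full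
  eigenvalue; so a high power of the full eigenvalue leaves a product of convergent one-dimensional series.
\<close>
lemma P_bound_decay:
  obtains B N K where "N > 0" "\<And>\<kappa> x. x \<in> cube \<Longrightarrow> \<bar>P \<kappa> x\<bar> \<le> B \<kappa>"
    "\<And>F. finite F \<Longrightarrow> (\<Sum>\<kappa>\<in>F. (1 + eig \<kappa>) powr (- N) * (B \<kappa>)\<^sup>2) \<le> K"
proof -
  define L where "L i k = 1 + real k * (real k + \<alpha> $ i + \<beta> $ i + 1)" for i k
  have L: "L i k \<ge> 1 + (real k)\<^sup>2" for i k using eig_term_ge[of k i] by (simp add: L_def)
  have L1: "L i k \<ge> 1" for i k by (rule order_trans[OF _ L]) simp
  have "\<exists>C>0. \<forall>n. \<forall>x\<in>{-1..1}. (poly (jacobi_poly (\<alpha> $ i) (\<beta> $ i) n) x)\<^sup>2 \<le> C * L i n powr (\<bar>\<alpha> $ i\<bar> + \<bar>\<beta> $ i\<bar> + 1)" for i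
    unfolding L_def using jacobi_poly_sup_bound[OF \<alpha>_gt \<beta>_gt, of i i] by metis
  then obtain C where C: "\<And>i. C i > 0"
    "\<And>i n x. x \<in> {-1..1} \<Longrightarrow> (poly (jacobi_poly (\<alpha> $ i) (\<beta> $ i) n) x)\<^sup>2 \<le> C i * L i n powr (\<bar>\<alpha> $ i\<bar> + \<bar>\<beta> $ i\<bar> + 1)"
    by metis
  define A where "A = (\<Sum>i\<in>UNIV. \<bar>\<alpha> $ i\<bar> + \<bar>\<beta> $ i\<bar> + 1)"
  have A: "\<bar>\<alpha> $ i\<bar> + \<bar>\<beta> $ i\<bar> + 1 \<le> A" for i
    unfolding A_def by (rule member_le_sum[where f = "\<lambda>i. \<bar>\<alpha> $ i\<bar> + \<bar>\<beta> $ i\<bar> + 1"]) auto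
  have A0: "A > 0" using A[of undefined] by linarith
  \<comment> \<open>Each coordinate receives \<open>A + 1\<close> powers of the full eigenvalue: \<open>A\<close> to compensate the growth of its factor and
    one for summability.\<close>
  define N where "N = (A + 1) * real CARD('d)"
  define B where "B \<kappa> = sqrt (\<Prod>i\<in>UNIV. C i * L i (\<kappa> $ i) powr A)" for \<kappa> :: "nat^'d"
  have pos: "C i * L i k powr a > 0" for i k a using C(1) L1[of i k] by simp
  have B2: "(B \<kappa>)\<^sup>2 = (\<Prod>i\<in>UNIV. C i * L i (\<kappa> $ i) powr A)" for \<kappa>
    unfolding B_def using pos by (intro real_sqrt_pow2 prod_nonneg) (auto intro: less_imp_le)
  define S where "S = (\<Sum>k. 1 / (1 + (real k)\<^sup>2))"
  define K where "K = (\<Prod>i\<in>UNIV. C i * S)"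
  show ?thesis
  proof (rule that[of N B K])
    show "N > 0" using A0 unfolding N_def by (intro mult_pos_pos) auto
    show "\<bar>P \<kappa> x\<bar> \<le> B \<kappa>" if x: "x \<in> cube" for \<kappa> x
    proof -
      have "(P \<kappa> x)\<^sup>2 = (\<Prod>i\<in>UNIV. (poly (jacobi_poly (\<alpha> $ i) (\<beta> $ i) (\<kappa> $ i)) (x $ i))\<^sup>2)"
        by (simp add: P_product prod_power_distrib)
      also have "\<dots> \<le> (\<Prod>i\<in>UNIV. C i * L i (\<kappa> $ i) powr A)"
      proof (rule prod_mono)
        fix i
        have "(poly (jacobi_poly (\<alpha> $ i) (\<beta> $ i) (\<kappa> $ i)) (x $ i))\<^sup>2 \<le> C i * L i (\<kappa> $ i) powr (\<bar>\<alpha> $ i\<bar> + \<bar>\<beta> $ i\<bar> + 1)"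
          using x by (intro C(2)) (auto simp: mem_cube)
        also have "\<dots> \<le> C i * L i (\<kappa> $ i) powr A"
          using C(1)[of i] L1[of i "\<kappa> $ i"] A[of i] by (intro mult_left_mono powr_mono) auto
        finally show "0 \<le> (poly (jacobi_poly (\<alpha> $ i) (\<beta> $ i) (\<kappa> $ i)) (x $ i))\<^sup>2 \<and>
            (poly (jacobi_poly (\<alpha> $ i) (\<beta> $ i) (\<kappa> $ i)) (x $ i))\<^sup>2 \<le> C i * L i (\<kappa> $ i) powr A" by simp
      qed
      finally show ?thesis unfolding B_def by (rule real_le_rsqrt[of "\<bar>P \<kappa> x\<bar>", simplified])
    qed
    fix F :: "(nat^'d) set" assume F: "finite F"
    have le: "(1 + eig \<kappa>) powr (- N) * (B \<kappa>)\<^sup>2 \<le> (\<Prod>i\<in>UNIV. C i * (1 / (1 + (real (\<kappa> $ i))\<^sup>2)))" for \<kappa>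
    proof -
      have Li: "L i (\<kappa> $ i) \<le> 1 + eig \<kappa>" for i
        unfolding L_def jacobi_lambda_def
        by (intro add_left_mono member_le_sum[where f = "\<lambda>i. real (\<kappa> $ i) * (real (\<kappa> $ i) + \<alpha> $ i + \<beta> $ i + 1)"])
          (auto intro: order_trans[OF _ eig_term_ge])
      have "(1 + eig \<kappa>) powr (- N) = (\<Prod>i\<in>(UNIV::'d set). (1 + eig \<kappa>) powr (- (A + 1)))"
      proof -
        have "(1 + eig \<kappa>) powr (- N) = ((1 + eig \<kappa>) powr (- (A + 1))) powr real CARD('d)"
          unfolding powr_powr N_def by (simp only: minus_mult_left)
        also have "\<dots> = ((1 + eig \<kappa>) powr (- (A + 1))) ^ CARD('d)"
          using eig_nonneg[of \<kappa>] by (intro powr_realpow) (auto simp: add_pos_nonneg)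
        finally show ?thesis by simp
      qed
      then have "(1 + eig \<kappa>) powr (- N) * (B \<kappa>)\<^sup>2
          = (\<Prod>i\<in>UNIV. (1 + eig \<kappa>) powr (- (A + 1)) * (C i * L i (\<kappa> $ i) powr A))"
        unfolding B2 by (simp only: prod.distrib)
      also have "\<dots> \<le> (\<Prod>i\<in>UNIV. C i * (1 / (1 + (real (\<kappa> $ i))\<^sup>2)))"
      proof (rule prod_mono, rule conjI)
        fix i
        let ?l = "L i (\<kappa> $ i)"
        show "0 \<le> (1 + eig \<kappa>) powr (- (A + 1)) * (C i * ?l powr A)"
          by (intro mult_nonneg_nonneg[OF _ less_imp_le[OF pos]]) auto
        have "(1 + eig \<kappa>) powr (- (A + 1)) \<le> ?l powr (- (A + 1))"
          using Li[of i] L1[of i "\<kappa> $ i"] A0 by (intro powr_mono2') auto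
        then have "(1 + eig \<kappa>) powr (- (A + 1)) * (C i * ?l powr A) \<le> ?l powr (- (A + 1)) * (C i * ?l powr A)"
          using pos[of i "\<kappa> $ i" A] by (intro mult_right_mono) auto
        also have "\<dots> = C i * (?l powr (- (A + 1)) * ?l powr A)" by simp
        also have "?l powr (- (A + 1)) * ?l powr A = ?l powr (-1)" by (simp flip: powr_add)
        also have "\<dots> = 1 / ?l" using L1[of i "\<kappa> $ i"] by (simp add: powr_minus_divide)
        also have "C i * (1 / ?l) \<le> C i * (1 / (1 + (real (\<kappa> $ i))\<^sup>2))"
          using C(1)[of i] L[of "\<kappa> $ i" i] by (intro mult_left_mono divide_left_mono) (auto intro!: mult_pos_pos add_pos_nonneg less_le_trans[OF _ L1])
        finally show "(1 + eig \<kappa>) powr (- (A + 1)) * (C i * ?l powr A) \<le> C i * (1 / (1 + (real (\<kappa> $ i))\<^sup>2))" .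
      qed
      finally show ?thesis .
    qed
    define n where "n = Max (insert 0 ((\<lambda>(\<kappa>,i). \<kappa> $ i) ` (F \<times> UNIV)))"
    have sub: "F \<subseteq> {\<kappa>. \<forall>i. \<kappa> $ i \<le> n}"
    proof (intro subsetI CollectI allI)
      fix \<kappa> i assume "\<kappa> \<in> F"
      then show "\<kappa> $ i \<le> n" unfolding n_def using F by (intro Max_ge) (auto intro!: image_eqI[of _ _ "(\<kappa>, i)"])
    qed
    have "(\<Sum>\<kappa>\<in>F. (1 + eig \<kappa>) powr (- N) * (B \<kappa>)\<^sup>2) \<le> (\<Sum>\<kappa>\<in>F. \<Prod>i\<in>UNIV. C i * (1 / (1 + (real (\<kappa> $ i))\<^sup>2)))"
      by (intro sum_mono le)
    also have "\<dots> \<le> (\<Sum>\<kappa>\<in>{\<kappa>. \<forall>i. \<kappa> $ i \<le> n}. \<Prod>i\<in>UNIV. C i * (1 / (1 + (real (\<kappa> $ i))\<^sup>2)))"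
      by (intro sum_mono2 sum_box_prod(1) sub prod_nonneg mult_nonneg_nonneg less_imp_le[OF C(1)]) auto
    also have "\<dots> = (\<Prod>i\<in>UNIV. \<Sum>k\<le>n. C i * (1 / (1 + (real k)\<^sup>2)))"
      by (rule sum_box_prod(2))
    also have "\<dots> \<le> K" unfolding K_def
    proof (rule prod_mono, rule conjI)
      fix i
      show "0 \<le> (\<Sum>k\<le>n. C i * (1 / (1 + (real k)\<^sup>2)))"
        using C(1)[of i] by (intro sum_nonneg mult_nonneg_nonneg) auto
      have "(\<Sum>k\<le>n. 1 / (1 + (real k)\<^sup>2)) \<le> S" unfolding S_def
        by (intro sum_le_suminf summable_inverse_one_plus_square) auto
      then show "(\<Sum>k\<le>n. C i * (1 / (1 + (real k)\<^sup>2))) \<le> C i * S"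
        unfolding sum_distrib_left[symmetric] using C(1)[of i] by (intro mult_left_mono) auto
    qed
    finally show "(\<Sum>\<kappa>\<in>F. (1 + eig \<kappa>) powr (- N) * (B \<kappa>)\<^sup>2) \<le> K" .
  qed
qed

lemma measure_M_pos: "measure M UNIV > 0"
proof -
  obtain k where k: "k \<noteq> 0" "\<And>x. P 0 x = k" using P_0_constant by blast
  have "(LINT x|M. P 0 x * P 0 x) = 1" using P_orthonormal(2)[of 0 0] by simp
  then have "k * k * measure M UNIV = 1" using k(2) by (simp add: mult.commute)
  then show ?thesis using measure_nonneg[of M UNIV] by (metis less_eq_real_def mult_zero_right zero_neq_one)
qed

text \<open>
  Jensen's inequality for the finite measure, by integrating the supporting line at the mean value.
\<close>
lemma integral_abs_powr_le:
  assumes p: "p > 1" 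
  shows "(LINT x|M. \<bar>jacobi_sum c x\<bar>) powr p \<le> measure M UNIV powr p / measure M UNIV * (LINT x|M. \<bar>jacobi_sum c x\<bar> powr p)"
proof -
  define \<mu> where "\<mu> = measure M UNIV"
  have \<mu>: "\<mu> > 0" using measure_M_pos by (simp add: \<mu>_def)
  define I where "I = (LINT x|M. \<bar>jacobi_sum c x\<bar>)"
  have I: "I \<ge> 0" unfolding I_def by simp
  obtain s where s: "\<And>t. \<bar>t\<bar> powr p \<ge> \<bar>I / \<mu>\<bar> powr p + s * (t - I / \<mu>)" using powr_abs_tangent[OF p] by blast
  have int: "integrable M (\<lambda>x. \<bar>jacobi_sum c x\<bar>)" using jacobi_sum_integrable by (rule integrable_abs)
  have "(LINT x|M. (I / \<mu>) powr p + s * (\<bar>jacobi_sum c x\<bar> - I / \<mu>)) \<le> (LINT x|M. \<bar>jacobi_sum c x\<bar> powr p)"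
    using p int s[of "\<bar>jacobi_sum c _\<bar>"] I \<mu>
    by (intro integral_mono integrable_powr_jacobi_sum Bochner_Integration.integrable_add integrable_mult_right
        Bochner_Integration.integrable_diff) auto
  also have "(LINT x|M. (I / \<mu>) powr p + s * (\<bar>jacobi_sum c x\<bar> - I / \<mu>)) = (I / \<mu>) powr p * \<mu> + s * (I - I / \<mu> * \<mu>)"
    using int by (simp add: I_def \<mu>_def)
  also have "\<dots> = I powr p / \<mu> powr p * \<mu>" using I \<mu> by (simp add: powr_divide)
  finally show ?thesis using \<mu> unfolding I_def[symmetric] \<mu>_def[symmetric] by (simp add: field_simps)
qed

text \<open>
  For such a symbol the integral kernel \<open>\<Sum> m(\<kappa>) P \<kappa> x P \<kappa> y\<close> converges absolutely and is bounded. The exponent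
  is independent of the symbol.
\<close>
lemma Lp_multiplier_decay:
  assumes p: "p > 1"
  obtains N where "N > 0" "\<And>m C. (\<And>\<kappa>. \<bar>m \<kappa>\<bar> \<le> C * (1 + eig \<kappa>) powr (- N)) \<Longrightarrow> Lp_multiplier p m"
proof -
  obtain B N K where N: "N > 0" and B: "\<And>\<kappa> x. x \<in> cube \<Longrightarrow> \<bar>P \<kappa> x\<bar> \<le> B \<kappa>"
    and K: "\<And>F. finite F \<Longrightarrow> (\<Sum>\<kappa>\<in>F. (1 + eig \<kappa>) powr (- N) * (B \<kappa>)\<^sup>2) \<le> K"
    by (rule P_bound_decay) blast
  have B0: "B \<kappa> \<ge> 0" for \<kappa>
    using cube_nonempty B[of _ \<kappa>] by (meson abs_ge_zero equals0I order_trans)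
  have "Lp_multiplier p m" if m: "\<And>\<kappa>. \<bar>m \<kappa>\<bar> \<le> C * (1 + eig \<kappa>) powr (- N)" for m C
  proof -
    define \<mu> where "\<mu> = measure M UNIV"
    have "\<bar>m 0\<bar> \<le> C" using m[of 0] by (simp add: eig_0)
    then have C0: "C \<ge> 0" by linarith
    have K0: "K \<ge> 0" using K[of "{}"] by simp
    have "(LINT x|M. \<bar>jacobi_sum (\<lambda>\<kappa>. m \<kappa> * c \<kappa>) x\<bar> powr p) \<le> (\<mu> * (C * K) powr p * (\<mu> powr p / \<mu>)) * (LINT x|M. \<bar>jacobi_sum c x\<bar> powr p)"
      if c: "fin_supp c" for c
    proof -
      define I where "I = (LINT x|M. \<bar>jacobi_sum c x\<bar>)"
      have I: "I \<ge> 0" unfolding I_def by simp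
      have int: "integrable M (\<lambda>x. \<bar>jacobi_sum c x\<bar>)" using jacobi_sum_integrable by (rule integrable_abs)
      have cb: "\<bar>c \<kappa>\<bar> \<le> B \<kappa> * I" for \<kappa>
      proof -
        have "\<bar>c \<kappa>\<bar> = \<bar>LINT x|M. jacobi_sum c x * P \<kappa> x\<bar>" using jacobi_coeff_jacobi_sum[OF c] unfolding jacobi_coeff_def by simp
        also have "\<dots> \<le> (LINT x|M. \<bar>jacobi_sum c x * P \<kappa> x\<bar>)" by (rule integral_abs_bound)
        also have "\<dots> \<le> (LINT x|M. B \<kappa> * \<bar>jacobi_sum c x\<bar>)"
        proof (rule integral_mono_AE)
          show "integrable M (\<lambda>x. \<bar>jacobi_sum c x * P \<kappa> x\<bar>)"
            by (rule integrable_M_continuous) (auto intro!: continuous_intros)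
          show "AE x in M. \<bar>jacobi_sum c x * P \<kappa> x\<bar> \<le> B \<kappa> * \<bar>jacobi_sum c x\<bar>"
            using AE_M_cube by eventually_elim (auto simp: abs_mult mult.commute[of "B \<kappa>"] intro!: mult_left_mono B)
        qed (use int in auto)
        also have "\<dots> = B \<kappa> * I" by (simp add: I_def)
        finally show ?thesis .
      qed
      have sup: "\<bar>jacobi_sum (\<lambda>\<kappa>. m \<kappa> * c \<kappa>) x\<bar> \<le> C * K * I" if x: "x \<in> cube" for x
      proof -
        have "\<bar>jacobi_sum (\<lambda>\<kappa>. m \<kappa> * c \<kappa>) x\<bar> \<le> (\<Sum>\<kappa> | c \<kappa> \<noteq> 0. \<bar>m \<kappa> * c \<kappa> * P \<kappa> x\<bar>)"
          unfolding jacobi_sum_mult[OF c] by (rule sum_abs)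
        also have "\<dots> \<le> (\<Sum>\<kappa> | c \<kappa> \<noteq> 0. C * I * ((1 + eig \<kappa>) powr (- N) * (B \<kappa>)\<^sup>2))"
        proof (rule sum_mono)
          fix \<kappa>
          have "\<bar>m \<kappa> * c \<kappa> * P \<kappa> x\<bar> \<le> (C * (1 + eig \<kappa>) powr (- N)) * (B \<kappa> * I) * B \<kappa>"
            unfolding abs_mult using m cb B[OF x] B0 C0 I
            by (intro mult_mono) auto
          then show "\<bar>m \<kappa> * c \<kappa> * P \<kappa> x\<bar> \<le> C * I * ((1 + eig \<kappa>) powr (- N) * (B \<kappa>)\<^sup>2)"
            by (simp add: power2_eq_square mult_ac)
        qed
        also have "\<dots> = C * I * (\<Sum>\<kappa> | c \<kappa> \<noteq> 0. (1 + eig \<kappa>) powr (- N) * (B \<kappa>)\<^sup>2)" by (simp add: sum_distrib_left)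
        also have "\<dots> \<le> C * I * K" using C0 I by (intro mult_left_mono K c) auto
        finally show ?thesis by (simp add: mult_ac)
      qed
      have "(LINT x|M. \<bar>jacobi_sum (\<lambda>\<kappa>. m \<kappa> * c \<kappa>) x\<bar> powr p) \<le> (LINT x|M. (C * K * I) powr p)"
      proof (rule integral_mono_AE)
        show "AE x in M. \<bar>jacobi_sum (\<lambda>\<kappa>. m \<kappa> * c \<kappa>) x\<bar> powr p \<le> (C * K * I) powr p"
          using AE_M_cube by eventually_elim (use p sup in \<open>auto intro!: powr_mono2\<close>)
      qed (use p in \<open>auto intro: integrable_powr_jacobi_sum\<close>)
      also have "\<dots> = \<mu> * (C * K) powr p * I powr p" using I C0 K0 by (simp add: \<mu>_def powr_mult)
      also have "\<dots> \<le> \<mu> * (C * K) powr p * (\<mu> powr p / \<mu> * (LINT x|M. \<bar>jacobi_sum c x\<bar> powr p))"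
        unfolding I_def \<mu>_def by (intro mult_left_mono integral_abs_powr_le p) auto
      finally show ?thesis by (simp only: mult.assoc)
    qed
    then show ?thesis unfolding Lp_multiplier_def
      by (intro exI[of _ "\<mu> * (C * K) powr p * (\<mu> powr p / \<mu>)"]) (auto simp: \<mu>_def)
  qed
  then show ?thesis using that N by blast
qed

end

section \<open>Extending bounded operators from a dense subspace\<close>

abbreviation Lp_mass :: "real \<Rightarrow> 'a measure \<Rightarrow> ('a \<Rightarrow> real) \<Rightarrow> real" where
  "Lp_mass p M f \<equiv> LINT x|M. \<bar>f x\<bar> powr p"

lemma Lp_spaceD:
  "f \<in> Lp_space p M \<Longrightarrow> f \<in> borel_measurable M" "f \<in> Lp_space p M \<Longrightarrow> integrable M (\<lambda>x. \<bar>f x\<bar> powr p)"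
  by (auto simp: Lp_space_def)

lemma Lp_mass_nonneg [simp]: "Lp_mass p M f \<ge> 0"
  by simp

lemma Lp_mass_scale: "Lp_mass p M (\<lambda>x. a * f x) = \<bar>a\<bar> powr p * Lp_mass p M f"
  by (simp add: abs_mult powr_mult)

lemma Lp_space_scale: "f \<in> Lp_space p M \<Longrightarrow> (\<lambda>x. a * f x) \<in> Lp_space p M"
  by (auto simp: Lp_space_def abs_mult powr_mult)

lemma
  assumes p: "p > 0" and f: "f \<in> Lp_space p M" and g: "g \<in> Lp_space p M"
  shows Lp_space_add: "(\<lambda>x. f x + g x) \<in> Lp_space p M"
    and Lp_mass_add: "Lp_mass p M (\<lambda>x. f x + g x) \<le> 2 powr p * (Lp_mass p M f + Lp_mass p M g)"
proof -
  note [measurable] = Lp_spaceD(1)[OF f] Lp_spaceD(1)[OF g]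
  have int: "integrable M (\<lambda>x. 2 powr p * (\<bar>f x\<bar> powr p + \<bar>g x\<bar> powr p))"
    by (intro integrable_mult_right Bochner_Integration.integrable_add Lp_spaceD f g)
  have i: "integrable M (\<lambda>x. \<bar>f x + g x\<bar> powr p)"
    by (rule Bochner_Integration.integrable_bound[OF int]) (use powr_abs_add_le[OF p] in \<open>auto intro!: order_trans[OF powr_abs_add_le[OF p]]\<close>)
  then show "(\<lambda>x. f x + g x) \<in> Lp_space p M" by (simp add: Lp_space_def)
  have "Lp_mass p M (\<lambda>x. f x + g x) \<le> (LINT x|M. 2 powr p * (\<bar>f x\<bar> powr p + \<bar>g x\<bar> powr p))"
    by (rule integral_mono[OF i int powr_abs_add_le[OF p]])
  also have "\<dots> = 2 powr p * (Lp_mass p M f + Lp_mass p M g)"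
    using Lp_spaceD(2)[OF f] Lp_spaceD(2)[OF g] by simp
  finally show "Lp_mass p M (\<lambda>x. f x + g x) \<le> 2 powr p * (Lp_mass p M f + Lp_mass p M g)" .
qed

lemma Lp_space_linear:
  "p > 0 \<Longrightarrow> f \<in> Lp_space p M \<Longrightarrow> g \<in> Lp_space p M \<Longrightarrow> (\<lambda>x. a * f x + b * g x) \<in> Lp_space p M"
  by (intro Lp_space_add Lp_space_scale)

lemma Lp_mass_linear:
  "p > 0 \<Longrightarrow> f \<in> Lp_space p M \<Longrightarrow> g \<in> Lp_space p M \<Longrightarrow>
    Lp_mass p M (\<lambda>x. a * f x + b * g x) \<le> 2 powr p * (\<bar>a\<bar> powr p * Lp_mass p M f + \<bar>b\<bar> powr p * Lp_mass p M g)"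
  using Lp_mass_add[OF _ Lp_space_scale[of f p M a] Lp_space_scale[of g p M b]] by (simp add: Lp_mass_scale)

lemma Lp_space_diff:
  "p > 0 \<Longrightarrow> f \<in> Lp_space p M \<Longrightarrow> g \<in> Lp_space p M \<Longrightarrow> (\<lambda>x. f x - g x) \<in> Lp_space p M"
  using Lp_space_linear[of p f M g 1 "-1"] by simp

lemma Lp_mass_triangle:
  assumes "p > 0" "f \<in> Lp_space p M" "g \<in> Lp_space p M" "h \<in> Lp_space p M"
  shows "Lp_mass p M (\<lambda>x. f x - h x) \<le> 2 powr p * (Lp_mass p M (\<lambda>x. f x - g x) + Lp_mass p M (\<lambda>x. g x - h x))"
  using Lp_mass_add[OF assms(1) Lp_space_diff[OF assms(1,2,3)] Lp_space_diff[OF assms(1,3,4)]] by simp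

lemma Lp_mass_minus_commute: "Lp_mass p M (\<lambda>x. f x - g x) = Lp_mass p M (\<lambda>x. g x - f x)"
  by (simp add: abs_minus_commute)

text \<open>
  The Riesz-Fischer argument: the increments, weighted by \<open>2^(pn)\<close>, have a finite total integral, so that almost everywhere
  they are eventually below \<open>2^(-n)\<close> and the sequence converges; Fatou's lemma transfers the estimates to the limit.
\<close>
lemma Lp_rapidly_Cauchy_limit:
  fixes u :: "nat \<Rightarrow> 'a \<Rightarrow> real"
  assumes p: "p > 0" and u: "\<And>n. u n \<in> Lp_space p M"
    and cauchy: "\<And>n m. n \<le> m \<Longrightarrow> Lp_mass p M (\<lambda>x. u m x - u n x) \<le> K * (1 / 4 powr p) ^ n"
  shows "\<exists>g\<in>Lp_space p M. \<forall>n. Lp_mass p M (\<lambda>x. g x - u n x) \<le> K * (1 / 4 powr p) ^ n"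
proof -
  note [measurable] = Lp_spaceD(1)[OF u]
  define r where "r = 1 / 4 powr p"
  have r: "r > 0" by (simp add: r_def)
  define d where "d n x = u (Suc n) x - u n x" for n x
  define t where "t n x = (2 powr p) ^ n * \<bar>d n x\<bar> powr p" for n x
  have dm [measurable]: "d n \<in> borel_measurable M" for n unfolding d_def by measurable
  have tm [measurable]: "t n \<in> borel_measurable M" for n unfolding t_def by measurable
  have dL: "d n \<in> Lp_space p M" for n unfolding d_def by (intro Lp_space_diff p u)
  have K0: "K \<ge> 0" using cauchy[of 0 0] by simp
  have r2: "2 powr p * r = 1 / 2 powr p"
  proof -
    have "(4::real) powr p = 2 powr p * 2 powr p" by (simp flip: powr_mult)
    then show ?thesis by (simp add: r_def)
  qed
  have tint: "(LINT x|M. t n x) \<le> K * (1 / 2 powr p) ^ n" for n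
  proof -
    have "(LINT x|M. t n x) = (2 powr p) ^ n * Lp_mass p M (d n)" unfolding t_def by simp
    also have "\<dots> \<le> (2 powr p) ^ n * (K * r ^ n)" unfolding d_def r_def by (intro mult_left_mono cauchy) auto
    also have "\<dots> = K * (2 powr p * r) ^ n" by (simp add: power_mult_distrib)
    finally show ?thesis unfolding r2 .
  qed
  have "(\<integral>\<^sup>+x. (\<Sum>n. ennreal (t n x)) \<partial>M) = (\<Sum>n. \<integral>\<^sup>+x. ennreal (t n x) \<partial>M)"
    by (rule nn_integral_suminf) simp
  also have "\<dots> \<le> (\<Sum>n. ennreal (K * (1 / 2 powr p) ^ n))"
  proof (rule suminf_le)
    fix n
    have "(\<integral>\<^sup>+x. ennreal (t n x) \<partial>M) = ennreal (LINT x|M. t n x)"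
      using Lp_spaceD(2)[OF dL[of n]] unfolding t_def by (intro nn_integral_eq_integral) auto
    then show "(\<integral>\<^sup>+x. ennreal (t n x) \<partial>M) \<le> ennreal (K * (1 / 2 powr p) ^ n)"
      using tint[of n] by (simp add: ennreal_leI)
  qed auto
  also have "\<dots> < \<infinity>"
  proof -
    have "summable (\<lambda>n. K * (1 / 2 powr p) ^ n)"
      using p by (intro summable_mult summable_geometric) (auto simp: gr_one_powr)
    then show ?thesis using K0 by (simp add: suminf_ennreal2)
  qed
  finally have "AE x in M. (\<Sum>n. ennreal (t n x)) \<noteq> \<infinity>"
    by (intro nn_integral_noteq_infinite) auto
  then have conv: "AE x in M. convergent (\<lambda>n. u n x)"
  proof eventually_elim
    case (elim x)
    have "summable (\<lambda>n. t n x)"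
      using elim by (intro summable_suminf_not_top) (auto simp: t_def)
    then have "(\<lambda>n. t n x) \<longlonglongrightarrow> 0" by (rule summable_LIMSEQ_zero)
    then have "eventually (\<lambda>n. t n x < 1) sequentially" by (rule order_tendstoD) simp
    then have "eventually (\<lambda>n. norm (d n x) \<le> (1 / 2) ^ n) sequentially"
    proof eventually_elim
      case (elim n)
      have "(2 ^ n * \<bar>d n x\<bar>) powr p = t n x"
        by (simp add: t_def powr_mult powr_power powr_powr flip: powr_realpow) (simp add: mult.commute)
      then have "(2 ^ n * \<bar>d n x\<bar>) powr p < 1 powr p" using elim by simp
      then have "2 ^ n * \<bar>d n x\<bar> < 1"
        using powr_mono2[of p 1 "2 ^ n * \<bar>d n x\<bar>"] p by (meson not_le less_imp_le zero_le_one)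
      then show ?case by (simp add: field_simps power_one_over)
    qed
    then have "summable (\<lambda>n. d n x)" by (rule summable_comparison_test_ev) (auto intro: summable_geometric)
    then have "convergent (\<lambda>n. \<Sum>k<n. d k x)" by (simp add: summable_iff_convergent)
    moreover have "(\<Sum>k<n. d k x) = u n x - u 0 x" for n
      unfolding d_def by (rule sum_lessThan_telescope)
    ultimately have "convergent (\<lambda>n. (u n x - u 0 x) + u 0 x)" by (intro convergent_add convergent_const) simp
    then show ?case by simp
  qed
  define g where "g x = lim (\<lambda>n. u n x)" for x
  have gm [measurable]: "g \<in> borel_measurable M" unfolding g_def by measurable
  have lim: "AE x in M. (\<lambda>n. u n x) \<longlonglongrightarrow> g x"
    using conv by eventually_elim (simp add: g_def convergent_LIMSEQ_iff)
  have nn: "(\<integral>\<^sup>+x. ennreal (\<bar>g x - u n x\<bar> powr p) \<partial>M) \<le> ennreal (K * r ^ n)" for n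
  proof -
    have "(\<integral>\<^sup>+x. ennreal (\<bar>g x - u n x\<bar> powr p) \<partial>M)
        = (\<integral>\<^sup>+x. liminf (\<lambda>m. ennreal (\<bar>u m x - u n x\<bar> powr p)) \<partial>M)"
    proof (rule nn_integral_cong_AE)
      show "AE x in M. ennreal (\<bar>g x - u n x\<bar> powr p) = liminf (\<lambda>m. ennreal (\<bar>u m x - u n x\<bar> powr p))"
        using lim
      proof eventually_elim
        case (elim x)
        have "(\<lambda>m. ennreal (\<bar>u m x - u n x\<bar> powr p)) \<longlonglongrightarrow> ennreal (\<bar>g x - u n x\<bar> powr p)"
          using p by (intro tendsto_ennrealI tendsto_powr' tendsto_rabs tendsto_diff tendsto_const elim) auto
        then show ?case by (intro lim_imp_Liminf[symmetric]) auto
      qed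
    qed
    also have "\<dots> \<le> liminf (\<lambda>m. \<integral>\<^sup>+x. ennreal (\<bar>u m x - u n x\<bar> powr p) \<partial>M)"
      by (rule nn_integral_liminf) measurable
    also have "\<dots> \<le> ennreal (K * r ^ n)"
    proof (rule Liminf_le)
      show "eventually (\<lambda>m. (\<integral>\<^sup>+x. ennreal (\<bar>u m x - u n x\<bar> powr p) \<partial>M) \<le> ennreal (K * r ^ n)) sequentially"
        using eventually_ge_at_top[of n]
      proof eventually_elim
        case (elim m)
        have "(\<integral>\<^sup>+x. ennreal (\<bar>u m x - u n x\<bar> powr p) \<partial>M) = ennreal (Lp_mass p M (\<lambda>x. u m x - u n x))"
          by (intro nn_integral_eq_integral Lp_spaceD(2) Lp_space_diff p u) auto
        then show ?case using cauchy[OF elim] by (simp add: r_def ennreal_leI)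
      qed
    qed simp
    finally show ?thesis .
  qed
  have int: "integrable M (\<lambda>x. \<bar>g x - u n x\<bar> powr p)" for n
    using nn[of n] by (intro integrableI_bounded) (auto intro: le_less_trans)
  have gu: "(\<lambda>x. g x - u n x) \<in> Lp_space p M" for n using int by (simp add: Lp_space_def)
  have "g \<in> Lp_space p M" using Lp_space_add[OF p gu[of 0] u[of 0]] by simp
  moreover have "Lp_mass p M (\<lambda>x. g x - u n x) \<le> K * r ^ n" for n
  proof -
    have "ennreal (Lp_mass p M (\<lambda>x. g x - u n x)) \<le> ennreal (K * r ^ n)"
      using nn[of n] by (subst (asm) nn_integral_eq_integral[OF int]) auto
    then show ?thesis using K0 r by (subst (asm) ennreal_le_iff) auto
  qed
  ultimately show ?thesis unfolding r_def by blast
qed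

locale dense_Lp_operator =
  fixes M :: "'a measure" and p C :: real and V :: "('a \<Rightarrow> real) set" and S :: "('a \<Rightarrow> real) \<Rightarrow> 'a \<Rightarrow> real"
  assumes p: "p > 0" and C: "C \<ge> 0"
    and V_Lp: "f \<in> V \<Longrightarrow> f \<in> Lp_space p M" and S_Lp: "f \<in> V \<Longrightarrow> S f \<in> Lp_space p M"
    and V_linear: "f \<in> V \<Longrightarrow> g \<in> V \<Longrightarrow> (\<lambda>x. a * f x + b * g x) \<in> V"
    and S_linear: "f \<in> V \<Longrightarrow> g \<in> V \<Longrightarrow> S (\<lambda>x. a * f x + b * g x) = (\<lambda>x. a * S f x + b * S g x)"
    and S_bounded: "f \<in> V \<Longrightarrow> Lp_mass p M (S f) \<le> C * Lp_mass p M f"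
    and dense: "f \<in> Lp_space p M \<Longrightarrow> e > 0 \<Longrightarrow> \<exists>g\<in>V. Lp_mass p M (\<lambda>x. f x - g x) < e"
begin

text \<open>
  The graph of the continuous extension. Working with the closure of the graph makes linearity and uniqueness
  direct consequences of the bound, and no approximating sequence has to be carried along.
\<close>
definition extends_to :: "('a \<Rightarrow> real) \<Rightarrow> ('a \<Rightarrow> real) \<Rightarrow> bool" where
  "extends_to f g \<longleftrightarrow> g \<in> Lp_space p M \<and>
     (\<forall>e>0. \<exists>q\<in>V. Lp_mass p M (\<lambda>x. f x - q x) < e \<and> Lp_mass p M (\<lambda>x. g x - S q x) < e)"

lemma S_diff_bounded:
  assumes "f \<in> V" "g \<in> V"
  shows "Lp_mass p M (\<lambda>x. S f x - S g x) \<le> C * Lp_mass p M (\<lambda>x. f x - g x)"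
  using S_bounded[OF V_linear[OF assms, of 1 "-1"]] S_linear[OF assms, of 1 "-1"] by simp

lemma extends_to_exists:
  assumes f: "f \<in> Lp_space p M"
  shows "\<exists>g. extends_to f g"
proof -
  define r where "r = 1 / 4 powr p"
  have r: "r > 0" "r < 1" using p by (auto simp: r_def gr_one_powr)
  have "\<exists>q\<in>V. Lp_mass p M (\<lambda>x. f x - q x) < r ^ n" for n using r by (intro dense f) auto
  then obtain q where q: "\<And>n. q n \<in> V" "\<And>n. Lp_mass p M (\<lambda>x. f x - q n x) < r ^ n" by metis
  define K where "K = C * (2 powr p * 2)"
  have K0: "K \<ge> 0" using C by (simp add: K_def)
  have cauchy: "Lp_mass p M (\<lambda>x. S (q m) x - S (q n) x) \<le> K * (1 / 4 powr p) ^ n" if "n \<le> m" for n m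
  proof -
    have "Lp_mass p M (\<lambda>x. q m x - f x) \<le> r ^ n"
      using q(2)[of m] power_decreasing[OF that, of r] r Lp_mass_minus_commute[where f = f and g = "q m"] by (metis less_imp_le order_trans)
    then have "Lp_mass p M (\<lambda>x. q m x - f x) + Lp_mass p M (\<lambda>x. f x - q n x) \<le> 2 * r ^ n" using q(2)[of n] by linarith
    then have "Lp_mass p M (\<lambda>x. q m x - q n x) \<le> 2 powr p * (2 * r ^ n)"
      by (intro order_trans[OF Lp_mass_triangle[OF p V_Lp[OF q(1)] f V_Lp[OF q(1)]]] mult_left_mono) auto
    then have "C * Lp_mass p M (\<lambda>x. q m x - q n x) \<le> C * (2 powr p * (2 * r ^ n))" using C by (rule mult_left_mono)
    then show ?thesis using S_diff_bounded[OF q(1)[of m] q(1)[of n]] unfolding r_def by (simp add: K_def mult.assoc)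
  qed
  obtain g where g: "g \<in> Lp_space p M" "\<And>n. Lp_mass p M (\<lambda>x. g x - S (q n) x) \<le> K * r ^ n"
    using Lp_rapidly_Cauchy_limit[OF p S_Lp[OF q(1)] cauchy] unfolding r_def by blast
  have "\<exists>q\<in>V. Lp_mass p M (\<lambda>x. f x - q x) < e \<and> Lp_mass p M (\<lambda>x. g x - S q x) < e" if e: "e > 0" for e
  proof -
    have "(\<lambda>n. (K + 1) * r ^ n) \<longlonglongrightarrow> (K + 1) * 0" using r by (intro tendsto_intros LIMSEQ_power_zero) auto
    then have "eventually (\<lambda>n. (K + 1) * r ^ n < e) sequentially" using e by (intro order_tendstoD(2)) auto
    then obtain n where n: "(K + 1) * r ^ n < e" by (auto simp: eventually_sequentially)
    have "K * r ^ n + r ^ n < e" using n by (simp add: algebra_simps)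
    moreover have "K * r ^ n \<ge> 0" "r ^ n > 0" using K0 r by auto
    ultimately show ?thesis using q[of n] g(2)[of n] by (intro bexI[of _ "q n"]) auto
  qed
  then show ?thesis unfolding extends_to_def using g(1) by blast
qed

lemma extends_to_bounded:
  assumes f: "f \<in> Lp_space p M" and g: "extends_to f g"
  shows "Lp_mass p M g \<le> 4 powr p * C * Lp_mass p M f"
proof (rule field_le_epsilon)
  fix e :: real assume e: "e > 0"
  \<comment> \<open>The factor with which the approximation errors enter the final estimate.\<close>
  let ?k = "2 powr p * (1 + C * 2 powr p)"
  have k: "?k > 0" using C by (intro mult_pos_pos add_pos_nonneg) auto
  then have "e / ?k > 0" using e by simp
  then obtain q where q: "q \<in> V" "Lp_mass p M (\<lambda>x. f x - q x) < e / ?k" "Lp_mass p M (\<lambda>x. g x - S q x) < e / ?k"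
    using g unfolding extends_to_def by blast
  have gL: "g \<in> Lp_space p M" using g by (simp add: extends_to_def)
  have "Lp_mass p M q \<le> 2 powr p * (Lp_mass p M (\<lambda>x. q x - f x) + Lp_mass p M f)"
    using Lp_mass_add[OF p Lp_space_diff[OF p V_Lp[OF q(1)] f] f] by simp
  also have "\<dots> \<le> 2 powr p * (e / ?k + Lp_mass p M f)"
    using q(2) Lp_mass_minus_commute[where f = q and g = f] by (intro mult_left_mono add_right_mono) auto
  finally have "C * Lp_mass p M q \<le> C * (2 powr p * (e / ?k + Lp_mass p M f))" using C by (rule mult_left_mono)
  then have Sq: "Lp_mass p M (S q) \<le> C * (2 powr p * (e / ?k + Lp_mass p M f))" using S_bounded[OF q(1)] by linarith
  have "Lp_mass p M g \<le> 2 powr p * (Lp_mass p M (\<lambda>x. g x - S q x) + Lp_mass p M (S q))"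
    using Lp_mass_add[OF p Lp_space_diff[OF p gL S_Lp[OF q(1)]] S_Lp[OF q(1)]] by simp
  also have "\<dots> \<le> 2 powr p * (e / ?k + C * (2 powr p * (e / ?k + Lp_mass p M f)))"
    using q(3) Sq by (intro mult_left_mono add_mono) auto
  also have "\<dots> = ?k * (e / ?k) + (2 powr p * 2 powr p) * C * Lp_mass p M f" by (simp only: algebra_simps)
  also have "?k * (e / ?k) = e"
    using k by (metis less_irrefl nonzero_mult_div_cancel_left times_divide_eq_right)
  also have "2 powr p * 2 powr p = 4 powr p" by (simp flip: powr_mult)
  finally show "Lp_mass p M g \<le> 4 powr p * C * Lp_mass p M f + e" by simp
qed

lemma extends_to_linear:
  assumes f: "f \<in> Lp_space p M" "f' \<in> Lp_space p M" and g: "extends_to f g" "extends_to f' g'"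
  shows "extends_to (\<lambda>x. a * f x + b * f' x) (\<lambda>x. a * g x + b * g' x)"
  unfolding extends_to_def
proof (intro conjI allI impI)
  have gL: "g \<in> Lp_space p M" "g' \<in> Lp_space p M" using g by (simp_all add: extends_to_def)
  then show "(\<lambda>x. a * g x + b * g' x) \<in> Lp_space p M" by (rule Lp_space_linear[OF p])
  fix e :: real assume e: "e > 0"
  let ?k = "2 powr p * (\<bar>a\<bar> powr p + \<bar>b\<bar> powr p) + 1"
  have k: "?k > 0" by (intro add_nonneg_pos mult_nonneg_nonneg) auto
  then have ek: "e / ?k > 0" using e by simp
  obtain q where q: "q \<in> V" "Lp_mass p M (\<lambda>x. f x - q x) < e / ?k" "Lp_mass p M (\<lambda>x. g x - S q x) < e / ?k"
    using g(1) ek unfolding extends_to_def by blast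
  obtain q' where q': "q' \<in> V" "Lp_mass p M (\<lambda>x. f' x - q' x) < e / ?k" "Lp_mass p M (\<lambda>x. g' x - S q' x) < e / ?k"
    using g(2) ek unfolding extends_to_def by blast
  have *: "Lp_mass p M (\<lambda>x. (a * F x + b * F' x) - (a * Q x + b * Q' x)) < e"
    if F: "F \<in> Lp_space p M" "F' \<in> Lp_space p M" "Q \<in> Lp_space p M" "Q' \<in> Lp_space p M"
      and *: "Lp_mass p M (\<lambda>x. F x - Q x) < e / ?k" "Lp_mass p M (\<lambda>x. F' x - Q' x) < e / ?k" for F F' Q Q'
  proof -
    have "Lp_mass p M (\<lambda>x. (a * F x + b * F' x) - (a * Q x + b * Q' x)) = Lp_mass p M (\<lambda>x. a * (F x - Q x) + b * (F' x - Q' x))"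
      by (simp add: algebra_simps)
    also have "\<dots> \<le> 2 powr p * (\<bar>a\<bar> powr p * Lp_mass p M (\<lambda>x. F x - Q x) + \<bar>b\<bar> powr p * Lp_mass p M (\<lambda>x. F' x - Q' x))"
      by (intro Lp_mass_linear Lp_space_diff p F)
    also have "\<dots> \<le> 2 powr p * (\<bar>a\<bar> powr p * (e / ?k) + \<bar>b\<bar> powr p * (e / ?k))"
      using * by (intro mult_left_mono add_mono) auto
    also have "\<dots> = ?k * (e / ?k) - e / ?k" by (simp only: algebra_simps)
    also have "\<dots> < e" using k ek by simp
    finally show ?thesis .
  qed
  show "\<exists>r\<in>V. Lp_mass p M (\<lambda>x. (a * f x + b * f' x) - r x) < e \<and> Lp_mass p M (\<lambda>x. (a * g x + b * g' x) - S r x) < e"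
  proof (intro bexI[of _ "\<lambda>x. a * q x + b * q' x"] conjI)
    show "(\<lambda>x. a * q x + b * q' x) \<in> V" by (rule V_linear[OF q(1) q'(1)])
    show "Lp_mass p M (\<lambda>x. (a * f x + b * f' x) - (a * q x + b * q' x)) < e"
      using f V_Lp q q' by (intro *) auto
    show "Lp_mass p M (\<lambda>x. (a * g x + b * g' x) - S (\<lambda>x. a * q x + b * q' x) x) < e"
      unfolding S_linear[OF q(1) q'(1)] using gL S_Lp q q' by (intro *) auto
  qed
qed

lemma extends_to_unique:
  assumes f: "f \<in> Lp_space p M" and g: "extends_to f g" "extends_to f g'"
  shows "AE x in M. g x = g' x"
proof -
  have e: "extends_to (\<lambda>x. 1 * f x + (-1) * f x) (\<lambda>x. 1 * g x + (-1) * g' x)" by (rule extends_to_linear[OF f f g])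
  let ?h = "\<lambda>x. 1 * g x + (-1) * g' x"
  have "Lp_mass p M ?h \<le> 4 powr p * C * Lp_mass p M (\<lambda>x. 1 * f x + (-1) * f x)"
    by (rule extends_to_bounded[OF Lp_space_linear[OF p f f] e])
  also have "\<dots> = 0" using p by simp
  finally have "Lp_mass p M ?h = 0" using Lp_mass_nonneg[where f = ?h] by (rule antisym)
  moreover have "integrable M (\<lambda>x. \<bar>?h x\<bar> powr p)" using e Lp_spaceD(2) unfolding extends_to_def by blast
  ultimately have "AE x in M. \<bar>?h x\<bar> powr p = 0" by (subst (asm) integral_nonneg_eq_0_iff_AE) auto
  then show ?thesis by eventually_elim auto
qed

lemma extends_to_AE_cong:
  assumes "f \<in> borel_measurable M" "f' \<in> borel_measurable M" "AE x in M. f x = f' x" and "extends_to f g"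
  shows "extends_to f' g"
proof -
  have "Lp_mass p M (\<lambda>x. f x - q x) = Lp_mass p M (\<lambda>x. f' x - q x)" if "q \<in> V" for q
  proof (rule integral_cong_AE)
    note [measurable] = assms(1,2) Lp_spaceD(1)[OF V_Lp[OF that]]
    show "(\<lambda>x. \<bar>f x - q x\<bar> powr p) \<in> borel_measurable M" "(\<lambda>x. \<bar>f' x - q x\<bar> powr p) \<in> borel_measurable M" by measurable
    show "AE x in M. \<bar>f x - q x\<bar> powr p = \<bar>f' x - q x\<bar> powr p" using assms(3) by eventually_elim simp
  qed
  then show ?thesis using assms(4) unfolding extends_to_def by metis
qed

lemma extends_to_S: 
  assumes "f \<in> V"
  shows "extends_to f (S f)"
  unfolding extends_to_def using S_Lp[OF assms] assms p by (auto intro!: bexI[of _ f])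

text \<open>
  The extension picks any representative related to \<open>f\<close>; two of them agree almost everywhere.
\<close>
theorem bounded_extension:
  "\<exists>T. Lp_bounded_linear p M T \<and> (\<forall>f\<in>V. AE x in M. T f x = S f x)"
proof -
  define T where "T f = (SOME g. extends_to f g)" for f
  have T: "extends_to f (T f)" if "f \<in> Lp_space p M" for f
    unfolding T_def using extends_to_exists[OF that] by (rule someI_ex)
  have "Lp_bounded_linear p M T" unfolding Lp_bounded_linear_def
  proof (intro conjI ballI allI impI)
    fix f assume "f \<in> Lp_space p M"
    then show "T f \<in> Lp_space p M" using T by (simp add: extends_to_def)
  next
    fix f g assume fg: "f \<in> Lp_space p M" "g \<in> Lp_space p M" "AE x in M. f x = g x"
    then have "extends_to g (T f)" using T Lp_spaceD(1) by (intro extends_to_AE_cong[of f g]) auto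
    then show "AE x in M. T f x = T g x" using T fg by (intro extends_to_unique[of g]) auto
  next
    fix f g a b assume fg: "f \<in> Lp_space p M" "g \<in> Lp_space p M"
    show "AE x in M. T (\<lambda>y. a * f y + b * g y) x = a * T f x + b * T g x"
      by (rule extends_to_unique[OF Lp_space_linear[OF p fg] T[OF Lp_space_linear[OF p fg]]
            extends_to_linear[OF fg T[OF fg(1)] T[OF fg(2)]]])
  next
    have "Lp_norm p M (T f) \<le> (4 powr p * C) powr (1 / p) * Lp_norm p M f" if f: "f \<in> Lp_space p M" for f
    proof -
      have "Lp_norm p M (T f) \<le> (4 powr p * C * Lp_mass p M f) powr (1 / p)"
        unfolding Lp_norm_def using p by (intro powr_mono2 extends_to_bounded f T) auto
      also have "\<dots> = (4 powr p * C) powr (1 / p) * Lp_norm p M f"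
        unfolding Lp_norm_def using C by (subst powr_mult) auto
      finally show ?thesis .
    qed
    then show "\<exists>C. \<forall>f\<in>Lp_space p M. Lp_norm p M (T f) \<le> C * Lp_norm p M f" by blast
  qed
  moreover have "AE x in M. T f x = S f x" if "f \<in> V" for f
    using that by (intro extends_to_unique[of f] T extends_to_S V_Lp)
  ultimately show ?thesis by blast
qed

end

section \<open>Integrals, expansions and enumerations\<close>

lemma Gamma_integral_scaled:
  fixes a l :: real
  assumes a: "a > 0" and l: "l > 0"
  shows "integrable lborel (\<lambda>t. indicator {0..} t * (t powr (a - 1) * exp (- (t * l))))"
    and "(LINT t|lborel. indicator {0..} t * (t powr (a - 1) * exp (- (t * l)))) = Gamma a * l powr (- a)"
proof -
  let ?g = "\<lambda>t::real. indicat_real {0..} t * t powr (a - 1) / exp t"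
  have nn: "(\<integral>\<^sup>+t. ennreal (?g t) \<partial>lborel) = ennreal (Gamma a)"
    using Gamma_conv_nn_integral_real[OF a] by simp
  have int: "integrable lborel ?g"
    by (rule integrableI_nn_integral_finite[where x = "Gamma a", OF _ _ nn]) (auto simp: indicator_def)
  have val: "(LINT t|lborel. ?g t) = Gamma a"
  proof -
    have "(LINT t|lborel. ?g t) = enn2real (\<integral>\<^sup>+t. ennreal (?g t) \<partial>lborel)"
      by (rule integral_eq_nn_integral) (auto simp: indicator_def)
    then show ?thesis unfolding nn using a by simp
  qed
  have eq: "?g (0 + l * t) = l powr (a - 1) * (indicator {0..} t * (t powr (a - 1) * exp (- (t * l))))" for t
  proof (cases "t \<ge> 0")
    case True
    then show ?thesis using l by (simp add: powr_mult exp_minus field_simps)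
  next
    case False
    then have "\<not> 0 \<le> l * t" using l by (simp add: zero_le_mult_iff)
    then show ?thesis using False by simp
  qed
  have "integrable lborel (\<lambda>t. ?g (0 + l * t))"
    using l by (intro lborel_integrable_real_affine[OF int]) auto
  then show "integrable lborel (\<lambda>t. indicator {0..} t * (t powr (a - 1) * exp (- (t * l))))"
    unfolding eq using l by (subst (asm) integrable_mult_left_iff) auto
  have "Gamma a = l * (LINT t|lborel. ?g (0 + l * t))"
    using lborel_integral_real_affine[of l ?g 0] l unfolding val by simp
  also have "\<dots> = l * l powr (a - 1) * (LINT t|lborel. indicator {0..} t * (t powr (a - 1) * exp (- (t * l))))"
    unfolding eq by simp
  also have "l * l powr (a - 1) = l powr a" using l by (simp add: powr_diff)
  finally show "(LINT t|lborel. indicator {0..} t * (t powr (a - 1) * exp (- (t * l)))) = Gamma a * l powr (- a)"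
    using l by (simp add: powr_minus field_simps)
qed

text \<open>
  From \<open>x / N \<le> exp (x / N)\<close> with \<open>x = 1 + l\<close>, raised to the power \<open>N\<close>.
\<close>
lemma exp_minus_le_powr:
  assumes N: "N > 0" and l: "l \<ge> (0::real)"
  shows "exp (- l) \<le> (N powr N * exp 1) * (1 + l) powr (- N)"
proof -
  have "(1 + l) / N \<le> exp ((1 + l) / N)" using exp_ge_add_one_self[of "(1 + l) / N"] by linarith
  then have "((1 + l) / N) powr N \<le> exp ((1 + l) / N) powr N" using N l by (intro powr_mono2) auto
  also have "\<dots> = exp 1 * exp l" using N by (simp add: exp_powr_real exp_add)
  finally have "(1 + l) powr N \<le> N powr N * (exp 1 * exp l)"
    using N l by (simp add: powr_divide pos_divide_le_eq mult.commute)
  then show ?thesis using l by (simp add: powr_minus exp_minus field_simps)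
qed

text \<open>
  The tail of the power series after \<open>J\<close> terms is \<open>t^J\<close> times a series that converges absolutely on a smaller interval.
\<close>
lemma fps_expansion_polynomial_approx:
  fixes h :: "real \<Rightarrow> real"
  assumes "h has_fps_expansion F"
  shows "\<exists>a B. eventually (\<lambda>t. \<bar>h t - (\<Sum>j<J. a j * t ^ j)\<bar> \<le> B * \<bar>t\<bar> ^ J) (nhds 0)"
proof -
  have R: "fps_conv_radius F > 0" and ev: "eventually (\<lambda>t. eval_fps F t = h t) (nhds 0)"
    using assms by (auto simp: has_fps_expansion_def)
  obtain \<rho> where \<rho>: "0 < ereal \<rho>" "ereal \<rho> < fps_conv_radius F" using ereal_dense2[OF R] by blast
  have \<rho>0: "\<rho> > 0" using \<rho>(1) by simp
  have "summable (\<lambda>n. norm (fps_nth F n * \<rho> ^ n))" by (rule norm_summable_fps) (use \<rho> \<rho>0 in auto)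
  then have "summable (\<lambda>n. norm (fps_nth F (n + J) * \<rho> ^ (n + J)) * (1 / \<rho> ^ J))"
    by (intro summable_mult2 summable_ignore_initial_segment)
  moreover have "norm (fps_nth F (n + J) * \<rho> ^ (n + J)) * (1 / \<rho> ^ J) = \<bar>fps_nth F (n + J)\<bar> * \<rho> ^ n" for n
    using \<rho>0 by (simp add: abs_mult power_add)
  ultimately have sm: "summable (\<lambda>n. \<bar>fps_nth F (n + J)\<bar> * \<rho> ^ n)" by (simp only:)
  define B where "B = (\<Sum>n. \<bar>fps_nth F (n + J)\<bar> * \<rho> ^ n)"
  have "eventually (\<lambda>t. t \<in> {-\<rho><..<\<rho>}) (nhds 0)" using \<rho>0 by (intro eventually_nhds_in_open) auto
  then have "eventually (\<lambda>t. \<bar>h t - (\<Sum>j<J. fps_nth F j * t ^ j)\<bar> \<le> B * \<bar>t\<bar> ^ J) (nhds 0)"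
    using ev
  proof eventually_elim
    case (elim t)
    then have t: "\<bar>t\<bar> \<le> \<rho>" by auto
    have "ereal (norm t) < fps_conv_radius F" using t \<rho>(2) by (intro le_less_trans[OF _ \<rho>(2)]) auto
    then have smt: "summable (\<lambda>n. norm (fps_nth F n * t ^ n))" by (rule norm_summable_fps)
    have le: "norm (fps_nth F (n + J) * t ^ n) \<le> \<bar>fps_nth F (n + J)\<bar> * \<rho> ^ n" for n
      using t by (auto simp: abs_mult power_abs intro!: mult_left_mono power_mono)
    have smJ: "summable (\<lambda>n. fps_nth F (n + J) * t ^ n)" by (rule summable_comparison_test'[OF sm le])
    have "h t - (\<Sum>j<J. fps_nth F j * t ^ j) = (\<Sum>n. fps_nth F (n + J) * t ^ (n + J))"
      using suminf_split_initial_segment[OF summable_norm_cancel[OF smt], of J] elim(2) by (simp add: eval_fps_def)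
    also have "\<dots> = t ^ J * (\<Sum>n. fps_nth F (n + J) * t ^ n)"
      by (subst suminf_mult[OF smJ, symmetric]) (simp add: power_add mult_ac)
    finally have "\<bar>h t - (\<Sum>j<J. fps_nth F j * t ^ j)\<bar> = \<bar>t\<bar> ^ J * norm (\<Sum>n. fps_nth F (n + J) * t ^ n)"
      by (simp add: abs_mult power_abs)
    also have "\<dots> \<le> \<bar>t\<bar> ^ J * B" unfolding B_def by (intro mult_left_mono norm_suminf_le[OF le sm]) auto
    finally show ?case by (simp add: mult.commute)
  qed
  then show ?thesis by blast
qed

lemma strict_mono_enumeration_unique:
  fixes r s :: "nat \<Rightarrow> real"
  assumes r: "strict_mono r" and s: "strict_mono s" and rng: "range r = range s"
  shows "r = s"
proof -
  have le: "r n \<le> s n" if r: "strict_mono r" and s: "strict_mono s" and sub: "range s \<subseteq> range r" for r s :: "nat \<Rightarrow> real" and n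
  proof -
    have "\<forall>n. \<exists>k. s n = r k" using sub by blast
    then obtain g where g: "\<And>n. s n = r (g n)" by metis
    have "strict_mono g"
    proof (rule strict_monoI)
      fix m n :: nat assume "m < n"
      then have "r (g m) < r (g n)" using strict_monoD[OF s] g by metis
      then show "g m < g n" using strict_mono_less[OF r] by blast
    qed
    then have "n \<le> g n" by (rule strict_mono_imp_increasing)
    then have "r n \<le> r (g n)" using strict_mono_less_eq[OF r] by blast
    then show ?thesis using g by simp
  qed
  show ?thesis using le[OF r s] le[OF s r] rng by (intro ext antisym) auto
qed

text \<open>
  Starting below the set, one moves repeatedly to the least larger element of the set; local finiteness makes this
  element exist and lets the sequence reach every element.
\<close>
lemma strict_mono_enumeration_exists:
  fixes A :: "real set"
  assumes inf: "infinite A" and fin: "\<And>b. finite {x\<in>A. x \<le> b}" and low: "\<And>x. x \<in> A \<Longrightarrow> x > l"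
  shows "\<exists>r. strict_mono (r :: nat \<Rightarrow> real) \<and> range r = A"
proof -
  have "\<exists>x\<in>A. x > b \<and> (\<forall>y\<in>A. y > b \<longrightarrow> x \<le> y)" for b
  proof -
    have "\<exists>z\<in>A. z > b"
    proof (rule ccontr)
      assume "\<not> (\<exists>z\<in>A. z > b)"
      then have "A = {x\<in>A. x \<le> b}" by (auto simp: not_less)
      then show False using inf fin[of b] by simp
    qed
    then obtain z where z: "z \<in> A" "z > b" by blast
    let ?B = "{x\<in>A. b < x \<and> x \<le> z}"
    have B: "finite ?B" "?B \<noteq> {}" using z by (auto intro: finite_subset[OF _ fin[of z]])
    have "Min ?B \<in> ?B" using B by (rule Min_in)
    moreover have "Min ?B \<le> y" if "y \<in> A" "y > b" for y
    proof (cases "y \<le> z")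
      case True
      then show ?thesis using that B by (intro Min_le) auto
    next
      case False
      then show ?thesis using \<open>Min ?B \<in> ?B\<close> by auto
    qed
    ultimately show ?thesis by blast
  qed
  then obtain nxt where nxt: "\<And>b. nxt b \<in> A" "\<And>b. nxt b > b" "\<And>b y. y \<in> A \<Longrightarrow> y > b \<Longrightarrow> nxt b \<le> y" by metis
  define r where "r n = (nxt ^^ Suc n) l" for n
  have rS: "r (Suc n) = nxt (r n)" "r 0 = nxt l" for n by (simp_all add: r_def)
  have rA: "r n \<in> A" for n by (cases n) (simp_all add: rS nxt(1))
  have mono: "strict_mono r" unfolding strict_mono_Suc_iff rS(1) using nxt(2) by blast
  have "y \<in> range r" if y: "y \<in> A" for y
  proof -
    have "\<exists>n. r n \<ge> y"
    proof (rule ccontr)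
      assume "\<nexists>n. r n \<ge> y"
      then have "range r \<subseteq> {x\<in>A. x \<le> y}" using rA by (auto simp: not_le intro: less_imp_le)
      then have "finite (range r)" using fin finite_subset by blast
      then show False using strict_mono_imp_inj_on[OF mono] by (meson finite_imageD infinite_UNIV_nat)
    qed
    define n where "n = (LEAST n. r n \<ge> y)"
    have n: "r n \<ge> y" unfolding n_def by (rule LeastI_ex) fact
    have "r n \<le> y"
    proof (cases n)
      case 0
      then show ?thesis using nxt(3)[OF y low[OF y]] rS(2) by simp
    next
      case (Suc m)
      then have "\<not> r m \<ge> y" using not_less_Least[of m "\<lambda>n. r n \<ge> y"] by (simp add: n_def)
      then show ?thesis using nxt(3)[OF y, of "r m"] rS(1)[of m] Suc by simp
    qed
    then show ?thesis using n by (metis antisym rangeI)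
  qed
  then show ?thesis using mono rA by blast
qed

context jacobi_parameters
begin

lemma finite_eig_le: "finite {\<kappa>. eig \<kappa> \<le> b}"
proof -
  obtain n :: nat where n: "\<bar>b\<bar> + 1 \<le> real n" using real_arch_simple by blast
  have "\<kappa> $ i \<le> n" if "eig \<kappa> \<le> b" for \<kappa> i
  proof (rule ccontr)
    assume "\<not> \<kappa> $ i \<le> n"
    then have k: "real n \<le> real (\<kappa> $ i)" by simp
    have "(real (\<kappa> $ i))\<^sup>2 \<le> (\<Sum>i\<in>UNIV. (real (\<kappa> $ i))\<^sup>2)"
      by (rule member_le_sum[where f = "\<lambda>i. (real (\<kappa> $ i))\<^sup>2"]) auto
    then have "(real (\<kappa> $ i))\<^sup>2 \<le> b" using eig_ge[of \<kappa>] that by linarith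
    moreover have "real n * 1 \<le> real (\<kappa> $ i) * real (\<kappa> $ i)" using k n by (intro mult_mono) auto
    ultimately show False using n by (simp add: power2_eq_square)
  qed
  then have "{\<kappa>. eig \<kappa> \<le> b} \<subseteq> {\<kappa>. \<forall>i. \<kappa> $ i \<le> n}" by auto
  then show ?thesis using sum_box_prod(1) finite_subset by blast
qed

lemma infinite_range_eig: "infinite (range eig)"
proof
  assume fin: "finite (range eig)"
  have "eig \<kappa> \<le> Max (range eig)" for \<kappa> using fin by (intro Max_ge) auto
  then have "finite (UNIV :: (nat^'d) set)" using finite_eig_le[of "Max (range eig)"] by simp
  then have "finite (range (vec :: nat \<Rightarrow> nat^'d))" by (rule rev_finite_subset) simp
  moreover have "inj (vec :: nat \<Rightarrow> nat^'d)" by (auto simp: inj_def vec_eq_iff)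
  ultimately show False by (meson finite_imageD infinite_UNIV_nat)
qed

lemma jacobi_r_enumerates: "strict_mono (jacobi_r \<alpha> \<beta>)" "range (jacobi_r \<alpha> \<beta>) = range eig"
proof -
  have "{x \<in> range eig. x \<le> b} \<subseteq> eig ` {\<kappa>. eig \<kappa> \<le> b}" for b by auto
  then have fin: "finite {x \<in> range eig. x \<le> b}" for b using finite_eig_le finite_subset by blast
  have low: "x > -1" if "x \<in> range eig" for x
    using that less_le_trans[OF _ eig_nonneg, of "-1"] by auto
  obtain r :: "nat \<Rightarrow> real" where r: "strict_mono r" "range r = range eig"
    using strict_mono_enumeration_exists[of "range eig" "-1"] infinite_range_eig fin low by auto
  have "jacobi_r \<alpha> \<beta> = r" unfolding jacobi_r_def
    using r strict_mono_enumeration_unique by (intro the_equality) auto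
  with r show "strict_mono (jacobi_r \<alpha> \<beta>)" "range (jacobi_r \<alpha> \<beta>) = range eig" by auto
qed

end

section \<open>The multiplier theorem\<close>

context jacobi_parameters
begin

lemma jacobi_sum_Lp: "p > 0 \<Longrightarrow> jacobi_sum c \<in> Lp_space p M"
  by (auto simp: Lp_space_def intro: integrable_powr_jacobi_sum)

lemma polynomials_dense_continuous:
  assumes p: "p > 0" and g: "continuous_on UNIV g" and e: "e > 0"
  shows "\<exists>c. fin_supp c \<and> Lp_mass p M (\<lambda>x. g x - jacobi_sum c x) \<le> e"
proof -
  define \<eta> where "\<eta> = (e / measure M UNIV) powr (1 / p)"
  have \<eta>: "\<eta> > 0" using e measure_M_pos by (simp add: \<eta>_def)
  have \<eta>p: "\<eta> powr p = e / measure M UNIV" using p e measure_M_pos by (simp add: \<eta>_def powr_powr)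
  obtain q where q: "real_polynomial_function q" "\<And>x. x \<in> cube \<Longrightarrow> \<bar>g x - q x\<bar> < \<eta>"
    by (rule Stone_Weierstrass_real_polynomial_function[OF compact_cbox continuous_on_subset[OF g subset_UNIV] \<eta>]) blast
  obtain c where c: "fin_supp c" "q = jacobi_sum c" using real_polynomial_function_jacobi_sum[OF q(1)] by blast
  have [measurable]: "g \<in> borel_measurable borel" by (rule borel_measurable_continuous_onI[OF g])
  have "Lp_mass p M (\<lambda>x. g x - jacobi_sum c x) \<le> (LINT x|M. \<eta> powr p)"
  proof (rule integral_mono_AE)
    show "integrable M (\<lambda>x. \<bar>g x - jacobi_sum c x\<bar> powr p)"
      using p by (intro integrable_M_continuous) (auto intro!: continuous_intros continuous_on_powr' continuous_on_subset[OF g])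
    show "AE x in M. \<bar>g x - jacobi_sum c x\<bar> powr p \<le> \<eta> powr p"
      using AE_M_cube
    proof eventually_elim
      case (elim x)
      show ?case using q(2)[OF elim] p by (intro powr_mono2) (auto simp: c(2))
    qed
  qed auto
  also have "\<dots> = e" using measure_M_pos unfolding \<eta>p by simp
  finally show ?thesis using c(1) by blast
qed

lemma Lp_mass_bounded_tendsto:
  assumes p: "p > 0" and [measurable]: "\<And>n. u n \<in> borel_measurable M" "f \<in> borel_measurable M" "w \<in> borel_measurable M"
    and w: "integrable M (\<lambda>x. \<bar>w x\<bar> powr p)" and bound: "\<And>n. AE x in M. \<bar>f x - u n x\<bar> \<le> \<bar>w x\<bar>"
    and lim: "AE x in M. (\<lambda>n. u n x) \<longlonglongrightarrow> f x"
  shows "(\<lambda>n. Lp_mass p M (\<lambda>x. f x - u n x)) \<longlonglongrightarrow> 0"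
proof -
  have "(\<lambda>n. Lp_mass p M (\<lambda>x. f x - u n x)) \<longlonglongrightarrow> (LINT x|M. 0)"
  proof (rule integral_dominated_convergence)
    show "AE x in M. (\<lambda>n. \<bar>f x - u n x\<bar> powr p) \<longlonglongrightarrow> 0"
      using lim
    proof eventually_elim
      case (elim x)
      have "(\<lambda>n. \<bar>f x - u n x\<bar> powr p) \<longlonglongrightarrow> \<bar>f x - f x\<bar> powr p"
        using p by (intro tendsto_powr' tendsto_rabs tendsto_diff tendsto_const elim) auto
      then show ?case using p by simp
    qed
    show "AE x in M. norm (\<bar>f x - u n x\<bar> powr p) \<le> \<bar>w x\<bar> powr p" for n
      using bound[of n] by eventually_elim (use p in \<open>auto intro!: powr_mono2\<close>)
  qed (use w in auto)
  then show ?thesis by simp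
qed

text \<open>
  A function is first truncated, and the truncation is an almost everywhere limit of continuous functions, which can be
  truncated at the same height; dominated convergence applies both times. Continuous functions are approximated
  uniformly on the cube by Weierstrass.
\<close>
lemma polynomials_dense:
  assumes p: "p > 0" and f: "f \<in> Lp_space p M" and e: "e > 0"
  shows "\<exists>c. fin_supp c \<and> Lp_mass p M (\<lambda>x. f x - jacobi_sum c x) < e"
proof -
  have fm [measurable]: "f \<in> borel_measurable borel" using Lp_spaceD(1)[OF f] by simp
  define clip :: "real \<Rightarrow> real \<Rightarrow> real" where "clip k t = max (- k) (min k t)" for k t
  have clip_le: "\<bar>clip k t\<bar> \<le> k" if "k \<ge> 0" for k t using that by (auto simp: clip_def)
  have clip_cont: "continuous_on A (\<lambda>x. clip k (g x))" if "continuous_on A g" for A k and g :: "real^'d \<Rightarrow> real"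
    unfolding clip_def by (intro continuous_intros that)
  have clip_meas [measurable]: "(\<lambda>x. clip k (g x)) \<in> borel_measurable borel" if [measurable]: "g \<in> borel_measurable borel" for k and g :: "real^'d \<Rightarrow> real"
    unfolding clip_def by measurable
  define K where "K = 2 powr p * (1 + 2 powr p * 2)"
  have K: "K > 0" by (simp add: K_def add_pos_pos)
  define \<delta> where "\<delta> = e / (2 * K)"
  have \<delta>: "\<delta> > 0" using e K by (simp add: \<delta>_def)
  have "(\<lambda>n. Lp_mass p M (\<lambda>x. f x - clip (real n) (f x))) \<longlonglongrightarrow> 0"
  proof (rule Lp_mass_bounded_tendsto[OF p _ _ _ Lp_spaceD(2)[OF f]])
    show "AE x in M. (\<lambda>n. clip (real n) (f x)) \<longlonglongrightarrow> f x"
    proof (rule AE_I2)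
      fix x
      obtain N :: nat where N: "\<bar>f x\<bar> \<le> real N" using real_arch_simple by blast
      have "eventually (\<lambda>n. clip (real n) (f x) = f x) sequentially"
        using eventually_ge_at_top[of N] by eventually_elim (use N in \<open>auto simp: clip_def\<close>)
      then show "(\<lambda>n. clip (real n) (f x)) \<longlonglongrightarrow> f x" by (rule tendsto_eventually)
    qed
    show "AE x in M. \<bar>f x - clip (real n) (f x)\<bar> \<le> \<bar>f x\<bar>" for n by (rule AE_I2) (auto simp: clip_def)
  qed (use fm in auto)
  then have "eventually (\<lambda>n. Lp_mass p M (\<lambda>x. f x - clip (real n) (f x)) < \<delta>) sequentially"
    using \<delta> by (rule order_tendstoD(2))
  then obtain k :: nat where k: "Lp_mass p M (\<lambda>x. f x - clip (real k) (f x)) < \<delta>" by (auto simp: eventually_sequentially)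
  have "f \<in> borel_measurable lebesgue" by (rule borel_measurable_subalgebra[OF _ _ fm]) (auto simp: sets_completionI_sets)
  then have "f measurable_on UNIV" by (rule lebesgue_measurable_imp_measurable_on_real) simp
  then obtain Z g where Z: "negligible Z" and g: "\<And>n. continuous_on UNIV (g n)" "\<And>x. x \<notin> Z \<Longrightarrow> (\<lambda>n. g n x) \<longlonglongrightarrow> f x"
    unfolding measurable_on_def by auto
  obtain Z' where "Z' \<in> null_sets lborel" "Z \<subseteq> Z'"
    using Z unfolding negligible_iff_null_sets null_sets_completion_iff2 by blast
  then have "AE x in lborel. x \<notin> Z" using AE_not_in[of Z' lborel] by (auto elim!: eventually_mono)
  then have AE_Z: "AE x in M. x \<notin> Z" by (rule AE_M)
  have gm [measurable]: "g n \<in> borel_measurable borel" for n by (rule borel_measurable_continuous_onI[OF g(1)])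
  have "(\<lambda>n. Lp_mass p M (\<lambda>x. clip (real k) (f x) - clip (real k) (g n x))) \<longlonglongrightarrow> 0"
  proof (rule Lp_mass_bounded_tendsto[OF p, where w = "\<lambda>x. 2 * real k"])
    show "AE x in M. (\<lambda>n. clip (real k) (g n x)) \<longlonglongrightarrow> clip (real k) (f x)"
      using AE_Z by eventually_elim (auto simp: clip_def intro!: tendsto_intros g(2))
    show "AE x in M. \<bar>clip (real k) (f x) - clip (real k) (g n x)\<bar> \<le> \<bar>2 * real k\<bar>" for n
    proof (rule AE_I2)
      fix x
      have "\<bar>clip (real k) (f x)\<bar> \<le> real k" "\<bar>clip (real k) (g n x)\<bar> \<le> real k" by (rule clip_le; simp)+
      then show "\<bar>clip (real k) (f x) - clip (real k) (g n x)\<bar> \<le> \<bar>2 * real k\<bar>" by linarith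
    qed
  qed auto
  then have "eventually (\<lambda>n. Lp_mass p M (\<lambda>x. clip (real k) (f x) - clip (real k) (g n x)) < \<delta>) sequentially"
    using \<delta> by (rule order_tendstoD(2))
  then obtain n where n: "Lp_mass p M (\<lambda>x. clip (real k) (f x) - clip (real k) (g n x)) < \<delta>" by (auto simp: eventually_sequentially)
  obtain c where c: "fin_supp c" "Lp_mass p M (\<lambda>x. clip (real k) (g n x) - jacobi_sum c x) \<le> \<delta>"
    using polynomials_dense_continuous[OF p clip_cont[OF g(1)] \<delta>] by blast
  have cL: "(\<lambda>x. clip (real k) (h x)) \<in> Lp_space p M" if [measurable]: "h \<in> borel_measurable borel" for h
    unfolding Lp_space_def
  proof (intro CollectI conjI)
    show "integrable M (\<lambda>x. \<bar>clip (real k) (h x)\<bar> powr p)"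
      by (rule M.integrable_const_bound[of _ "real k powr p"]) (use p clip_le[of "real k"] in \<open>auto intro!: powr_mono2\<close>)
  qed simp
  have "Lp_mass p M (\<lambda>x. clip (real k) (f x) - jacobi_sum c x) \<le> 2 powr p * (\<delta> + \<delta>)"
    using n c(2) by (intro order_trans[OF Lp_mass_triangle[OF p cL[OF fm] cL[OF gm] jacobi_sum_Lp[OF p]]] mult_left_mono add_mono) auto
  then have "Lp_mass p M (\<lambda>x. f x - jacobi_sum c x) \<le> 2 powr p * (\<delta> + 2 powr p * (\<delta> + \<delta>))"
    using k by (intro order_trans[OF Lp_mass_triangle[OF p f cL[OF fm] jacobi_sum_Lp[OF p]]] mult_left_mono add_mono) auto
  also have "\<dots> = K * \<delta>" by (simp add: K_def algebra_simps)
  also have "\<dots> = e / 2" using K by (simp add: \<delta>_def)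
  also have "\<dots> < e" using e by simp
  finally show ?thesis using c(1) by blast
qed

lemma Lp_multiplier_const: "Lp_multiplier p (\<lambda>_. 1)"
  unfolding Lp_multiplier_def by (rule exI[of _ 1]) simp

text \<open>
  The power \<open>\<lambda>^(-a)\<close> is, up to the factor \<open>\<Gamma>(a)\<close>, the integral of \<open>t^(a-1) exp(-t \<lambda>)\<close> over the positive half-line. The part over
  the unit interval is an average of the heat semigroup, hence positive; the rest decays exponentially in \<open>\<lambda>\<close> and is
  covered by the bounded kernel estimate. The symbol is cut off below \<open>1\<close>, which changes it at finitely many indices and
  avoids the eigenvalue \<open>0\<close>.
\<close>
lemma Lp_multiplier_power:
  assumes p: "p > 1" and a: "a > 0"
  shows "Lp_multiplier p (\<lambda>\<kappa>. if eig \<kappa> \<ge> 1 then eig \<kappa> powr (- a) else 0)"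
proof -
  let ?h = "\<lambda>l t. t powr (a - 1) * exp (- (t * l))"
  define q where "q \<kappa> = (LINT t|lborel. indicator {0..1} t * ?h (eig \<kappa>) t)" for \<kappa>
  have Ga: "Gamma a > 0" using a by simp
  have int1: "integrable lborel (\<lambda>t. indicator {0..1} t * ?h l t)" if "l \<ge> 0" for l
  proof (rule Bochner_Integration.integrable_bound)
    show "integrable lborel (\<lambda>t. exp 1 * (indicator {0..} t * ?h 1 t))"
      using Gamma_integral_scaled(1)[OF a, of 1] by (intro integrable_mult_right) simp
    show "AE t in lborel. norm (indicator {0..1} t * ?h l t) \<le> norm (exp 1 * (indicator {0..} t * ?h 1 t))"
    proof (rule AE_I2)
      fix t :: real
      have "?h l t \<le> exp 1 * ?h 1 t" if t: "t \<in> {0..1}"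
      proof -
        have "t * l \<ge> 0" using t \<open>l \<ge> 0\<close> by simp
        then have "- (t * l) \<le> 1 - t" using t by auto
        then have "exp (- (t * l)) \<le> exp (1 - t)" by simp
        then have "t powr (a - 1) * exp (- (t * l)) \<le> t powr (a - 1) * exp (1 - t)" by (rule mult_left_mono) simp
        then show ?thesis by (simp add: exp_diff exp_minus divide_inverse mult_ac)
      qed
      then show "norm (indicator {0..1} t * ?h l t) \<le> norm (exp 1 * (indicator {0..} t * ?h 1 t))"
        by (auto simp: indicator_def abs_mult)
    qed
  qed simp
  have q_nonneg: "q \<kappa> \<ge> 0" for \<kappa> unfolding q_def by (intro Bochner_Integration.integral_nonneg) (auto simp: indicator_def)
  have q_le: "q \<kappa> \<le> q 0" for \<kappa>
    unfolding q_def eig_0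
  proof (rule integral_mono[OF int1 int1])
    fix t :: real
    show "indicator {0..1} t * ?h (eig \<kappa>) t \<le> indicator {0..1} t * ?h 0 t"
      using eig_nonneg[of \<kappa>] by (auto simp: indicator_def intro!: mult_left_le)
  qed (use eig_nonneg in auto)
  have q0: "q 0 > 0"
  proof -
    have "set_integrable lborel {0..1} (?h 0)" using int1[of 0] by (simp add: set_integrable_def)
    then have "q 0 = integral {0..1} (?h 0)"
      using set_borel_integral_eq_integral(2)[of "{0..1}" "?h 0"] by (simp add: q_def eig_0 set_lebesgue_integral_def)
    also have "\<dots> = 1 / a"
      using has_integral_powr_from_0[of "a - 1" 1] a by (simp add: integral_unique)
    finally show ?thesis using a by simp
  qed
  have "positive_symbol q"
  proof (rule positive_symbol_integral[where S = UNIV])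
    \<comment> \<open>The absolute value only serves to have a positive symbol for every real \<open>t\<close>; the weight vanishes for negative \<open>t\<close>.\<close>
    show "positive_symbol (\<lambda>\<kappa>. exp (- (\<bar>t\<bar> * eig \<kappa>)))" for t :: real by (rule positive_symbol_exp) simp
    show "0 \<le> indicator {0..1} t * t powr (a - 1)" for t :: real by simp
    show "((\<lambda>t. indicator {0..1} t * t powr (a - 1) * exp (- (\<bar>t\<bar> * eig \<kappa>))) has_integral q \<kappa>) UNIV" for \<kappa>
    proof -
      have "(\<lambda>t. indicator {0..1} t * t powr (a - 1) * exp (- (\<bar>t\<bar> * eig \<kappa>))) = (\<lambda>t. indicator {0..1} t * ?h (eig \<kappa>) t)"
        by (auto simp: indicator_def)
      then show ?thesis unfolding q_def using has_integral_integral_lborel[OF int1[OF eig_nonneg[of \<kappa>]]] by (simp only:)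
    qed
  qed
  then have mq: "Lp_multiplier p q" using q0 by (rule Lp_multiplier_positive[OF p])
  obtain N where N: "N > 0" "\<And>m C. (\<And>\<kappa>. \<bar>m \<kappa>\<bar> \<le> C * (1 + eig \<kappa>) powr (- N)) \<Longrightarrow> Lp_multiplier p m"
    by (rule Lp_multiplier_decay[OF p]) blast
  define r where "r \<kappa> = (if eig \<kappa> \<ge> 1 then eig \<kappa> powr (- a) else 0) - (1 / Gamma a) * q \<kappa>" for \<kappa>
  have tail: "\<bar>r \<kappa>\<bar> \<le> exp 1 * exp (- eig \<kappa>)" if l: "eig \<kappa> \<ge> 1" for \<kappa>
  proof -
    let ?l = "eig \<kappa>"
    have lpos: "?l > 0" using l by linarith
    note I = Gamma_integral_scaled[OF a lpos] and I1 = Gamma_integral_scaled[OF a zero_less_one]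
    have "Gamma a * ?l powr (- a) - q \<kappa> = (LINT t|lborel. indicator {0..} t * ?h ?l t - indicator {0..1} t * ?h ?l t)"
      unfolding q_def using I int1[of ?l] lpos by simp
    also have "\<dots> = (LINT t|lborel. indicator {1<..} t * ?h ?l t)"
      by (intro Bochner_Integration.integral_cong) (auto simp: indicator_def)
    finally have e: "Gamma a * ?l powr (- a) - q \<kappa> = (LINT t|lborel. indicator {1<..} t * ?h ?l t)" .
    have "(LINT t|lborel. indicator {1<..} t * ?h ?l t) \<le> (LINT t|lborel. exp (1 - ?l) * (indicator {0..} t * ?h 1 t))"
    proof (rule integral_mono')
      show "integrable lborel (\<lambda>t. exp (1 - ?l) * (indicator {0..} t * ?h 1 t))" using I1(1) by (rule integrable_mult_right)
      fix t :: real
      show "indicator {1<..} t * ?h ?l t \<le> exp (1 - ?l) * (indicator {0..} t * ?h 1 t)"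
      proof (cases "t > 1")
        case True
        have "(t - 1) * (?l - 1) \<ge> 0" using True l by (intro mult_nonneg_nonneg) auto
        then have "exp (- (t * ?l)) \<le> exp ((1 - ?l) + - t)" by (simp add: algebra_simps)
        then have "t powr (a - 1) * exp (- (t * ?l)) \<le> t powr (a - 1) * exp ((1 - ?l) + - t)" by (rule mult_left_mono) simp
        also have "\<dots> = exp (1 - ?l) * (t powr (a - 1) * exp (- t))" unfolding exp_add by simp
        finally show ?thesis using True by simp
      qed (auto simp: indicator_def)
      show "0 \<le> exp (1 - ?l) * (indicator {0..} t * ?h 1 t)" by simp
    qed
    also have "\<dots> = exp (1 - ?l) * Gamma a" using I1(2) by simp
    finally have le: "Gamma a * ?l powr (- a) - q \<kappa> \<le> Gamma a * exp (1 - ?l)" unfolding e by (simp add: mult.commute)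
    have ge: "Gamma a * ?l powr (- a) - q \<kappa> \<ge> 0" unfolding e by (intro Bochner_Integration.integral_nonneg) (auto simp: indicator_def)
    have r: "r \<kappa> = (Gamma a * ?l powr (- a) - q \<kappa>) / Gamma a" using l Ga by (simp add: r_def diff_divide_distrib)
    have "r \<kappa> \<ge> 0" unfolding r using ge Ga by simp
    moreover have "r \<kappa> \<le> exp (1 - ?l)" unfolding r using le Ga by (simp add: divide_le_eq mult.commute)
    ultimately show ?thesis by (simp add: exp_diff exp_minus divide_inverse)
  qed
  define C where "C = q 0 / Gamma a * 2 powr N + exp 1 * (N powr N * exp 1)"
  have C1: "q 0 / Gamma a * 2 powr N \<ge> 0" using q0 Ga by simp
  have "\<bar>r \<kappa>\<bar> \<le> C * (1 + eig \<kappa>) powr (- N)" for \<kappa>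
  proof (cases "eig \<kappa> \<ge> 1")
    case True
    have "\<bar>r \<kappa>\<bar> \<le> exp 1 * exp (- eig \<kappa>)" by (rule tail[OF True])
    also have "\<dots> \<le> exp 1 * ((N powr N * exp 1) * (1 + eig \<kappa>) powr (- N))"
      by (intro mult_left_mono exp_minus_le_powr N eig_nonneg) auto
    also have "\<dots> \<le> C * (1 + eig \<kappa>) powr (- N)" unfolding C_def mult.assoc[symmetric]
      using C1 by (intro mult_right_mono) (auto simp: mult.assoc)
    finally show ?thesis .
  next
    case False
    have "\<bar>r \<kappa>\<bar> = q \<kappa> / Gamma a" using False q_nonneg[of \<kappa>] Ga by (simp add: r_def)
    also have "\<dots> \<le> q 0 / Gamma a" using q_le[of \<kappa>] Ga by (intro divide_right_mono) auto
    also have "\<dots> = q 0 / Gamma a * 2 powr N * 2 powr (- N)" by (simp flip: powr_add)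
    also have "\<dots> \<le> q 0 / Gamma a * 2 powr N * (1 + eig \<kappa>) powr (- N)"
      using False N(1) eig_nonneg[of \<kappa>] C1 by (intro mult_left_mono powr_mono2') auto
    also have "\<dots> \<le> C * (1 + eig \<kappa>) powr (- N)" unfolding C_def by (intro mult_right_mono) auto
    finally show ?thesis .
  qed
  then have "Lp_multiplier p r" by (rule N(2))
  moreover have "Lp_multiplier p (\<lambda>\<kappa>. (1 / Gamma a) * q \<kappa>)" using p mq by (intro Lp_multiplier_scale) auto
  ultimately have "Lp_multiplier p (\<lambda>\<kappa>. r \<kappa> + (1 / Gamma a) * q \<kappa>)" using p by (intro Lp_multiplier_add) auto
  then show ?thesis unfolding r_def by simp
qed

text \<open>
  Finitely many Taylor terms of \<open>h\<close> give fractional powers of the eigenvalue. The order is chosen so high that the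
  remainder decays fast enough for the bounded kernel estimate; the finitely many small eigenvalues are harmless.
\<close>
lemma Lp_multiplier_analytic:
  assumes p: "p > 1" and \<gamma>: "\<gamma> > 0" and F: "h has_fps_expansion F"
    and \<phi>: "\<And>\<kappa>. eig \<kappa> \<ge> R \<Longrightarrow> \<phi> \<kappa> = h (1 / eig \<kappa> powr \<gamma>)"
  shows "Lp_multiplier p \<phi>"
proof -
  obtain N where N: "N > 0" "\<And>m C. (\<And>\<kappa>. \<bar>m \<kappa>\<bar> \<le> C * (1 + eig \<kappa>) powr (- N)) \<Longrightarrow> Lp_multiplier p m"
    by (rule Lp_multiplier_decay[OF p]) blast
  obtain J :: nat where J: "N / \<gamma> \<le> real J" using real_arch_simple by blast
  have NJ: "N \<le> \<gamma> * real J" using J \<gamma> by (simp add: divide_le_eq mult.commute)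
  obtain a B where ev: "eventually (\<lambda>t. \<bar>h t - (\<Sum>j<J. a j * t ^ j)\<bar> \<le> B * \<bar>t\<bar> ^ J) (nhds 0)"
    using fps_expansion_polynomial_approx[OF F, of J] by blast
  have "((\<lambda>l. 1 / l powr \<gamma>) \<longlongrightarrow> 0) at_top"
  proof -
    have "((\<lambda>l::real. l powr (- \<gamma>)) \<longlongrightarrow> 0) at_top" using \<gamma> by (intro tendsto_neg_powr filterlim_ident) auto
    then show ?thesis by (simp add: powr_minus_divide)
  qed
  then have "eventually (\<lambda>l. \<bar>h (1 / l powr \<gamma>) - (\<Sum>j<J. a j * (1 / l powr \<gamma>) ^ j)\<bar> \<le> B * \<bar>1 / l powr \<gamma>\<bar> ^ J) at_top"
    using ev unfolding filterlim_def le_filter_def eventually_filtermap by blast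
  then obtain R0 where R0: "\<And>l. l \<ge> R0 \<Longrightarrow> \<bar>h (1 / l powr \<gamma>) - (\<Sum>j<J. a j * (1 / l powr \<gamma>) ^ j)\<bar> \<le> B * \<bar>1 / l powr \<gamma>\<bar> ^ J"
    unfolding eventually_at_top_linorder by blast
  define R1 where "R1 = max 1 (max R R0)"
  define s where "s j = (if j = 0 then (\<lambda>_. 1) else (\<lambda>\<kappa>. if eig \<kappa> \<ge> 1 then eig \<kappa> powr (- (\<gamma> * real j)) else 0))" for j :: nat
  have s: "Lp_multiplier p (s j)" for j
  proof (cases "j = 0")
    case True
    then show ?thesis using Lp_multiplier_const by (simp add: s_def)
  next
    case False
    then show ?thesis using Lp_multiplier_power[OF p, of "\<gamma> * real j"] \<gamma> by (simp add: s_def)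
  qed
  have s_pow: "s j \<kappa> = (1 / eig \<kappa> powr \<gamma>) ^ j" if "eig \<kappa> \<ge> 1" for j \<kappa>
  proof (cases "j = 0")
    case False
    have "(1 / eig \<kappa> powr \<gamma>) ^ j = (eig \<kappa> powr (- \<gamma>)) powr real j"
      using that by (subst powr_realpow) (auto simp: powr_minus_divide)
    also have "\<dots> = eig \<kappa> powr (- (\<gamma> * real j))" by (simp add: powr_powr)
    finally show ?thesis using that False by (simp add: s_def)
  qed (simp add: s_def)
  define r where "r \<kappa> = \<phi> \<kappa> - (\<Sum>j<J. a j * s j \<kappa>)" for \<kappa>
  have big: "\<bar>r \<kappa>\<bar> \<le> (\<bar>B\<bar> * 2 powr N) * (1 + eig \<kappa>) powr (- N)" if l: "eig \<kappa> \<ge> R1" for \<kappa>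
  proof -
    have l': "eig \<kappa> \<ge> 1" "eig \<kappa> \<ge> R" "eig \<kappa> \<ge> R0" using l by (auto simp: R1_def)
    have "\<bar>r \<kappa>\<bar> \<le> B * \<bar>1 / eig \<kappa> powr \<gamma>\<bar> ^ J"
      using R0[OF l'(3)] unfolding r_def \<phi>[OF l'(2)] s_pow[OF l'(1)] .
    also have "\<dots> \<le> \<bar>B\<bar> * \<bar>1 / eig \<kappa> powr \<gamma>\<bar> ^ J" by (intro mult_right_mono) auto
    also have "\<bar>1 / eig \<kappa> powr \<gamma>\<bar> ^ J = (eig \<kappa> powr (- \<gamma>)) powr real J"
      using l'(1) by (subst powr_realpow) (auto simp: powr_minus_divide)
    also have "\<dots> = eig \<kappa> powr (- (\<gamma> * real J))" by (simp add: powr_powr)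
    also have "\<dots> \<le> eig \<kappa> powr (- N)" using NJ l'(1) by (intro powr_mono) auto
    also have "\<dots> \<le> ((1 + eig \<kappa>) / 2) powr (- N)" using l'(1) N(1) by (intro powr_mono2') auto
    also have "\<dots> = 2 powr N * (1 + eig \<kappa>) powr (- N)" using l'(1) by (simp add: powr_divide powr_minus_divide)
    finally show ?thesis by (simp add: mult.assoc mult_left_mono)
  qed
  have fin: "finite {\<kappa>. eig \<kappa> \<le> R1}" by (rule finite_eig_le)
  define D where "D = (\<Sum>\<kappa> | eig \<kappa> \<le> R1. \<bar>r \<kappa>\<bar>)"
  have D0: "D \<ge> 0" unfolding D_def by (intro sum_nonneg) auto
  have small: "\<bar>r \<kappa>\<bar> \<le> (D * (1 + R1) powr N) * (1 + eig \<kappa>) powr (- N)" if l: "eig \<kappa> \<le> R1" for \<kappa>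
  proof -
    have rD: "\<bar>r \<kappa>\<bar> \<le> D" unfolding D_def using fin l by (intro member_le_sum) auto
    have "1 + R1 > 0" by (simp add: R1_def max_def)
    then have "1 \<le> (1 + R1) powr N * (1 + R1) powr (- N)" by (simp flip: powr_add)
    also have "\<dots> \<le> (1 + R1) powr N * (1 + eig \<kappa>) powr (- N)"
      using l N(1) eig_nonneg[of \<kappa>] by (intro mult_left_mono powr_mono2') auto
    finally have "D * 1 \<le> D * ((1 + R1) powr N * (1 + eig \<kappa>) powr (- N))" using D0 by (intro mult_left_mono)
    then show ?thesis using rD by (simp add: mult.assoc)
  qed
  have "\<bar>r \<kappa>\<bar> \<le> (\<bar>B\<bar> * 2 powr N + D * (1 + R1) powr N) * (1 + eig \<kappa>) powr (- N)" for \<kappa>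
  proof (cases "eig \<kappa> \<ge> R1")
    case True
    have "(\<bar>B\<bar> * 2 powr N) * (1 + eig \<kappa>) powr (- N) \<le> (\<bar>B\<bar> * 2 powr N + D * (1 + R1) powr N) * (1 + eig \<kappa>) powr (- N)"
      using D0 by (intro mult_right_mono) auto
    then show ?thesis using big[OF True] by linarith
  next
    case False
    have "(D * (1 + R1) powr N) * (1 + eig \<kappa>) powr (- N) \<le> (\<bar>B\<bar> * 2 powr N + D * (1 + R1) powr N) * (1 + eig \<kappa>) powr (- N)"
      by (intro mult_right_mono) auto
    then show ?thesis using small[of \<kappa>] False by linarith
  qed
  then have "Lp_multiplier p r" by (rule N(2))
  moreover have "Lp_multiplier p (\<lambda>\<kappa>. \<Sum>j<J. a j * s j \<kappa>)"
    using p by (intro Lp_multiplier_sum Lp_multiplier_scale s) auto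
  ultimately have "Lp_multiplier p (\<lambda>\<kappa>. r \<kappa> + (\<Sum>j<J. a j * s j \<kappa>))" using p by (intro Lp_multiplier_add) auto
  then show ?thesis unfolding r_def by simp
qed

text \<open>
  The eigenspaces partition the indices, so the series over eigenvalues regroups the finite sum over indices.
\<close>
lemma jacobi_multiplier_jacobi_sum:
  assumes c: "fin_supp c" and idx: "\<And>\<kappa>. jacobi_r \<alpha> \<beta> (idx \<kappa>) = eig \<kappa>"
  shows "jacobi_multiplier \<alpha> \<beta> \<Phi> (jacobi_sum c) x = jacobi_sum (\<lambda>\<kappa>. \<Phi> (idx \<kappa>) * c \<kappa>) x"
proof -
  let ?F = "{\<kappa>. c \<kappa> \<noteq> 0}"
  have index: "\<kappa> \<in> jacobi_index \<alpha> \<beta> n \<longleftrightarrow> idx \<kappa> = n" for \<kappa> n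
    unfolding jacobi_index_def idx[symmetric] using strict_mono_eq[OF jacobi_r_enumerates(1)] by auto
  have fin: "finite (jacobi_index \<alpha> \<beta> n)" for n
    by (rule finite_subset[OF _ finite_eig_le[of "jacobi_r \<alpha> \<beta> n"]]) (auto simp: jacobi_index_def)
  have proj: "jacobi_proj \<alpha> \<beta> n (jacobi_sum c) x = (\<Sum>\<kappa> | \<kappa> \<in> ?F \<and> idx \<kappa> = n. c \<kappa> * P \<kappa> x)" for n
    unfolding jacobi_proj_def jacobi_coeff_jacobi_sum[OF c]
    by (rule sum.mono_neutral_right[OF fin]) (auto simp: index)
  have "jacobi_multiplier \<alpha> \<beta> \<Phi> (jacobi_sum c) x = (\<Sum>n\<in>idx ` ?F. \<Phi> n * jacobi_proj \<alpha> \<beta> n (jacobi_sum c) x)"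
    unfolding jacobi_multiplier_def
  proof (rule suminf_finite)
    fix n assume "n \<notin> idx ` ?F"
    then have "{\<kappa>. \<kappa> \<in> ?F \<and> idx \<kappa> = n} = {}" by auto
    then show "\<Phi> n * jacobi_proj \<alpha> \<beta> n (jacobi_sum c) x = 0" unfolding proj by (simp only: sum.empty mult_zero_right)
  qed (use c in auto)
  also have "\<dots> = (\<Sum>n\<in>idx ` ?F. \<Sum>\<kappa> | \<kappa> \<in> ?F \<and> idx \<kappa> = n. \<Phi> (idx \<kappa>) * c \<kappa> * P \<kappa> x)"
    unfolding proj by (intro sum.cong refl) (auto simp: sum_distrib_left mult.assoc)
  also have "\<dots> = (\<Sum>\<kappa>\<in>?F. \<Phi> (idx \<kappa>) * c \<kappa> * P \<kappa> x)"
    using c by (intro sum.group) auto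
  finally show ?thesis unfolding jacobi_sum_mult[OF c] .
qed

lemma Lp_multiplier_extension:
  assumes p: "p > 1" and m: "Lp_multiplier p m"
  shows "\<exists>T. Lp_bounded_linear p M T \<and> (\<forall>c. fin_supp c \<longrightarrow> (AE x in M. T (jacobi_sum c) x = jacobi_sum (\<lambda>\<kappa>. m \<kappa> * c \<kappa>) x))"
proof -
  obtain C where C: "C \<ge> 0" "\<And>c. fin_supp c \<Longrightarrow> Lp_mass p M (jacobi_sum (\<lambda>\<kappa>. m \<kappa> * c \<kappa>)) \<le> C * Lp_mass p M (jacobi_sum c)"
    using m unfolding Lp_multiplier_def by blast
  define V where "V = {f. \<exists>c. fin_supp c \<and> f = jacobi_sum c}"
  define S where "S f = jacobi_sum (\<lambda>\<kappa>. m \<kappa> * jacobi_coeff \<alpha> \<beta> f \<kappa>)" for f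
  have S: "S (jacobi_sum c) = jacobi_sum (\<lambda>\<kappa>. m \<kappa> * c \<kappa>)" if "fin_supp c" for c
    unfolding S_def jacobi_coeff_jacobi_sum[OF that] ..
  have p0: "p > 0" using p by simp
  interpret dense_Lp_operator M p C V S
  proof
    fix f assume "f \<in> V"
    then obtain c where c: "fin_supp c" "f = jacobi_sum c" unfolding V_def by blast
    show "f \<in> Lp_space p M" "S f \<in> Lp_space p M" unfolding c(2) S[OF c(1)] by (rule jacobi_sum_Lp[OF p0])+
    show "Lp_mass p M (S f) \<le> C * Lp_mass p M f" unfolding c(2) S[OF c(1)] by (rule C(2)[OF c(1)])
  next
    fix f g and a b :: real assume "f \<in> V" "g \<in> V"
    then obtain c d where c: "fin_supp c" "f = jacobi_sum c" and d: "fin_supp d" "g = jacobi_sum d" unfolding V_def by blast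
    have lin: "(\<lambda>x. a * f x + b * g x) = jacobi_sum (\<lambda>\<kappa>. a * c \<kappa> + b * d \<kappa>)"
      unfolding c(2) d(2) jacobi_sum_linear[OF c(1) d(1), abs_def] ..
    show "(\<lambda>x. a * f x + b * g x) \<in> V" unfolding lin V_def
      by (rule CollectI, rule exI, rule conjI[OF fin_supp_linear[OF c(1) d(1)] refl])
    have "S (\<lambda>x. a * f x + b * g x) = jacobi_sum (\<lambda>\<kappa>. m \<kappa> * (a * c \<kappa> + b * d \<kappa>))"
      unfolding lin by (rule S[OF fin_supp_linear[OF c(1) d(1)]])
    also have "(\<lambda>\<kappa>. m \<kappa> * (a * c \<kappa> + b * d \<kappa>)) = (\<lambda>\<kappa>. a * (m \<kappa> * c \<kappa>) + b * (m \<kappa> * d \<kappa>))"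
      by (simp add: algebra_simps)
    also have "jacobi_sum \<dots> = (\<lambda>x. a * S f x + b * S g x)"
      unfolding c(2) d(2) S[OF c(1)] S[OF d(1)]
      by (rule ext, rule jacobi_sum_linear[OF fin_supp_mult[OF c(1)] fin_supp_mult[OF d(1)]])
    finally show "S (\<lambda>x. a * f x + b * g x) = (\<lambda>x. a * S f x + b * S g x)" .
  next
    fix f and e :: real assume "f \<in> Lp_space p M" "0 < e"
    then show "\<exists>g\<in>V. Lp_mass p M (\<lambda>x. f x - g x) < e" using polynomials_dense[OF p0] unfolding V_def by blast
  qed (use p C in auto)
  obtain T where T: "Lp_bounded_linear p M T" "\<And>f. f \<in> V \<Longrightarrow> AE x in M. T f x = S f x"
    using bounded_extension by blast
  have "AE x in M. T (jacobi_sum c) x = jacobi_sum (\<lambda>\<kappa>. m \<kappa> * c \<kappa>) x" if c: "fin_supp c" for c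
    using T(2)[of "jacobi_sum c"] c unfolding S[OF c] V_def by blast
  then show ?thesis using T(1) by blast
qed

end

theorem theorem3p2:
  fixes \<alpha> \<beta> :: "real ^ 'd"
    and p \<gamma> :: real
    and \<Phi> :: "nat \<Rightarrow> real"
    and n\<^sub>0 :: nat
    and h :: "real \<Rightarrow> real"
    and U :: "real set"
  assumes "\<And>i. \<alpha> $ i > - 1 / 2"
    and "\<And>i. \<beta> $ i > - 1 / 2"
    and "1 < p"
    and "0 < \<gamma>" and "\<gamma> < 1"
    and "open U" and "0 \<in> U" and "real_analytic_on h U"
    and "\<And>k. k \<ge> n\<^sub>0 \<Longrightarrow> jacobi_r \<alpha> \<beta> k > 0 \<and> 1 / jacobi_r \<alpha> \<beta> k powr \<gamma> \<in> U"
    and "\<And>k. k \<ge> n\<^sub>0 \<Longrightarrow> \<Phi> k = h (1 / jacobi_r \<alpha> \<beta> k powr \<gamma>)"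
  shows "\<exists>T. Lp_bounded_linear p (jacobi_measure \<alpha> \<beta>) T \<and>
           (\<forall>f. real_polynomial_function f \<longrightarrow>
              (AE x in jacobi_measure \<alpha> \<beta>. T f x = jacobi_multiplier \<alpha> \<beta> \<Phi> f x))"
proof -
  interpret jacobi_parameters \<alpha> \<beta> by standard (use assms(1,2) in auto)
  obtain F where F: "h has_fps_expansion F"
    using assms(7,8) unfolding real_analytic_on_def by auto
  have "\<exists>n. jacobi_r \<alpha> \<beta> n = eig \<kappa>" for \<kappa> using jacobi_r_enumerates(2) by (metis rangeE rangeI)
  then obtain idx where idx: "\<And>\<kappa>. jacobi_r \<alpha> \<beta> (idx \<kappa>) = eig \<kappa>" by metis
  have "Lp_multiplier p (\<lambda>\<kappa>. \<Phi> (idx \<kappa>))"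
  proof (rule Lp_multiplier_analytic[OF \<open>1 < p\<close> \<open>0 < \<gamma>\<close> F])
    fix \<kappa> assume "jacobi_r \<alpha> \<beta> n\<^sub>0 \<le> eig \<kappa>"
    then have "n\<^sub>0 \<le> idx \<kappa>" unfolding idx[symmetric] using strict_mono_less_eq[OF jacobi_r_enumerates(1)] by blast
    then show "\<Phi> (idx \<kappa>) = h (1 / eig \<kappa> powr \<gamma>)" using assms(10) idx by simp
  qed
  then obtain T where T: "Lp_bounded_linear p M T"
      "\<And>c. fin_supp c \<Longrightarrow> AE x in M. T (jacobi_sum c) x = jacobi_sum (\<lambda>\<kappa>. \<Phi> (idx \<kappa>) * c \<kappa>) x"
    using Lp_multiplier_extension[OF \<open>1 < p\<close>] by blast
  have "AE x in M. T f x = jacobi_multiplier \<alpha> \<beta> \<Phi> f x" if f: "real_polynomial_function f" for f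
  proof -
    obtain c where c: "fin_supp c" "f = jacobi_sum c" using real_polynomial_function_jacobi_sum[OF f] by blast
    show ?thesis using T(2)[OF c(1)] unfolding c(2) jacobi_multiplier_jacobi_sum[OF c(1) idx] .
  qed
  then show ?thesis using T(1) by blast
qed

end
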